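(* Let $N\ge1$. The algebra $E_N^1=\bigoplus_{\lambda,\mu\in\Lambda_N^1}\operatorname{Ext}_{K_N^1}(M(\lambda),M(\mu))=H^*(A)$, where $A=\bigoplus_{\lambda,\mu}\operatorname{Hom}^\bullet(P_\bullet(\lambda),P_\bullet(\mu))$, is formal; i.e. there is a minimal model of $A$ on $E_N^1$ such that $m_l=0$ for all $l\ge3$.
   Context: **Weights.** $\Lambda_m^n$ is the set of sequences of $n$ symbols $\wedge$ and $m$ symbols $\vee$ placed on the vertices $I=\{0,1,\dots,m+n-1\}$ of the real line. Here $n=1$, $m=N$. **Diagrams.** A cup diagram on $I$ consists of pairwise non-crossing cups (lower semicircles joining two vertices) and rays (from a vertex down to infinity), each vertex lying on exactly one cup or ray; cap diagrams are mirror images, and $*$ denotes mirror image. A cup diagram $c$ together with a weight $\lambda$ is an oriented cup diagram $c\lambda$ if each cup has one end labeled $\vee$ and one labeled $\wedge$, and there are no two rays labeled $\vee,\wedge$ in this order from left to right. Oriented cap diagrams $\lambda b$ are defined by mirror image. An oriented circle diagram $a\lambda b$ consists of an oriented cup diagram $a\lambda$ and an oriented cap diagram $\lambda b$. The degree of an oriented diagram is its number of clockwise cups and caps (those with left end $\wedge$ and right end $\vee$). For $\lambda\in\Lambda_m^n$, $\underline\lambda$ is the unique cup diagram such that $\underline\lambda\lambda$ is oriented of degree $0$, and $\overline\lambda=(\underline\lambda)^*$. **The algebra $K_m^n$** (Khovanov diagram algebra) is the graded $\mathbb C$-algebra with basis the oriented circle diagrams $(\underline\alpha\lambda\overline\beta)$,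 $\alpha,\beta,\lambda\in\Lambda_m^n$, graded by degree. Its product can be described as follows. For $\lambda\in\Lambda_m^n$ let $\mathrm{cl}(\lambda)$ be the weight with $n$ additional $\vee$'s at the left and $m$ additional $\wedge$'s at the right. Let $H$ be Khovanov's arc algebra on $2(m+n)$ points, with basis the oriented circle diagrams without rays, and multiplication given by the surgery procedure for the Frobenius algebra $\mathbb C[x]/(x^2)$ (with $\Delta(1)=1\otimes x+x\otimes 1$, $\Delta(x)=x\otimes x$; anticlockwise circles are $1$, clockwise circles are $x$). Then $K_m^n$ is the quotient of $\bigoplus_{\alpha,\beta}e_{\mathrm{cl}(\alpha)}He_{\mathrm{cl}(\beta)}$ by the ideal spanned by the basis diagrams $(\underline{\mathrm{cl}(\alpha)}\,\nu\,\overline{\mathrm{cl}(\beta)})$ with $\nu\notin\mathrm{cl}(\Lambda_m^n)$, the class of $(\underline{\mathrm{cl}(\alpha)}\,\mathrm{cl}(\lambda)\,\overline{\mathrm{cl}(\beta)})$ being identified with $(\underline\alpha\lambda\overline\beta)$. Put $e_\lambda=(\underline\lambda\lambda\overline\lambda)$. **Modules.** All modules are finite dimensional left modules. $P(\lambda)=K_m^ne_\lambda$; the cell module $M(\lambda)$ is the quotient of $P(\lambda)$ by the submodule spanned by the basis elements $(c\nu\overline\lambda)$ with $\nu\ne\lambda$. For a graded module, $M\langle i\rangle_j=M_{j-i}$. (By a theorem of Brundan and Stroppel, $K_m^n$-mod is equivalent to the principal block of $\mathcal O^{\mathfrak p}$ for $\mathfrak{gl}_{m+n}(\mathbb C)$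 with Levi $\mathfrak{gl}_m\oplus\mathfrak{gl}_n$, cell modules corresponding to parabolic Verma modules.) **Resolutions and the dg algebra.** For each $\lambda$ fix a linear projective resolution $P_\bullet(\lambda)\to M(\lambda)$: a finite graded projective resolution with $P_0(\lambda)=P(\lambda)$ and $P_i(\lambda)$ a finite direct sum of modules $P(\mu)\langle i\rangle$. Let $\operatorname{Hom}^r(P_\bullet(\lambda),P_\bullet(\mu))=\prod_p\operatorname{Hom}_{K_m^n}(P_p(\lambda),P_{p-r}(\mu))$. On $A$ the product is composition written from left to right, $(\alpha\cdot\beta)(x)=\beta(\alpha(x))$, and the differential is $d(f)=(-1)^r(\partial\circ f-(-1)^rf\circ\partial)$ for $f$ of degree $r$, where $\partial$ denotes the differentials of the resolutions; this is a dg algebra, viewed as an $A_\infty$-algebra with $m_1=d$, $m_2$ the product and $m_l=0$ for $l\ge3$. **$A_\infty$-notions.** An $A_\infty$-algebra is a $\mathbb Z$-graded vector space $A$ with graded linear maps $m_l:A^{\otimes l}\to A$ of degree $2-l$, $l\ge1$, such that for all $l$: $\sum_{l=r+s+t,\ s\ge1,\ r,t\ge0}(-1)^{r+st}m_{r+t+1}(\mathrm{Id}^{\otimes r}\otimes m_s\otimes\mathrm{Id}^{\otimes t})=0$ (Koszul sign rule $(f\otimes g)(x\otimes y)=(-1)^{|g||x|}f(x)\otimes g(y)$). A morphism $f:A\to B$ is a family $f_l:A^{\otimes l}\to B$ of degree $1-l$ with $\sum(-1)^{r+st}f_{r+t+1}(\mathrm{Id}^{\otimes r}\otimes m_s\otimes\mathrm{Id}^{\otimes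 t})=\sum(-1)^wm_q(f_{i_1}\otimes\dots\otimes f_{i_q})$, sums over $l=r+s+t$ and over $l=i_1+\dots+i_q$ with all $i_j\ge1$, $w=\sum_{j=1}^{q-1}(q-j)(i_j-1)$; it is a quasi-isomorphism if $f_1$ is. A minimal model of $A$ is an $A_\infty$-structure on $H^*(A)$ with $m_1=0$ and $m_2$ induced by the product of $A$, together with an $A_\infty$-quasi-isomorphism $H^*(A)\to A$ lifting the identity of $H^*(A)$. *)

theory Defs
  imports Complex_Main "HOL-Algebra.Algebraic_Closure_Type" "HOL-Algebra.AbelCoset"
begin

section \<open>Weights and cup diagrams\<close>

datatype arrow = Wedge | Vee

type_synonym weight = "arrow list"

definition weights :: "nat \<Rightarrow> nat \<Rightarrow> weight set" where
  "weights m n = {w. count_list w Wedge = n \<and> count_list w Vee = m}"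

text \<open>
  A cup diagram on the vertices \<open>0, \<dots>, k - 1\<close> is given by the set of its cups
  \<open>(i, j)\<close> with \<open>i < j\<close>; the vertices that lie on no cup carry a ray.  A cap diagram is
  given by the cup diagram that is its mirror image, so that \<open>b\<close> and \<open>b\<^sup>*\<close> are the same set
  of pairs.
\<close>

type_synonym cups = "(nat \<times> nat) set"

definition rays :: "nat \<Rightarrow> cups \<Rightarrow> nat set" where
  "rays k c = {v. v < k \<and> (\<forall>(i, j) \<in> c. v \<noteq> i \<and> v \<noteq> j)}"

definition cup_diagram :: "nat \<Rightarrow> cups \<Rightarrow> bool" where
  "cup_diagram k c \<longleftrightarrow>
     (\<forall>(i, j) \<in> c. i < j \<and> j < k) \<and>
     (\<forall>p \<in> c. \<forall>q \<in> c. p \<noteq> q \<longrightarrow> {fst p, snd p} \<inter> {fst q, snd q} = {}) \<and>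
     \<not> (\<exists>(i, j) \<in> c. \<exists>(i', j') \<in> c. i < i' \<and> i' < j \<and> j < j') \<and>
     \<not> (\<exists>(i, j) \<in> c. \<exists>v \<in> rays k c. i < v \<and> v < j)"

definition oriented :: "cups \<Rightarrow> weight \<Rightarrow> bool" where
  "oriented c w \<longleftrightarrow>
     (\<forall>(i, j) \<in> c. w ! i \<noteq> w ! j) \<and>
     \<not> (\<exists>i \<in> rays (length w) c. \<exists>j \<in> rays (length w) c. i < j \<and> w ! i = Vee \<and> w ! j = Wedge)"

definition num_clockwise :: "cups \<Rightarrow> weight \<Rightarrow> nat" where
  "num_clockwise c w = card {(i, j) \<in> c. w ! i = Wedge \<and> w ! j = Vee}"

definition underline :: "weight \<Rightarrow> cups" where
  "underline w = (THE c. cup_diagram (length w) c \<and> oriented c w \<and> num_clockwise c w = 0)"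


section \<open>Khovanov's arc algebra\<close>

text \<open>
  A basis diagram of the arc algebra is a triple \<open>(a, \<nu>, b)\<close> of a cup diagram, a weight and a
  cap diagram, without rays.  A closed circle is oriented anticlockwise precisely if its
  leftmost vertex is labelled \<open>Vee\<close>, that is, if the circle runs downwards there.
\<close>

type_synonym arc_diagram = "cups \<times> weight \<times> cups"

definition circle :: "('v \<times> 'v) set \<Rightarrow> 'v \<Rightarrow> 'v set" where
  "circle E v = {w. (v, w) \<in> (E \<union> E\<inverse>)\<^sup>*}"

definition clockwise_vertices :: "arc_diagram \<Rightarrow> nat set" where
  "clockwise_vertices = (\<lambda>(a, \<nu>, b).
     {i. i < length \<nu> \<and> \<nu> ! Min (circle (a \<union> b) i) = Wedge})"

text \<open>
  To multiply \<open>(a, \<kappa>, b)\<close> with \<open>(b\<^sup>*, \<mu>, d)\<close> the second diagram is drawn above the first one.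
  The vertices of the stacked diagram are pairs of a vertex and a row, the rows being \<open>0\<close> (the
  weight line of the first factor) and \<open>1\<close> (that of the second).  The set \<open>s\<close>
  consists of those caps of \<open>b\<close> for which surgery has already replaced the cap and its mirror
  image by two vertical segments.
\<close>

type_synonym vertex = "nat \<times> nat"

definition in_row :: "nat \<Rightarrow> cups \<Rightarrow> (vertex \<times> vertex) set" where
  "in_row r c = (\<lambda>(i, j). ((i, r), (j, r))) ` c"

definition stage :: "cups \<Rightarrow> cups \<Rightarrow> cups \<Rightarrow> cups \<Rightarrow> (vertex \<times> vertex) set" where
  "stage a b d s =
     in_row 0 a \<union> in_row 1 d \<union> in_row 0 (b - s) \<union> in_row 1 (b - s) \<union>
     (\<Union>(i, j) \<in> s. {((i, 0), (i, 1)), ((j, 0), (j, 1))})"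

text \<open>
  A basis vector of the tensor power of \<open>\<complex>[x]/(x\<^sup>2)\<close> attached to a stage assigns \<open>1\<close> or \<open>x\<close> to
  each circle; it is encoded by the union \<open>S\<close> of the circles carrying \<open>x\<close>.  The list that
  \<open>surgery\<close> returns stands for the sum of its entries.  Here \<open>E\<close> and \<open>E'\<close> are the diagrams
  before and after the surgery at \<open>(i, j)\<close>.  If the two arcs lie on different circles, these are
  merged, and \<open>1 \<otimes> 1 \<mapsto> 1\<close>, \<open>1 \<otimes> x, x \<otimes> 1 \<mapsto> x\<close>, \<open>x \<otimes> x \<mapsto> 0\<close>; otherwise the circle is split,
  and \<open>1 \<mapsto> 1 \<otimes> x + x \<otimes> 1\<close>, \<open>x \<mapsto> x \<otimes> x\<close>.
\<close>

definition surgery ::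
  "(vertex \<times> vertex) set \<Rightarrow> (vertex \<times> vertex) set \<Rightarrow> nat \<times> nat \<Rightarrow> vertex set \<Rightarrow> vertex set list"
where
  "surgery E E' = (\<lambda>(i, j) S.
     if (i, 1) \<notin> circle E (i, 0) then
       (if (i, 0) \<in> S \<and> (i, 1) \<in> S then []
        else if (i, 0) \<in> S \<or> (i, 1) \<in> S then [S \<union> circle E (i, 0) \<union> circle E (i, 1)]
        else [S])
     else
       (if (i, 0) \<in> S then [S]
        else [S \<union> circle E' (i, 0), S \<union> circle E' (j, 0)]))"

fun surgeries ::
  "cups \<Rightarrow> cups \<Rightarrow> cups \<Rightarrow> cups \<Rightarrow> (nat \<times> nat) list \<Rightarrow> vertex set \<Rightarrow> vertex set list"
where
  "surgeries a b d s [] S = [S]"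
| "surgeries a b d s (p # ps) S =
     concat (map (surgeries a b d (insert p s) ps)
       (surgery (stage a b d s) (stage a b d (insert p s)) p S))"

text \<open>
  The coefficient of \<open>(e, \<nu>, f)\<close> in the product of \<open>(a, \<kappa>, b)\<close> and \<open>(c, \<mu>, d)\<close>.  The caps of \<open>b\<close>
  are treated by increasing left end, hence a cap before those nested inside it, so that
  every surgery takes place in a planar diagram.
\<close>

definition arc_coeff :: "arc_diagram \<Rightarrow> arc_diagram \<Rightarrow> arc_diagram \<Rightarrow> nat" where
  "arc_coeff = (\<lambda>(a, \<kappa>, b) (c, \<mu>, d) (e, \<nu>, f).
     if b = c \<and> e = a \<and> f = d then
       count_list
         (surgeries a b d {} (sorted_key_list_of_set fst b)
           (clockwise_vertices (a, \<kappa>, b) \<times> {0} \<union> clockwise_vertices (b, \<mu>, d) \<times> {1}))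
         (clockwise_vertices (a, \<nu>, d) \<times> {0, 1})
     else 0)"


section \<open>The Khovanov diagram algebra\<close>

text \<open>
  The triple \<open>(\<alpha>, \<kappa>, \<beta>)\<close> of weights stands for the oriented circle diagram with cup diagram
  \<open>underline \<alpha>\<close>, weight \<open>\<kappa>\<close> and cap diagram the mirror image of \<open>underline \<beta>\<close>.  An element of
  the algebra is the function giving its coefficients.
\<close>

type_synonym diagram = "weight \<times> weight \<times> weight"

type_synonym kvec = "diagram \<Rightarrow> complex"

definition diagrams :: "nat \<Rightarrow> nat \<Rightarrow> diagram set" where
  "diagrams m n = {(\<alpha>, \<kappa>, \<beta>).
     \<alpha> \<in> weights m n \<and> \<kappa> \<in> weights m n \<and> \<beta> \<in> weights m n \<and>
     oriented (underline \<alpha>) \<kappa> \<and> oriented (underline \<beta>) \<kappa>}"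

definition diagram_degree :: "diagram \<Rightarrow> nat" where
  "diagram_degree = (\<lambda>(\<alpha>, \<kappa>, \<beta>).
     num_clockwise (underline \<alpha>) \<kappa> + num_clockwise (underline \<beta>) \<kappa>)"

definition cl :: "nat \<Rightarrow> nat \<Rightarrow> weight \<Rightarrow> weight" where
  "cl m n \<kappa> = replicate n Vee @ \<kappa> @ replicate m Wedge"

definition cl_diagram :: "nat \<Rightarrow> nat \<Rightarrow> diagram \<Rightarrow> arc_diagram" where
  "cl_diagram m n = (\<lambda>(\<alpha>, \<kappa>, \<beta>). (underline (cl m n \<alpha>), cl m n \<kappa>, underline (cl m n \<beta>)))"

definition basis_vec :: "diagram \<Rightarrow> kvec" where
  "basis_vec b = (\<lambda>c. if c = b then 1 else 0)"

text \<open>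
  Passing to the quotient by the span of the diagrams whose weight is not of the form
  \<open>cl m n \<kappa>\<close> amounts to reading off, in the arc algebra product of the closures, the
  coefficients of the closures of the elements of \<open>diagrams m n\<close> only.
\<close>

definition khovanov :: "nat \<Rightarrow> nat \<Rightarrow> (complex, kvec) module" where
  "khovanov m n = \<lparr>
     carrier = {x. \<forall>b. b \<notin> diagrams m n \<longrightarrow> x b = 0},
     monoid.mult = (\<lambda>x y b. if b \<in> diagrams m n then
        (\<Sum>p \<in> diagrams m n. \<Sum>q \<in> diagrams m n. x p * y q *
          of_nat (arc_coeff (cl_diagram m n p) (cl_diagram m n q) (cl_diagram m n b))) else 0),
     one = (\<lambda>b. \<Sum>\<kappa> \<in> weights m n. basis_vec (\<kappa>, \<kappa>, \<kappa>) b),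
     ring.zero = (\<lambda>b. 0),
     add = (\<lambda>x y b. x b + y b),
     module.smult = (\<lambda>c x b. c * x b)\<rparr>"


section \<open>Modules\<close>

text \<open>
  A module over a ring is represented by the library record \<open>module\<close>, of which the fields
  \<open>mult\<close> and \<open>one\<close> are irrelevant; for left modules over the (noncommutative) Khovanov algebra
  the field \<open>smult\<close> is the action of its elements.
\<close>

record ('a, 'b) graded_module = "('a, 'b) module" + grade :: "int \<Rightarrow> 'b set"

definition product_module ::
  "'i set \<Rightarrow> ('i \<Rightarrow> ('a, 'b, 'c) module_scheme) \<Rightarrow> ('a, 'i \<Rightarrow> 'b) module" where
  "product_module I M = \<lparr>
     carrier = (\<Pi>\<^sub>E i \<in> I. carrier (M i)),
     monoid.mult = undefined, one = undefined,
     ring.zero = (\<lambda>i \<in> I. \<zero>\<^bsub>M i\<^esub>),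
     add = (\<lambda>x y. \<lambda>i \<in> I. x i \<oplus>\<^bsub>M i\<^esub> y i),
     module.smult = (\<lambda>c x. \<lambda>i \<in> I. c \<odot>\<^bsub>M i\<^esub> x i)\<rparr>"

definition quotient_module ::
  "('a, 'b, 'c) module_scheme \<Rightarrow> 'b set \<Rightarrow> ('a, 'b set) module" where
  "quotient_module M B = \<lparr>
     carrier = a_rcosets\<^bsub>M\<^esub> B,
     monoid.mult = undefined, one = undefined,
     ring.zero = B,
     add = (\<lambda>C C'. C <+>\<^bsub>M\<^esub> C'),
     module.smult = (\<lambda>c C. B <+>\<^bsub>M\<^esub> ((\<lambda>x. c \<odot>\<^bsub>M\<^esub> x) ` C))\<rparr>"

definition projective :: "nat \<Rightarrow> nat \<Rightarrow> weight \<Rightarrow> (kvec, kvec) graded_module" where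
  "projective m n \<kappa> = (let K = khovanov m n;
       C = {x \<otimes>\<^bsub>K\<^esub> basis_vec (\<kappa>, \<kappa>, \<kappa>) | x. x \<in> carrier K} in
     \<lparr>carrier = C, monoid.mult = undefined, one = undefined, ring.zero = \<zero>\<^bsub>K\<^esub>, add = add K,
      module.smult = monoid.mult K,
      grade = (\<lambda>j. {x \<in> C. \<forall>b. x b \<noteq> 0 \<longrightarrow> int (diagram_degree b) = j})\<rparr>)"

definition cell_submodule :: "nat \<Rightarrow> nat \<Rightarrow> weight \<Rightarrow> kvec set" where
  "cell_submodule m n \<kappa> =
     {x \<in> carrier (projective m n \<kappa>). \<forall>\<alpha> \<nu> \<beta>. x (\<alpha>, \<nu>, \<beta>) \<noteq> 0 \<longrightarrow> \<nu> \<noteq> \<kappa>}"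

definition cell_module :: "nat \<Rightarrow> nat \<Rightarrow> weight \<Rightarrow> (kvec, kvec set) graded_module" where
  "cell_module m n \<kappa> =
     (let P = projective m n \<kappa>; B = cell_submodule m n \<kappa>; Q = quotient_module P B in
     \<lparr>carrier = carrier Q, monoid.mult = undefined, one = undefined, ring.zero = \<zero>\<^bsub>Q\<^esub>, add = add Q,
      module.smult = module.smult Q, grade = (\<lambda>j. (\<lambda>x. B +>\<^bsub>P\<^esub> x) ` grade P j)\<rparr>)"

definition shift :: "int \<Rightarrow> ('a, 'b) graded_module \<Rightarrow> ('a, 'b) graded_module" where
  "shift i M = M\<lparr>grade := \<lambda>j. grade M (j - i)\<rparr>"

definition direct_sum :: "('a, 'b) graded_module list \<Rightarrow> ('a, nat \<Rightarrow> 'b) graded_module" where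
  "direct_sum Ms = (let M = product_module {..<length Ms} (\<lambda>k. Ms ! k) in
     \<lparr>carrier = carrier M, monoid.mult = undefined, one = undefined, ring.zero = \<zero>\<^bsub>M\<^esub>, add = add M,
      module.smult = module.smult M, grade = (\<lambda>j. \<Pi>\<^sub>E k \<in> {..<length Ms}. grade (Ms ! k) j)\<rparr>)"

text \<open>
  Homomorphisms are extensional, so that equality of functions is equality of homomorphisms.
\<close>

definition homs ::
  "('a, 'r) ring_scheme \<Rightarrow> ('a, 'b, 'c) module_scheme \<Rightarrow> ('a, 'd, 'e) module_scheme \<Rightarrow>
   ('b \<Rightarrow> 'd) set" where
  "homs R L M = {f \<in> carrier L \<rightarrow>\<^sub>E carrier M.
     (\<forall>x \<in> carrier L. \<forall>y \<in> carrier L. f (x \<oplus>\<^bsub>L\<^esub> y) = f x \<oplus>\<^bsub>M\<^esub> f y) \<and>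
     (\<forall>a \<in> carrier R. \<forall>x \<in> carrier L. f (a \<odot>\<^bsub>L\<^esub> x) = a \<odot>\<^bsub>M\<^esub> f x)}"

definition graded_homs ::
  "('a, 'r) ring_scheme \<Rightarrow> ('a, 'b) graded_module \<Rightarrow> ('a, 'd) graded_module \<Rightarrow> ('b \<Rightarrow> 'd) set"
where
  "graded_homs R L M = {f \<in> homs R L M. \<forall>j. f ` grade L j \<subseteq> grade M j}"

definition scale ::
  "('s, 'a, 'c) module_scheme \<Rightarrow> ('a, 'b, 'd) module_scheme \<Rightarrow> 's \<Rightarrow> 'b \<Rightarrow> 'b" where
  "scale K M c x = (c \<odot>\<^bsub>K\<^esub> \<one>\<^bsub>K\<^esub>) \<odot>\<^bsub>M\<^esub> x"

definition hom_space ::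
  "('s, 'a, 'r) module_scheme \<Rightarrow> ('a, 'b, 'c) module_scheme \<Rightarrow> ('a, 'd, 'e) module_scheme \<Rightarrow>
   ('s, 'b \<Rightarrow> 'd) module" where
  "hom_space K L M = \<lparr>
     carrier = homs K L M,
     monoid.mult = undefined, one = undefined,
     ring.zero = (\<lambda>x \<in> carrier L. \<zero>\<^bsub>M\<^esub>),
     add = (\<lambda>f g. \<lambda>x \<in> carrier L. f x \<oplus>\<^bsub>M\<^esub> g x),
     module.smult = (\<lambda>c f. \<lambda>x \<in> carrier L. scale K M c (f x))\<rparr>"


section \<open>Linear projective resolutions and the dg algebra\<close>

text \<open>
  A linear projective resolution is given by lists \<open>W i\<close> of weights, the term in homological
  degree \<open>i\<close> being the direct sum of the modules \<open>P(\<mu>)\<langle>i\<rangle>\<close> with \<open>\<mu>\<close> running through \<open>W i\<close>,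
  and by differentials \<open>D i\<close> from the \<open>i\<close>-th to the \<open>(i - 1)\<close>-st term.
\<close>

definition resolution_term ::
  "nat \<Rightarrow> nat \<Rightarrow> (int \<Rightarrow> weight list) \<Rightarrow> int \<Rightarrow> (kvec, nat \<Rightarrow> kvec) graded_module" where
  "resolution_term m n W i = direct_sum (map (\<lambda>\<mu>. shift i (projective m n \<mu>)) (W i))"

definition linear_resolution ::
  "nat \<Rightarrow> nat \<Rightarrow> weight \<Rightarrow> (int \<Rightarrow> weight list) \<Rightarrow>
   (int \<Rightarrow> (nat \<Rightarrow> kvec) \<Rightarrow> (nat \<Rightarrow> kvec)) \<Rightarrow> bool" where
  "linear_resolution m n \<kappa> W D \<longleftrightarrow>
     (let P = resolution_term m n W; K = khovanov m n; M = cell_module m n \<kappa> in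
       (\<forall>i. set (W i) \<subseteq> weights m n) \<and>
       (\<forall>i<0. W i = []) \<and> (\<exists>b. \<forall>i>b. W i = []) \<and>
       W 0 = [\<kappa>] \<and>
       (\<forall>i. D i \<in> graded_homs K (P i) (P (i - 1))) \<and>
       (\<forall>i\<ge>1. a_kernel (P i) (P (i - 1)) (D i) = D (i + 1) ` carrier (P (i + 1))) \<and>
       (\<exists>\<epsilon> \<in> graded_homs K (P 0) M.
          \<epsilon> ` carrier (P 0) = carrier M \<and> a_kernel (P 0) M \<epsilon> = D 1 ` carrier (P 1)))"

text \<open>
  The dg algebra of a family of complexes \<open>P\<^sub>\<bullet>(\<kappa>)\<close>: a homogeneous element of degree \<open>r\<close> is a family
  \<open>f (\<kappa>, \<mu>, p) : P\<^sub>p(\<kappa>) \<rightarrow> P\<^sub>p\<^sub>-\<^sub>r(\<mu>)\<close>.  As the set of weights is finite, the direct sum over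
  \<open>\<kappa>, \<mu>\<close> is a product.
\<close>

type_synonym endo = "weight \<times> weight \<times> int \<Rightarrow> (nat \<Rightarrow> kvec) \<Rightarrow> (nat \<Rightarrow> kvec)"

definition endo_space ::
  "nat \<Rightarrow> nat \<Rightarrow> (weight \<Rightarrow> int \<Rightarrow> weight list) \<Rightarrow> int \<Rightarrow> (complex, endo) module" where
  "endo_space m n W r = product_module (weights m n \<times> weights m n \<times> UNIV)
     (\<lambda>(\<kappa>, \<mu>, p). hom_space (khovanov m n)
        (resolution_term m n (W \<kappa>) p) (resolution_term m n (W \<mu>) (p - r)))"

definition endo_diff ::
  "nat \<Rightarrow> nat \<Rightarrow> (weight \<Rightarrow> int \<Rightarrow> weight list) \<Rightarrow>
   (weight \<Rightarrow> int \<Rightarrow> (nat \<Rightarrow> kvec) \<Rightarrow> (nat \<Rightarrow> kvec)) \<Rightarrow> int \<Rightarrow> endo \<Rightarrow> endo" where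
  "endo_diff m n W D r f =
     (\<lambda>(\<kappa>, \<mu>, p) \<in> weights m n \<times> weights m n \<times> UNIV.
        let L = resolution_term m n (W \<kappa>) p;
            M = resolution_term m n (W \<mu>) (p - r - 1);
            sc = scale (khovanov m n) M
        in (\<lambda>x \<in> carrier L. sc ((-1) powi r)
             (D \<mu> (p - r) (f (\<kappa>, \<mu>, p) x) \<ominus>\<^bsub>M\<^esub> sc ((-1) powi r) (f (\<kappa>, \<mu>, p - 1) (D \<kappa> p x)))))"

text \<open>The product of \<open>f\<close> of degree \<open>r\<close> and \<open>g\<close> of degree \<open>s\<close>, composed from left to right.\<close>

definition endo_mult ::
  "nat \<Rightarrow> nat \<Rightarrow> (weight \<Rightarrow> int \<Rightarrow> weight list) \<Rightarrow> int \<Rightarrow> endo \<Rightarrow> int \<Rightarrow> endo \<Rightarrow> endo" where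
  "endo_mult m n W r f s g =
     (\<lambda>(\<kappa>, \<nu>, p) \<in> weights m n \<times> weights m n \<times> UNIV.
        \<lambda>x \<in> carrier (resolution_term m n (W \<kappa>) p).
          \<Oplus>\<^bsub>resolution_term m n (W \<nu>) (p - r - s)\<^esub> \<mu> \<in> weights m n.
            g (\<mu>, \<nu>, p - r) (f (\<kappa>, \<mu>, p) x))"


section \<open>A-infinity algebras\<close>

abbreviation complex_ring :: "complex ring" where
  "complex_ring \<equiv> ring_of_type_algebra"

text \<open>
  A graded vector space \<open>V\<close> is a family of vector spaces indexed by the degree.  A homogeneous
  element is a pair of a degree \<open>d\<close> and an element of \<open>V d\<close>, and a homogeneous tensor
  \<open>x\<^sub>1 \<otimes> \<dots> \<otimes> x\<^sub>l\<close> is represented by the list of its factors.  A graded linear map out of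
  the \<open>l\<close>-th tensor power is the same as a multilinear map on such lists.  A family of maps, one for
  each \<open>l \<ge> 1\<close>, is a single function on lists whose \<open>l\<close>-th member is its restriction to the
  lists of length \<open>l\<close>.
\<close>

type_synonym 'v gspace = "int \<Rightarrow> (complex, 'v) module"

type_synonym 'v tensor = "(int \<times> 'v) list"

definition tensors :: "'v gspace \<Rightarrow> 'v tensor set" where
  "tensors V = {z. z \<noteq> [] \<and> (\<forall>(d, x) \<in> set z. x \<in> carrier (V d))}"

definition tensor_degree :: "'v tensor \<Rightarrow> int" where
  "tensor_degree z = sum_list (map fst z)"

text \<open>In \<open>multilinear_family e V U f\<close>, the map \<open>f\<^sub>l\<close> has degree \<open>e - l\<close>.\<close>

definition multilinear_family ::
  "int \<Rightarrow> 'v gspace \<Rightarrow> 'u gspace \<Rightarrow> ('v tensor \<Rightarrow> 'u) \<Rightarrow> bool" where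
  "multilinear_family e V U f \<longleftrightarrow>
     (\<forall>z \<in> tensors V. f z \<in> carrier (U (tensor_degree z + e - int (length z)))) \<and>
     (\<forall>y z d. \<forall>a \<in> carrier (V d). \<forall>b \<in> carrier (V d). y @ (d, a) # z \<in> tensors V \<longrightarrow>
        (let T = U (tensor_degree y + d + tensor_degree z + e - int (length y + 1 + length z)) in
          f (y @ (d, a \<oplus>\<^bsub>V d\<^esub> b) # z) = f (y @ (d, a) # z) \<oplus>\<^bsub>T\<^esub> f (y @ (d, b) # z) \<and>
          (\<forall>c. f (y @ (d, c \<odot>\<^bsub>V d\<^esub> a) # z) = c \<odot>\<^bsub>T\<^esub> f (y @ (d, a) # z))))"

text \<open>
  The sum over \<open>r + s + t = l\<close> of \<open>(-1)\<^bsup>r+st\<^esup> f\<^sub>r\<^sub>+\<^sub>t\<^sub>+\<^sub>1 (Id\<^sup>r \<otimes> m\<^sub>s \<otimes> Id\<^sup>t)\<close>, evaluated at the tensor \<open>z\<close>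
  of length \<open>l\<close>; the exponent \<open>(2 - s) * tensor_degree (take r z)\<close> is the Koszul sign.
\<close>

definition insertion_sum ::
  "(complex, 'u) module \<Rightarrow> ('v tensor \<Rightarrow> 'v) \<Rightarrow> ('v tensor \<Rightarrow> 'u) \<Rightarrow>
   'v tensor \<Rightarrow> 'u" where
  "insertion_sum T m f z =
     finsum T
       (\<lambda>(r, s, t). let y = take s (drop r z) in
          (-1) powi (int (r + s * t) + (2 - int s) * tensor_degree (take r z)) \<odot>\<^bsub>T\<^esub>
            f (take r z @ [(tensor_degree y + 2 - int s, m y)] @ drop (r + s) z))
       {(r, s, t). r + s + t = length z \<and> s \<ge> 1}"

definition ainf_algebra :: "'v gspace \<Rightarrow> ('v tensor \<Rightarrow> 'v) \<Rightarrow> bool" where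
  "ainf_algebra V m \<longleftrightarrow>
     (\<forall>d. module complex_ring (V d)) \<and>
     multilinear_family 2 V V m \<and>
     (\<forall>z \<in> tensors V. let T = V (tensor_degree z + 3 - int (length z)) in
        insertion_sum T m m z = \<zero>\<^bsub>T\<^esub>)"

fun blocks :: "nat list \<Rightarrow> 'a list \<Rightarrow> 'a list list" where
  "blocks [] z = []"
| "blocks (i # is) z = take i z # blocks is (drop i z)"

text \<open>
  The sum over \<open>l = i\<^sub>1 + \<dots> + i\<^sub>q\<close> of \<open>(-1)\<^sup>w m\<^sub>q (f\<^bsub>i\<^sub>1\<^esub> \<otimes> \<dots> \<otimes> f\<^bsub>i\<^sub>q\<^esub>)\<close>, evaluated at the tensor \<open>z\<close> of
  length \<open>l\<close>.  The index \<open>j\<close> below starts at \<open>0\<close>; the second sum in the exponent is the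
  Koszul sign, the map \<open>f\<close> of degree \<open>1 - is ! j\<close> passing all factors of the preceding blocks.
\<close>

definition composition_sum ::
  "(complex, 'u) module \<Rightarrow> ('v tensor \<Rightarrow> 'u) \<Rightarrow> ('u tensor \<Rightarrow> 'u) \<Rightarrow>
   'v tensor \<Rightarrow> 'u" where
  "composition_sum T f m z =
     (\<Oplus>\<^bsub>T\<^esub> is \<in> {is. sum_list is = length z \<and> (\<forall>i \<in> set is. i \<ge> 1)}.
        (-1) powi
             ((\<Sum>j<length is. (int (length is) - int (j + 1)) * (int (is ! j) - 1)) +
              (\<Sum>j<length is. (1 - int (is ! j)) * tensor_degree (take (sum_list (take j is)) z))) \<odot>\<^bsub>T\<^esub>
          (m (map (\<lambda>y. (tensor_degree y + 1 - int (length y), f y)) (blocks is z))))"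

definition ainf_morphism ::
  "'v gspace \<Rightarrow> ('v tensor \<Rightarrow> 'v) \<Rightarrow> 'u gspace \<Rightarrow> ('u tensor \<Rightarrow> 'u) \<Rightarrow> ('v tensor \<Rightarrow> 'u) \<Rightarrow> bool"
where
  "ainf_morphism V m U m' f \<longleftrightarrow>
     ainf_algebra V m \<and> ainf_algebra U m' \<and>
     multilinear_family 1 V U f \<and>
     (\<forall>z \<in> tensors V. let T = U (tensor_degree z + 2 - int (length z)) in
        insertion_sum T m f z = composition_sum T f m' z)"

definition cocycles :: "'v gspace \<Rightarrow> ('v tensor \<Rightarrow> 'v) \<Rightarrow> int \<Rightarrow> 'v set" where
  "cocycles V m d = {x \<in> carrier (V d). m [(d, x)] = \<zero>\<^bsub>V (d + 1)\<^esub>}"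

definition coboundaries :: "'v gspace \<Rightarrow> ('v tensor \<Rightarrow> 'v) \<Rightarrow> int \<Rightarrow> 'v set" where
  "coboundaries V m d = (\<lambda>x. m [(d - 1, x)]) ` carrier (V (d - 1))"

definition cohomology :: "'v gspace \<Rightarrow> ('v tensor \<Rightarrow> 'v) \<Rightarrow> 'v set gspace" where
  "cohomology V m d =
     quotient_module ((V d)\<lparr>carrier := cocycles V m d\<rparr>) (coboundaries V m d)"

definition cohomology_class ::
  "'v gspace \<Rightarrow> ('v tensor \<Rightarrow> 'v) \<Rightarrow> int \<Rightarrow> 'v \<Rightarrow> 'v set" where
  "cohomology_class V m d x = coboundaries V m d +>\<^bsub>V d\<^esub> x"

definition ainf_quasi_iso ::
  "'v gspace \<Rightarrow> ('v tensor \<Rightarrow> 'v) \<Rightarrow> 'u gspace \<Rightarrow> ('u tensor \<Rightarrow> 'u) \<Rightarrow> ('v tensor \<Rightarrow> 'u) \<Rightarrow> bool"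
where
  "ainf_quasi_iso V m U m' f \<longleftrightarrow>
     ainf_morphism V m U m' f \<and>
     (\<forall>d. bij_betw (\<lambda>C. coboundaries U m' d <+>\<^bsub>U d\<^esub> ((\<lambda>x. f [(d, x)]) ` C))
        (carrier (cohomology V m d)) (carrier (cohomology U m' d)))"

text \<open>
  In a minimal model the linear part of the quasi-isomorphism sends each cohomology class to one of
  its representatives.
\<close>

definition minimal_model ::
  "'v gspace \<Rightarrow> ('v tensor \<Rightarrow> 'v) \<Rightarrow> ('v set tensor \<Rightarrow> 'v set) \<Rightarrow> ('v set tensor \<Rightarrow> 'v) \<Rightarrow> bool"
where
  "minimal_model V m mH f \<longleftrightarrow>
     ainf_algebra (cohomology V m) mH \<and>
     (\<forall>d. \<forall>C \<in> carrier (cohomology V m d). mH [(d, C)] = \<zero>\<^bsub>cohomology V m (d + 1)\<^esub>) \<and>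
     (\<forall>d e. \<forall>x \<in> cocycles V m d. \<forall>y \<in> cocycles V m e.
        mH [(d, cohomology_class V m d x), (e, cohomology_class V m e y)] =
        cohomology_class V m (d + e) (m [(d, x), (e, y)])) \<and>
     ainf_quasi_iso (cohomology V m) mH V m f \<and>
     (\<forall>d. \<forall>C \<in> carrier (cohomology V m d).
        f [(d, C)] \<in> cocycles V m d \<and> cohomology_class V m d (f [(d, C)]) = C)"

definition dg_operations ::
  "'v gspace \<Rightarrow> (int \<Rightarrow> 'v \<Rightarrow> 'v) \<Rightarrow> (int \<Rightarrow> 'v \<Rightarrow> int \<Rightarrow> 'v \<Rightarrow> 'v) \<Rightarrow> 'v tensor \<Rightarrow> 'v" where
  "dg_operations V diff mul z = (case z of
       [(d, x)] \<Rightarrow> diff d x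
     | [(d, x), (e, y)] \<Rightarrow> mul d x e y
     | _ \<Rightarrow> \<zero>\<^bsub>V (tensor_degree z + 2 - int (length z))\<^esub>)"

definition endo_operations ::
  "nat \<Rightarrow> nat \<Rightarrow> (weight \<Rightarrow> int \<Rightarrow> weight list) \<Rightarrow>
   (weight \<Rightarrow> int \<Rightarrow> (nat \<Rightarrow> kvec) \<Rightarrow> (nat \<Rightarrow> kvec)) \<Rightarrow> endo tensor \<Rightarrow> endo" where
  "endo_operations m n W D =
     dg_operations (endo_space m n W) (endo_diff m n W D) (endo_mult m n W)"

end

theory Submission
  imports Defs "HOL-Library.Function_Algebras"
begin

text \<open>A weight is the position \<open>k \<le> N\<close> of its single \<open>Wedge\<close>, and the surgery procedure identifies the diagram
  algebra with a zigzag algebra: its basis consists of idempotents \<open>e\<^sub>0, \<dots>, e\<^sub>N\<close>, elements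
  \<open>u\<^sub>i \<in> e\<^sub>i K e\<^sub>i\<^sub>+\<^sub>1\<close> and \<open>v\<^sub>i \<in> e\<^sub>i\<^sub>+\<^sub>1 K e\<^sub>i\<close> of degree 1, and \<open>x\<^sub>i = v\<^sub>i u\<^sub>i \<in> e\<^sub>i\<^sub>+\<^sub>1 K e\<^sub>i\<^sub>+\<^sub>1\<close> of degree 2.
  The linear resolution of the cell module at \<open>k\<close> is forced to be \<open>K e\<^sub>0 \<rightarrow> \<dots> \<rightarrow> K e\<^sub>k\<close>, with nonzero
  multiples of right multiplication by \<open>u\<^sub>i\<close> as differentials. So the dg algebra of endomorphisms
  consists of families of elements of the spaces \<open>e\<^sub>i K e\<^sub>j\<close>, with the product of \<open>K\<close> and the signed
  commutator with the \<open>u\<^sub>i\<close> as differential. Coboundaries are supported on the \<open>u\<^sub>i\<close> and \<open>x\<^sub>i\<close>;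
  conversely, by solving a first order recursion along the resolutions, every family is a
  coboundary plus a family supported on the \<open>e\<^sub>i\<close> and \<open>v\<^sub>i\<close>. The span of the \<open>e\<^sub>i\<close> and \<open>v\<^sub>i\<close> is closed
  under products because \<open>v\<^sub>i\<^sub>+\<^sub>1 v\<^sub>i = 0\<close>. Hence the cocycles supported there form a dg subalgebra with
  zero differential that maps isomorphically onto the cohomology, and its inclusion is a strict
  quasi-isomorphism.\<close>

section \<open>Weights and their cup diagrams\<close>

text \<open>Every term of the differential has a factor \<open>u_i\<close>, and a product with such
  a factor has only \<open>u\<close> and \<open>x\<close> coordinates; this singles out the span of
  the \<open>e_i\<close> and \<open>v_i\<close> as a complement that coboundaries meet only in 0.
  That the complement is large enough is the actual content. With \<open>\<kappa>\<close>,
  \<open>\<mu>\<close> and the degree fixed, the \<open>u\<close> or \<open>x\<close> coordinates of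
  a family form one sequence of scalars, indexed by the position \<open>p\<close> in the resolution,
  and removing them amounts to solving
  \<open>a p * \<alpha> p - b p * \<alpha> (p - 1) = \<eta> p\<close>, where \<open>a\<close> and
  \<open>b\<close> come from the differentials of the two resolutions. The \<open>\<alpha> p\<close>
  have to vanish where one of the two terms is zero, so the ends of the range decide on solvability.
  The resolutions are arbitrary, so the scalars in their differentials are not normalised; the
  recursion uses only that they are nonzero. In the \<open>x\<close> case both summands are present
  because \<open>x_i\<close> equals \<open>v_i u_i\<close> and, for \<open>i + 1 < N\<close>, also
  \<open>u_(i+1) v_(i+1)\<close>. The removal works for all families, and from a cocycle it leaves a
  cocycle.\<close>

lemma filter_pair: "{(i, j) \<in> c. P i j} = {p \<in> c. P (fst p) (snd p)}" by auto

locale one_wedge =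
  fixes N :: nat
begin

definition wt :: "nat \<Rightarrow> weight" where
  "wt k = replicate k Vee @ Wedge # replicate (N - k) Vee"

lemma length_wt [simp]: "k \<le> N \<Longrightarrow> length (wt k) = Suc N"
  by (simp add: wt_def)

lemma nth_wt: "k \<le> N \<Longrightarrow> i \<le> N \<Longrightarrow> wt k ! i = (if i = k then Wedge else Vee)"
  by (auto simp: wt_def nth_append nth_Cons')

lemma wt_inject [simp]: "k \<le> N \<Longrightarrow> l \<le> N \<Longrightarrow> wt k = wt l \<longleftrightarrow> k = l"
  by (metis arrow.distinct(1) nth_wt)

lemma not_Wedge_replicate: "count_list w Wedge = 0 \<Longrightarrow> w = replicate (count_list w Vee) Vee"
proof (induction w)
  case (Cons a w)
  then show ?case by (cases a) (auto split: if_splits)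
qed simp

lemma weights_eq: "weights N 1 = wt ` {..N}"
proof
  show "weights N 1 \<subseteq> wt ` {..N}"
  proof
    fix w assume w: "w \<in> weights N 1"
    then have "Wedge \<in> set w" using count_list_0_iff[of w Wedge] by (auto simp: weights_def)
    then obtain xs ys where xs: "w = xs @ Wedge # ys" by (meson split_list)
    from w xs have "count_list xs Wedge = 0" "count_list ys Wedge = 0"
      "count_list xs Vee + count_list ys Vee = N" by (auto simp: weights_def)
    then have "w = wt (count_list xs Vee)" "count_list xs Vee \<le> N"
      using not_Wedge_replicate[of xs] not_Wedge_replicate[of ys] xs by (auto simp: wt_def)
    then show "w \<in> wt ` {..N}" by auto
  qed
  have *: "count_list (replicate k Vee) x = (if x = Vee then k else 0)" for k x
    by (induction k) auto
  show "wt ` {..N} \<subseteq> weights N 1"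
    by (auto simp: weights_def wt_def * )
qed

lemma finite_weights: "finite (weights N 1)"
  unfolding weights_eq by simp

lemma wt_in_weights [simp]: "k \<le> N \<Longrightarrow> wt k \<in> weights N 1"
  unfolding weights_eq by simp

definition idx :: "weight \<Rightarrow> nat" where
  "idx w = (THE k. k \<le> N \<and> w = wt k)"

lemma idx_wt [simp]: "k \<le> N \<Longrightarrow> idx (wt k) = k"
  unfolding idx_def by (rule the_equality) auto

end

lemma cup_diagramD:
  assumes "cup_diagram k c"
  shows "(i, j) \<in> c \<Longrightarrow> i < j" "(i, j) \<in> c \<Longrightarrow> j < k"
    and "x \<in> c \<Longrightarrow> y \<in> c \<Longrightarrow> {fst x, snd x} \<inter> {fst y, snd y} \<noteq> {} \<Longrightarrow> x = y"
    and "(i, j) \<in> c \<Longrightarrow> (i', j') \<in> c \<Longrightarrow> i < i' \<Longrightarrow> i' < j \<Longrightarrow> \<not> j < j'"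
    and "(i, j) \<in> c \<Longrightarrow> v \<in> rays k c \<Longrightarrow> i < v \<Longrightarrow> \<not> v < j"
proof -
  have *: "\<forall>(i, j) \<in> c. i < j \<and> j < k"
     "\<forall>p \<in> c. \<forall>q \<in> c. p \<noteq> q \<longrightarrow> {fst p, snd p} \<inter> {fst q, snd q} = {}"
     "\<not> (\<exists>(i, j) \<in> c. \<exists>(i', j') \<in> c. i < i' \<and> i' < j \<and> j < j')"
     "\<not> (\<exists>(i, j) \<in> c. \<exists>v \<in> rays k c. i < v \<and> v < j)"
    using assms unfolding cup_diagram_def by simp_all
  show "(i, j) \<in> c \<Longrightarrow> i < j" "(i, j) \<in> c \<Longrightarrow> j < k" using *(1) by auto
  show "x \<in> c \<Longrightarrow> y \<in> c \<Longrightarrow> {fst x, snd x} \<inter> {fst y, snd y} \<noteq> {} \<Longrightarrow> x = y" using *(2) by metis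
  show "(i, j) \<in> c \<Longrightarrow> (i', j') \<in> c \<Longrightarrow> i < i' \<Longrightarrow> i' < j \<Longrightarrow> \<not> j < j'" using *(3) by blast
  show "(i, j) \<in> c \<Longrightarrow> v \<in> rays k c \<Longrightarrow> i < v \<Longrightarrow> \<not> v < j" using *(4) by blast
qed

text \<open>In degree 0 every cup runs from \<open>Vee\<close> to \<open>Wedge\<close>. As the
  vertices between \<open>p\<close> and \<open>q\<close> are matched among themselves, a cup at
  \<open>p\<close> ends at \<open>q\<close> or beyond, and a cup at \<open>q\<close> starts at
  \<open>p\<close> or before. Two different such cups would cross, a ray at one end would be
  enclosed by the cup at the other, and two rays violate the orientation. Applied from the inside
  outwards, this determines \<open>underline\<close>.\<close>

lemma enclosing_cup:
  assumes c: "cup_diagram (length w) c" "oriented c w" "num_clockwise c w = 0"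
    and pq: "p < q" "q < length w" "w ! p = Vee" "w ! q = Wedge"
    and between: "\<And>v. p < v \<Longrightarrow> v < q \<Longrightarrow> \<exists>(i, j) \<in> c. (v = i \<or> v = j) \<and> p < i \<and> j < q"
  shows "(p, q) \<in> c"
proof -
  note bnd = cup_diagramD(1,2)[OF c(1)]
  note disj = cup_diagramD(3)[OF c(1)]
  note noncross = cup_diagramD(4)[OF c(1)]
  note noray = cup_diagramD(5)[OF c(1)]
  have "c \<subseteq> {..<length w} \<times> {..<length w}" using bnd by fastforce
  \<comment> \<open>The degree is a cardinality, and \<open>card\<close> is 0 on infinite sets too;
    finiteness is what turns degree 0 into the absence of clockwise cups.\<close>
  then have fin: "finite c" by (rule finite_subset) simp
  have lab: "w ! i = Vee \<and> w ! j = Wedge" if "(i, j) \<in> c" for i j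
  proof -
    have "{(i, j) \<in> c. w ! i = Wedge \<and> w ! j = Vee} = {}"
      using c(3) fin finite_subset[OF _ fin] unfolding num_clockwise_def filter_pair by auto
    moreover have "w ! i \<noteq> w ! j" using c(2) that unfolding oriented_def by blast
    ultimately show ?thesis using that by (cases "w ! i"; cases "w ! j") auto
  qed
  have "\<not> (\<exists>i \<in> rays (length w) c. \<exists>j \<in> rays (length w) c. i < j \<and> w ! i = Vee \<and> w ! j = Wedge)"
    using c(2) unfolding oriented_def by simp
  then have rr: "\<not> (p \<in> rays (length w) c \<and> q \<in> rays (length w) c)" using pq by blast
  have P: "p \<in> rays (length w) c \<or> (\<exists>j. (p, j) \<in> c)"
    using pq lab unfolding rays_def by auto
  have Q: "q \<in> rays (length w) c \<or> (\<exists>i. (i, q) \<in> c)"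
    using pq lab unfolding rays_def by auto
  have PJ: "j \<ge> q" if pj: "(p, j) \<in> c" for j
  proof (rule ccontr)
    assume "\<not> j \<ge> q"
    then obtain x y where "(x, y) \<in> c" "j = x \<or> j = y" "p < x" using between[of j] bnd(1)[OF pj] by (auto simp: not_le)
    then show False using disj[OF pj, of "(x, y)"] by auto
  qed
  have QI: "i \<le> p" if iq: "(i, q) \<in> c" for i
  proof (rule ccontr)
    assume "\<not> i \<le> p"
    then obtain x y where "(x, y) \<in> c" "i = x \<or> i = y" "y < q" using between[of i] bnd(1)[OF iq] by (auto simp: not_le)
    then show False using disj[OF iq, of "(x, y)"] by auto
  qed
  show ?thesis
  proof (cases "p \<in> rays (length w) c")
    case True
    with Q obtain i where i: "(i, q) \<in> c" using rr by blast
    with QI[OF i] have "i = p" using noray[OF i True] pq by linarith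
    then show ?thesis using i by simp
  next
    case False
    with P obtain j where j: "(p, j) \<in> c" by blast
    show ?thesis
    proof (cases "q \<in> rays (length w) c")
      case True
      then show ?thesis using noray[OF j True] PJ[OF j] pq j by (cases "j = q") auto
    next
      case False
      with Q obtain i where i: "(i, q) \<in> c" by blast
      show ?thesis using noncross[OF i j] PJ[OF j] QI[OF i] pq i j by (cases "i = p"; cases "j = q") auto
    qed
  qed
qed

context one_wedge
begin

text \<open>In degree 0 the right end of a cup carries \<open>Wedge\<close>, so every cup ends at
  \<open>k\<close> and there is at most one. For \<open>k > 0\<close> the adjacent pair
  \<open>(k - 1, k)\<close> has nothing between its ends and \<open>enclosing_cup\<close>
  applies.\<close>

lemma underline_wt:
  assumes k: "k \<le> N"
  shows "underline (wt k) = (if k = 0 then {} else {(k - 1, k)})" (is "_ = ?c")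
  unfolding underline_def
proof (rule the_equality)
  show "cup_diagram (length (wt k)) ?c \<and> oriented ?c (wt k) \<and> num_clockwise ?c (wt k) = 0"
    using k by (auto simp: cup_diagram_def oriented_def num_clockwise_def filter_pair rays_def nth_wt)
  fix c assume c: "cup_diagram (length (wt k)) c \<and> oriented c (wt k) \<and> num_clockwise c (wt k) = 0"
  have bnd: "i < j \<and> j \<le> N" if "(i, j) \<in> c" for i j
    using c that k unfolding cup_diagram_def by fastforce
  have "c \<subseteq> {..N} \<times> {..N}" using bnd by fastforce
  then have fin: "finite c" by (rule finite_subset) simp
  have snd: "j = k" if "(i, j) \<in> c" for i j
  proof -
    have "{(i, j) \<in> c. wt k ! i = Wedge \<and> wt k ! j = Vee} = {}"
      using c fin finite_subset[OF _ fin] unfolding num_clockwise_def filter_pair by auto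
    moreover have "wt k ! i \<noteq> wt k ! j" using c that unfolding oriented_def by blast
    moreover from calculation(1) have "\<not> (wt k ! i = Wedge \<and> wt k ! j = Vee)" using that by auto
    ultimately show ?thesis using that bnd[OF that] k by (auto simp: nth_wt split: if_splits)
  qed
  show "c = ?c"
  proof (cases "k = 0")
    case True
    then show ?thesis using snd bnd by fastforce
  next
    case False
    then have "(k - 1, k) \<in> c" using k c by (intro enclosing_cup[of "wt k"]) (auto simp: nth_wt)
    moreover have "p = (k - 1, k)" if "p \<in> c" for p
    proof (rule ccontr)
      assume "p \<noteq> (k - 1, k)"
      then have "{fst p, snd p} \<inter> {k - 1, k} = {}" using c that calculation
        cup_diagramD(3)[of "length (wt k)" c p "(k - 1, k)"] by auto
      then show False using snd[of "fst p" "snd p"] that by auto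
    qed
    ultimately have "c = {(k - 1, k)}" by blast
    then show ?thesis using False by simp
  qed
qed

text \<open>For \<open>i > 0\<close> the ends of the only cup carry different labels, which puts the
  single \<open>Wedge\<close> on that cup; for \<open>i = 0\<close> all vertices are rays and the
  \<open>Wedge\<close> has to come first. This is the origin of the zigzag shape: a common
  orientation links only equal or neighbouring weights.\<close>

lemma oriented_underline_wt:
  assumes "i \<le> N" "k \<le> N"
  shows "oriented (underline (wt i)) (wt k) \<longleftrightarrow> k = i \<or> Suc k = i"
proof (cases "i = 0")
  case True
  then show ?thesis using assms
    by (auto simp: underline_wt oriented_def rays_def nth_wt intro: exI[of _ "0::nat"])
next
  case False
  then show ?thesis using assms
    by (auto simp: underline_wt oriented_def rays_def nth_wt)
qed

lemma num_clockwise_wt: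
  assumes "i \<le> N" "k \<le> N"
  shows "num_clockwise (underline (wt i)) (wt k) = (if Suc k = i then 1 else 0)"
proof -
  have *: "{p. p = q \<and> P p} = (if P q then {q} else {})" for P :: "nat \<times> nat \<Rightarrow> bool" and q
    by auto
  show ?thesis
    using assms unfolding num_clockwise_def filter_pair underline_wt[OF assms(1)]
    by (cases i) (auto simp: * nth_wt cong: conj_cong)
qed

definition diag :: "nat \<Rightarrow> nat \<Rightarrow> nat \<Rightarrow> diagram" where
  "diag i k j = (wt i, wt k, wt j)"

lemma diag_inject [simp]:
  "i \<le> N \<Longrightarrow> k \<le> N \<Longrightarrow> j \<le> N \<Longrightarrow> i' \<le> N \<Longrightarrow> k' \<le> N \<Longrightarrow> j' \<le> N \<Longrightarrow>
   diag i k j = diag i' k' j' \<longleftrightarrow> i = i' \<and> k = k' \<and> j = j'"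
  by (auto simp: diag_def)

lemma diagrams_eq:
  "diagrams N 1 = {diag i k j | i k j. i \<le> N \<and> k \<le> N \<and> j \<le> N \<and> (k = i \<or> Suc k = i) \<and> (k = j \<or> Suc k = j)}"
proof (intro subset_antisym subsetI)
  fix p assume "p \<in> diagrams N 1"
  then obtain i k j where "p = (wt i, wt k, wt j)" "i \<le> N" "k \<le> N" "j \<le> N"
    "oriented (underline (wt i)) (wt k)" "oriented (underline (wt j)) (wt k)"
    unfolding diagrams_def weights_eq by auto
  then show "p \<in> {diag i k j | i k j. i \<le> N \<and> k \<le> N \<and> j \<le> N \<and> (k = i \<or> Suc k = i) \<and> (k = j \<or> Suc k = j)}"
    using oriented_underline_wt unfolding diag_def by blast
next
  fix p assume "p \<in> {diag i k j | i k j. i \<le> N \<and> k \<le> N \<and> j \<le> N \<and> (k = i \<or> Suc k = i) \<and> (k = j \<or> Suc k = j)}"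
  then obtain i k j where p: "p = (wt i, wt k, wt j)" "i \<le> N" "k \<le> N" "j \<le> N"
    "k = i \<or> Suc k = i" "k = j \<or> Suc k = j" unfolding diag_def by blast
  then have "oriented (underline (wt i)) (wt k)" "oriented (underline (wt j)) (wt k)"
    by (simp_all only: oriented_underline_wt)
  then show "p \<in> diagrams N 1" unfolding diagrams_def weights_eq using p(1-4) by simp
qed

lemma diagram_degree_diag:
  "i \<le> N \<Longrightarrow> k \<le> N \<Longrightarrow> j \<le> N \<Longrightarrow>
   diagram_degree (diag i k j) = (if Suc k = i then 1 else 0) + (if Suc k = j then 1 else 0)"
  by (simp add: diagram_degree_def diag_def num_clockwise_wt)

text \<open>The closure of \<open>wt k\<close> has its \<open>Wedge\<close> symbols at
  \<open>k + 1\<close> and from \<open>N + 2\<close> on. The one at \<open>k + 1\<close> closes with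
  its left neighbour. The remaining \<open>Vee\<close> symbols form two nests: those right of this
  small cup have partners with sum of positions \<open>2 * N + 3\<close>, those left of it have
  partners with sum \<open>2 * N + 1\<close>.\<close>

definition cupset :: "nat \<Rightarrow> cups" where
  "cupset k = {(k, Suc k)} \<union> {(v, 2 * N + 1 - v) | v. v < k} \<union>
     {(v, 2 * N + 3 - v) | v. k + 2 \<le> v \<and> v \<le> N + 1}"

definition clw :: "nat \<Rightarrow> weight" where
  "clw k = cl N 1 (wt k)"

lemma length_clw [simp]: "k \<le> N \<Longrightarrow> length (clw k) = 2 * N + 2"
  by (simp add: clw_def cl_def)

lemma nth_clw:
  "k \<le> N \<Longrightarrow> v < 2 * N + 2 \<Longrightarrow> clw k ! v = (if v = Suc k \<or> v \<ge> N + 2 then Wedge else Vee)"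
  by (auto simp: clw_def cl_def nth_append nth_Cons' nth_wt)

lemma cupset_disjoint:
  "k \<le> N \<Longrightarrow> p \<in> cupset k \<Longrightarrow> q \<in> cupset k \<Longrightarrow> p \<noteq> q \<Longrightarrow> {fst p, snd p} \<inter> {fst q, snd q} = {}"
  unfolding cupset_def by auto

lemma cupset_bounds: "k \<le> N \<Longrightarrow> (i, j) \<in> cupset k \<Longrightarrow> i < j \<and> j < 2 * N + 2"
  unfolding cupset_def by auto

lemma cupset_cover:
  assumes "k \<le> N" "v < 2 * N + 2"
  shows "\<exists>(i, j) \<in> cupset k. v = i \<or> v = j"
proof -
  consider "v < k" | "v = k" | "v = Suc k" | "k + 2 \<le> v" "v \<le> N + 1" | "N + 2 \<le> v" "2 * N + 1 - v < k"
    | "N + 2 \<le> v" "2 * N + 1 - v \<ge> k"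
    using assms by linarith
  then show ?thesis
  proof cases
    case 1
    then show ?thesis using assms by (auto simp: cupset_def intro!: bexI[of _ "(v, 2 * N + 1 - v)"])
  next
    case 4
    then show ?thesis using assms by (auto simp: cupset_def intro!: bexI[of _ "(v, 2 * N + 3 - v)"])
  next
    case 5
    then show ?thesis using assms
      by (auto simp: cupset_def intro!: bexI[of _ "(2 * N + 1 - v, v)"] exI[of _ "2 * N + 1 - v"])
  next
    case 6
    then show ?thesis using assms
      by (auto simp: cupset_def intro!: bexI[of _ "(2 * N + 3 - v, v)"] exI[of _ "2 * N + 3 - v"])
  qed (auto simp: cupset_def)
qed

lemma cup_diagram_cupset:
  assumes "k \<le> N"
  shows "cup_diagram (2 * N + 2) (cupset k)"
  unfolding cup_diagram_def
proof (intro conjI)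
  show "\<forall>(i, j)\<in>cupset k. i < j \<and> j < 2 * N + 2" using cupset_bounds[OF assms] by blast
  show "\<forall>p\<in>cupset k. \<forall>q\<in>cupset k. p \<noteq> q \<longrightarrow> {fst p, snd p} \<inter> {fst q, snd q} = {}"
    using cupset_disjoint[OF assms] by blast
  show "\<not> (\<exists>(i, j)\<in>cupset k. \<exists>(i', j')\<in>cupset k. i < i' \<and> i' < j \<and> j < j')"
    using assms unfolding cupset_def by auto
  have "rays (2 * N + 2) (cupset k) = {}"
    using cupset_cover[OF assms] unfolding rays_def by fastforce
  then show "\<not> (\<exists>(i, j)\<in>cupset k. \<exists>v\<in>rays (2 * N + 2) (cupset k). i < v \<and> v < j)" by auto
qed

text \<open>Uniqueness comes from building \<open>c\<close> inside out with
  \<open>enclosing_cup\<close>: the small cup, the nest to its right, then the outer nest around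
  both. Since \<open>cupset k\<close> already covers all vertices, a diagram containing it has no
  further cup.\<close>

lemma underline_clw:
  assumes k: "k \<le> N"
  shows "underline (clw k) = cupset k"
  unfolding underline_def
proof (rule the_equality)
  let ?w = "clw k"
  have rays: "rays (2 * N + 2) (cupset k) = {}"
    using cupset_cover[OF k] unfolding rays_def by fastforce
  have lab: "?w ! i = Vee \<and> ?w ! j = Wedge" if "(i, j) \<in> cupset k" for i j
    using that k cupset_bounds[OF k that] by (auto simp: nth_clw) (auto simp: cupset_def)
  have "{p \<in> cupset k. ?w ! fst p = Wedge \<and> ?w ! snd p = Vee} = {}" using lab by fastforce
  then have "num_clockwise (cupset k) ?w = 0" unfolding num_clockwise_def filter_pair by (simp only: card.empty)
  moreover have "?w ! i \<noteq> ?w ! j" if "(i, j) \<in> cupset k" for i j using lab[OF that] by simp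
  ultimately show "cup_diagram (length ?w) (cupset k) \<and> oriented (cupset k) ?w \<and> num_clockwise (cupset k) ?w = 0"
    using cup_diagram_cupset[OF k] rays
    unfolding length_clw[OF k] oriented_def by auto
  fix c assume c: "cup_diagram (length ?w) c \<and> oriented c ?w \<and> num_clockwise c ?w = 0"
  note enclosing = enclosing_cup[of ?w c, OF conjunct1[OF c] conjunct1[OF conjunct2[OF c]] conjunct2[OF conjunct2[OF c]]]
  have inner: "(k, Suc k) \<in> c"
    using k by (intro enclosing) (simp_all add: nth_clw)
  \<comment> \<open>The index \<open>m\<close> numbers the cups of the right nest from the innermost
    one, \<open>(N + 1, N + 2)\<close>, outwards, so the induction hypothesis matches everything
    that the next cup encloses.\<close>
  have right: "m < N - k \<longrightarrow> (N + 1 - m, N + 2 + m) \<in> c" for m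
  proof (induction m rule: less_induct)
    case (less m)
    show ?case
    proof
      assume m: "m < N - k"
      show "(N + 1 - m, N + 2 + m) \<in> c"
      proof (rule enclosing)
        fix v assume v: "N + 1 - m < v" "v < N + 2 + m"
        show "\<exists>(i, j) \<in> c. (v = i \<or> v = j) \<and> N + 1 - m < i \<and> j < N + 2 + m"
        proof (cases "v \<le> N + 1")
          case True
          then show ?thesis using less[of "N + 1 - v"] v m
            by (intro bexI[of _ "(v, N + 2 + (N + 1 - v))"]) auto
        next
          case False
          then obtain x where x: "v = N + 2 + x" using le_Suc_ex[of "N + 2" v] by auto
          then have "(N + 1 - x, v) \<in> c" using less[of x] v m by auto
          then show ?thesis using v m x by (intro bexI[of _ "(N + 1 - x, v)"]) auto
        qed
      qed (use m k in \<open>auto simp: nth_clw\<close>)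
    qed
  qed
  have right': "(v, 2 * N + 3 - v) \<in> c" if "k + 2 \<le> v" "v \<le> N + 1" for v
  proof -
    have "N + 1 - (N + 1 - v) = v" "N + 2 + (N + 1 - v) = 2 * N + 3 - v" "N + 1 - v < N - k" using that by linarith+
    then show ?thesis using right[of "N + 1 - v"] by (simp only:)
  qed
  \<comment> \<open>Here the numbering starts at \<open>(k - 1, 2 * N + 2 - k)\<close>, the
    innermost cup of the outer nest; it encloses the small cup and the whole right nest.\<close>
  have left: "m < k \<longrightarrow> (k - 1 - m, 2 * N + 1 - (k - 1 - m)) \<in> c" for m
  proof (induction m rule: less_induct)
    case (less m)
    show ?case
    proof
      assume m: "m < k"
      show "(k - 1 - m, 2 * N + 1 - (k - 1 - m)) \<in> c"
      proof (rule enclosing)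
        fix v assume v: "k - 1 - m < v" "v < 2 * N + 1 - (k - 1 - m)"
        then have "v < 2 * N + 2" by simp
        from cupset_cover[OF k this] obtain x y where xy: "(x, y) \<in> cupset k" "v = x \<or> v = y" by auto
        have "(x, y) \<in> c \<and> k - 1 - m < x \<and> y < 2 * N + 1 - (k - 1 - m)"
        proof (cases "x < k")
          case True
          then have y: "y = 2 * N + 1 - x" using xy(1) by (auto simp: cupset_def)
          then have x: "k - 1 - m < x" using xy(2) v True k by auto
          have "k - 1 - (k - 1 - x) = x" "k - 1 - x < m" "k - 1 - x < k" using x True m by linarith+
          then have "(x, y) \<in> c" using less[of "k - 1 - x"] y by (simp only:)
          then show ?thesis using x y True k by auto
        next
          case False
          then have "(x, y) \<in> c" using xy(1) inner right' by (auto simp: cupset_def)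
          moreover have "y < 2 * N + 1 - (k - 1 - m)" using False xy(1) m k by (auto simp: cupset_def)
          ultimately show ?thesis using False m by auto
        qed
        then show "\<exists>(i, j) \<in> c. (v = i \<or> v = j) \<and> k - 1 - m < i \<and> j < 2 * N + 1 - (k - 1 - m)"
          using xy(2) by auto
      qed (use m k in \<open>auto simp: nth_clw\<close>)
    qed
  qed
  have left': "(v, 2 * N + 1 - v) \<in> c" if "v < k" for v
  proof -
    have "k - 1 - (k - 1 - v) = v" "k - 1 - v < k" using that by linarith+
    then show ?thesis using left[of "k - 1 - v"] by (simp only:)
  qed
  have sub: "cupset k \<subseteq> c" using inner left' right' by (auto simp: cupset_def)
  moreover have "p \<in> cupset k" if p: "p \<in> c" for p
  proof -
    have "fst p < snd p" "snd p < 2 * N + 2"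
      using p c cup_diagramD(1,2)[of "length ?w" c "fst p" "snd p"] length_clw[OF k] by auto
    then have "fst p < 2 * N + 2" by simp
    from cupset_cover[OF k this] obtain q where q: "q \<in> cupset k" "fst p = fst q \<or> fst p = snd q" by auto
    then have "p = q" using p sub cup_diagramD(3)[of "length ?w" c p q] c by auto
    then show ?thesis using q by simp
  qed
  ultimately show "c = cupset k" by auto
qed

text \<open>The index is recovered as the only \<open>v \<le> N\<close> for which
  \<open>(v, Suc v)\<close> is a cup; the bound excludes the cup \<open>(N + 1, N + 2)\<close> of
  the right nest. Hence two closed diagrams are composable exactly if their inner indices
  agree.\<close>

lemma cupset_inject: 
  assumes "k \<le> N" "l \<le> N" 
  shows "cupset k = cupset l \<longleftrightarrow> k = l"
proof -
  have *: "(v, Suc v) \<in> cupset l \<Longrightarrow> v \<le> N \<Longrightarrow> l \<le> N \<Longrightarrow> v = l" for v l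
    by (auto simp: cupset_def)
  have "(k, Suc k) \<in> cupset k" by (simp add: cupset_def)
  then show ?thesis using * assms by auto
qed

end

section \<open>Surgery\<close>

lemma circle_self [simp]: "x \<in> circle E x"
  by (simp add: circle_def)

lemma circle_step: "u \<in> circle E x \<Longrightarrow> (u, v) \<in> E \<or> (v, u) \<in> E \<Longrightarrow> v \<in> circle E x"
  unfolding circle_def by (auto intro: rtrancl_into_rtrancl)

lemma circle_sym: "y \<in> circle E x \<longleftrightarrow> x \<in> circle E y"
proof -
  have "sym ((E \<union> E\<inverse>)\<^sup>*)" by (intro sym_rtrancl) (auto simp: sym_def)
  then show ?thesis unfolding circle_def by (auto dest: symD)
qed

text \<open>Circles are computed by two inclusions: a set closed under the edges bounds a circle
  from above, and explicit paths built with \<open>circle_step\<close> bound it from below.\<close>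

lemma circle_subset:
  assumes "\<And>u v. (u, v) \<in> E \<Longrightarrow> u \<in> T \<longleftrightarrow> v \<in> T" "x \<in> T"
  shows "circle E x \<subseteq> T"
proof
  fix y assume "y \<in> circle E x"
  then have "(x, y) \<in> (E \<union> E\<inverse>)\<^sup>*" by (simp add: circle_def)
  then show "y \<in> T" by (induction rule: rtrancl_induct) (use assms in auto)
qed

lemma in_row_iff: "((u, r), (v, r')) \<in> in_row q c \<longleftrightarrow> r = q \<and> r' = q \<and> (u, v) \<in> c"
  unfolding in_row_def by force

lemma stage_iff:
  "((u, r), (v, r')) \<in> stage a b d s \<longleftrightarrow>
     r = 0 \<and> r' = 0 \<and> ((u, v) \<in> a \<or> (u, v) \<in> b - s) \<or> r = 1 \<and> r' = 1 \<and> ((u, v) \<in> d \<or> (u, v) \<in> b - s) \<or>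
     r = 0 \<and> r' = 1 \<and> u = v \<and> (\<exists>w. (u, w) \<in> s \<or> (w, u) \<in> s)"
  unfolding stage_def Un_iff in_row_iff by auto

lemma stage_closed:
  assumes "\<And>u v. (u, v) \<in> a \<Longrightarrow> (u, 0) \<in> T \<longleftrightarrow> (v, 0) \<in> T"
    and "\<And>u v. (u, v) \<in> d \<Longrightarrow> (u, 1) \<in> T \<longleftrightarrow> (v, 1) \<in> T"
    and "\<And>u v. (u, v) \<in> b - s \<Longrightarrow> (u, 0) \<in> T \<longleftrightarrow> (v, 0) \<in> T"
    and "\<And>u v. (u, v) \<in> b - s \<Longrightarrow> (u, 1) \<in> T \<longleftrightarrow> (v, 1) \<in> T"
    and "\<And>u v. (u, v) \<in> s \<Longrightarrow> (u, 0) \<in> T \<longleftrightarrow> (u, 1) \<in> T"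
    and "\<And>u v. (u, v) \<in> s \<Longrightarrow> (v, 0) \<in> T \<longleftrightarrow> (v, 1) \<in> T"
    and "x \<in> T"
  shows "circle (stage a b d s) x \<subseteq> T"
proof (rule circle_subset)
  fix y z assume yz: "(y, z) \<in> stage a b d s"
  obtain u r v r' where e: "y = (u, r)" "z = (v, r')" by (metis surj_pair)
  show "y \<in> T \<longleftrightarrow> z \<in> T" using yz assms(1-6) unfolding e stage_iff by auto
qed (rule assms)

lemma stage_edges:
  "(u, v) \<in> a \<Longrightarrow> ((u, 0), (v, 0)) \<in> stage a b d s"
  "(u, v) \<in> d \<Longrightarrow> ((u, 1), (v, 1)) \<in> stage a b d s"
  "(u, v) \<in> s \<Longrightarrow> ((u, 0), (u, 1)) \<in> stage a b d s"
  "(u, v) \<in> s \<Longrightarrow> ((v, 0), (v, 1)) \<in> stage a b d s"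
  unfolding stage_iff by auto

definition matching :: "cups \<Rightarrow> bool" where
  "matching c \<longleftrightarrow> (\<forall>p \<in> c. \<forall>q \<in> c. p \<noteq> q \<longrightarrow> {fst p, snd p} \<inter> {fst q, snd q} = {})"

lemma matching_iff: "matching c \<Longrightarrow> (i, j) \<in> c \<Longrightarrow> (u, v) \<in> c \<Longrightarrow> u \<in> {i, j} \<longleftrightarrow> v \<in> {i, j}"
  unfolding matching_def by fastforce

lemma matching_disjoint:
  "matching c \<Longrightarrow> (i, j) \<in> c \<Longrightarrow> (u, v) \<in> c \<Longrightarrow> (u, v) \<noteq> (i, j) \<Longrightarrow> u \<noteq> i \<and> u \<noteq> j \<and> v \<noteq> i \<and> v \<noteq> j"
  unfolding matching_def by fastforce

text \<open>A cap that also occurs as a cup of the bottom diagram closes up with it to a circle on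
  two vertices, as long as its own surgery has not been performed. The surgery at a shared cap is
  therefore always a merge, whatever happened at the other caps.\<close>

lemma shared_cap_lower:
  assumes "matching a" "matching b" "s \<subseteq> b" "(i, j) \<in> a" "(i, j) \<in> b - s"
  shows "circle (stage a b d s) (i, 0) = {(i, 0), (j, 0)}"
proof
  show "circle (stage a b d s) (i, 0) \<subseteq> {(i, 0), (j, 0)}"
  proof (rule stage_closed)
    fix u v assume uv: "(u, v) \<in> s"
    with assms have "(u, v) \<in> b" "(i, j) \<in> b" "(u, v) \<noteq> (i, j)" by auto
    from matching_disjoint[OF assms(2) this(2,1,3)]
    show "(u, 0) \<in> {(i, 0), (j, 0)} \<longleftrightarrow> (u, 1) \<in> {(i, 0), (j, 0::nat)}"
      "(v, 0) \<in> {(i, 0), (j, 0)} \<longleftrightarrow> (v, 1) \<in> {(i, 0), (j, 0::nat)}" by auto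
  qed (use matching_iff[OF assms(1,4)] matching_iff[OF assms(2)] assms(5) in auto)
  show "{(i, 0), (j, 0)} \<subseteq> circle (stage a b d s) (i, 0)"
    using circle_step[OF circle_self disjI1, OF stage_edges(1)[OF assms(4)]] by auto
qed

lemma shared_cap_upper:
  assumes "matching d" "matching b" "s \<subseteq> b" "(i, j) \<in> d" "(i, j) \<in> b - s"
  shows "circle (stage a b d s) (i, 1) = {(i, 1), (j, 1)}"
proof
  show "circle (stage a b d s) (i, 1) \<subseteq> {(i, 1), (j, 1)}"
  proof (rule stage_closed)
    fix u v assume uv: "(u, v) \<in> s"
    with assms have "(u, v) \<in> b" "(i, j) \<in> b" "(u, v) \<noteq> (i, j)" by auto
    from matching_disjoint[OF assms(2) this(2,1,3)]
    show "(u, 0) \<in> {(i, 1), (j, 1)} \<longleftrightarrow> (u, 1) \<in> {(i, 1), (j, 1::nat)}"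
      "(v, 0) \<in> {(i, 1), (j, 1)} \<longleftrightarrow> (v, 1) \<in> {(i, 1), (j, 1::nat)}" by auto
  qed (use matching_iff[OF assms(1,4)] matching_iff[OF assms(2)] assms(5) in auto)
  show "{(i, 1), (j, 1)} \<subseteq> circle (stage a b d s) (i, 1)"
    using circle_step[OF circle_self disjI1, OF stage_edges(2)[OF assms(4)]] by auto
qed

lemma shared_cap_merge:
  assumes "matching a" "matching b" "matching d" "s \<subseteq> b" "(i, j) \<in> a \<or> (i, j) \<in> d" "(i, j) \<in> b - s"
  shows "(i, 1) \<notin> circle (stage a b d s) (i, 0)"
proof (cases "(i, j) \<in> a")
  case True
  then show ?thesis using shared_cap_lower[OF assms(1,2,4) _ assms(6)] by auto
next
  case False
  then show ?thesis using shared_cap_upper[OF assms(3,2,4) _ assms(6)] assms(5)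
    circle_sym[of "(i, 1)" "stage a b d s" "(i, 0)"] by auto
qed

lemma surgeries_append:
  "surgeries a b d s (ps @ qs) S = concat (map (surgeries a b d (s \<union> set ps) qs) (surgeries a b d s ps S))"
proof (induction ps arbitrary: s S)
  case (Cons p ps)
  have *: "concat (map h (concat zs)) = concat (map (\<lambda>z. concat (map h z)) zs)"
    for h :: "vertex set \<Rightarrow> vertex set list" and zs by (induction zs) auto
  have IH: "surgeries a b d s (ps @ qs) = (\<lambda>S. concat (map (surgeries a b d (s \<union> set ps) qs) (surgeries a b d s ps S)))" for s
    by (rule ext) (rule Cons.IH)
  show ?case by (simp add: IH * o_def)
qed simp

text \<open>All surgeries here are merges, and a merge of two circles that both carry 1 changes
  nothing. Only the ends of the caps in \<open>ps\<close> have to be unmarked, so the lemma also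
  disposes of the caps away from the vertices where marks are placed.\<close>

lemma surgeries_unmarked:
  assumes "matching a" "matching b" "matching d"
    and "s \<union> set ps \<subseteq> b" "s \<inter> set ps = {}" "distinct ps" "set ps \<subseteq> a \<union> d"
    and "\<And>i j. (i, j) \<in> set ps \<Longrightarrow> (i, 0) \<notin> S \<and> (i, 1) \<notin> S"
  shows "surgeries a b d s ps S = [S]"
  using assms(4-8)
proof (induction ps arbitrary: s)
  case (Cons p ps)
  obtain i j where p: "p = (i, j)" by force
  have "(i, 1) \<notin> circle (stage a b d s) (i, 0)"
    by (rule shared_cap_merge) (use Cons.prems assms(1-3) p in auto)
  then have "surgery (stage a b d s) (stage a b d (insert p s)) p S = [S]"
    using Cons.prems(5)[of i j] p by (simp add: surgery_def)
  moreover have "surgeries a b d (insert p s) ps S = [S]"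
    by (rule Cons.IH) (use Cons.prems in auto)
  ultimately show ?case by simp
qed simp

text \<open>Neither merging nor splitting ever turns an \<open>x\<close> into a 1. Consequently a
  product with a factor that carries an \<open>x\<close> has no component in which all circles carry
  1.\<close>

lemma surgeries_increasing: "S' \<in> set (surgeries a b d s ps S) \<Longrightarrow> S \<subseteq> S'"
proof (induction ps arbitrary: s S)
  case (Cons p ps)
  obtain i j where p: "p = (i, j)" by force
  from Cons.prems obtain S'' where S: "S'' \<in> set (surgery (stage a b d s) (stage a b d (insert p s)) p S)"
    "S' \<in> set (surgeries a b d (insert p s) ps S'')" by auto
  then have "S'' \<subseteq> S'" using Cons.IH by blast
  moreover have "S \<subseteq> S''" using S(1) unfolding p surgery_def by (auto split: if_splits)
  ultimately show ?case by blast
qed simp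

text \<open>With three equal diagrams all caps are shared, and only the surgery at
  \<open>(i, j)\<close> sees a mark. The three cases are \<open>x * 1 = x\<close>,
  \<open>1 * x = x\<close> and \<open>x * x = 0\<close> in the Frobenius algebra.\<close>

lemma surgeries_idempotent:
  assumes c: "matching c" "(i, j) \<in> c" and ps: "distinct ps" "set ps = c"
  shows "surgeries c c c {} ps ({i, j} \<times> {0}) = [{i, j} \<times> {0, 1}]"
    and "surgeries c c c {} ps ({i, j} \<times> {1}) = [{i, j} \<times> {0, 1}]"
    and "surgeries c c c {} ps ({i, j} \<times> {0, 1}) = []"
proof -
  from c ps obtain qs rs where qr: "ps = qs @ (i, j) # rs" by (meson split_list)
  have un: "surgeries c c c s xs S = [S]" if "s \<union> set xs \<subseteq> c" "s \<inter> set xs = {}" "distinct xs"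
     "(i, j) \<notin> set xs" "S \<subseteq> {i, j} \<times> UNIV" for s xs S
  proof (rule surgeries_unmarked)
    fix u v assume uv: "(u, v) \<in> set xs"
    then have "(u, v) \<in> c" "(u, v) \<noteq> (i, j)" using that by auto
    then have "u \<noteq> i" "u \<noteq> j" using matching_disjoint[OF c] by blast+
    then show "(u, 0) \<notin> S \<and> (u, 1) \<notin> S" using that(5) by blast
  qed (use c that in auto)
  let ?E = "stage c c c (set qs)"
  have circ: "circle ?E (i, 0) = {(i, 0), (j, 0)}" "circle ?E (i, 1) = {(i, 1), (j, 1)}"
    by (intro shared_cap_lower shared_cap_upper; use c ps qr in auto)+
  have step: "surgeries c c c {} ps S = concat (map (surgeries c c c (insert (i, j) (set qs)) rs)
     (surgery ?E (stage c c c (insert (i, j) (set qs))) (i, j) S))" if S: "S \<subseteq> {i, j} \<times> UNIV" for S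
  proof -
    have "surgeries c c c {} qs S = [S]" by (rule un) (use S ps qr in auto)
    then show ?thesis by (simp add: qr surgeries_append)
  qed
  have last: "surgeries c c c (insert (i, j) (set qs)) rs ({i, j} \<times> {0, 1}) = [{i, j} \<times> {0, 1}]"
    by (rule un) (use ps qr in auto)
  have "surgery ?E E' (i, j) ({i, j} \<times> {0}) = [{i, j} \<times> {0, 1}]"
    and "surgery ?E E' (i, j) ({i, j} \<times> {1}) = [{i, j} \<times> {0, 1}]"
    and "surgery ?E E' (i, j) ({i, j} \<times> {0, 1}) = []" for E'
    by (auto simp: surgery_def circ simp del: One_nat_def)
  then show "surgeries c c c {} ps ({i, j} \<times> {0}) = [{i, j} \<times> {0, 1}]"
    and "surgeries c c c {} ps ({i, j} \<times> {1}) = [{i, j} \<times> {0, 1}]"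
    and "surgeries c c c {} ps ({i, j} \<times> {0, 1}) = []"
    using last by (subst step; force)+
qed

text \<open>Of the two caps at which \<open>b\<close> differs from \<open>a\<close>, the first to be treated merges the two circles
  through the four vertices \<open>{p, p', q, q'}\<close>, and the second splits the result.\<close>

lemma surgeries_merge_split:
  assumes ab: "matching a" "matching b"
    and a: "a = {(x, x'), (y, y')} \<union> g" and b: "b = {(p, p'), (q, q')} \<union> g"
    and L: "{p, p', q, q'} = {x, x', y, y'}" "distinct [p, p', q, q']"
    and x: "(q, q') \<notin> a" "(q', q) \<notin> a" "distinct [x, x', y, y']"
    and g: "\<And>u v. (u, v) \<in> g \<Longrightarrow> u \<notin> {p, p', q, q'} \<and> v \<notin> {p, p', q, q'}"
    and ps: "ps = ps1 @ (p, p') # ps2 @ (q, q') # ps3" "distinct ps" "set ps = b"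
  shows "mset (surgeries a b a {} ps {}) = {# {x, x'} \<times> {0, 1}, {y, y'} \<times> {0, 1} #}"
proof -
  let ?L = "{p, p', q, q'}"
  have un: "surgeries a b a s xs S = [S]" if "s \<union> set xs \<subseteq> b" "s \<inter> set xs = {}" "distinct xs"
     "set xs \<subseteq> g" "S \<subseteq> ?L \<times> UNIV" for s xs S
  proof (rule surgeries_unmarked)
    fix u v assume uv: "(u, v) \<in> set xs"
    then show "(u, 0) \<notin> S \<and> (u, 1) \<notin> S" using g[of u v] that by auto
  qed (use ab a that in auto)
  have g123: "set ps1 \<subseteq> g" "set ps2 \<subseteq> g" "set ps3 \<subseteq> g" using ps b by auto
  let ?s1 = "set ps1" and ?s2 = "insert (p, p') (set ps1 \<union> set ps2)"
  let ?s3 = "insert (q, q') ?s2"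
  have aL: "(u, v) \<in> a \<Longrightarrow> u \<in> ?L \<longleftrightarrow> v \<in> ?L" for u v using a L g[of u v] by auto
  have bL: "(u, v) \<in> b \<Longrightarrow> u \<in> ?L \<longleftrightarrow> v \<in> ?L" for u v using b L g[of u v] by auto
  have "circle (stage a b a ?s1) (p, 0) \<subseteq> ?L \<times> {0}"
  proof (rule stage_closed)
    fix u v assume uv: "(u, v) \<in> ?s1"
    then have "(u, v) \<in> g" using g123 by auto
    from g[OF this] show "(u, 0) \<in> ?L \<times> {0} \<longleftrightarrow> (u, 1) \<in> ?L \<times> {0::nat}"
      "(v, 0) \<in> ?L \<times> {0} \<longleftrightarrow> (v, 1) \<in> ?L \<times> {0::nat}" by auto
  qed (use aL bL in auto)
  then have merge: "(p, 1) \<notin> circle (stage a b a ?s1) (p, 0)" by auto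
  \<comment> \<open>The first surgery has put vertical segments at \<open>p\<close> and
    \<open>p'\<close>. As \<open>(q, q')\<close> is no cup of \<open>a\<close> in either order,
    \<open>a\<close> joins \<open>q\<close> to one of these two vertices, say \<open>r\<close>; the
    path goes from \<open>q\<close> to \<open>r\<close> in the lower row, up at \<open>r\<close>,
    and back to \<open>q\<close> in the upper row.\<close>
  have conn: "(q, 1) \<in> circle (stage a b a ?s2) (q, 0)"
  proof -
    have "q \<in> {x, x', y, y'}" using L(1) by blast
    then have "\<exists>r \<in> {x, x', y, y'}. r \<noteq> q \<and> ((q, r) \<in> a \<or> (r, q) \<in> a)"
      using x(3) unfolding a by (elim insertE emptyE) auto
    then obtain r where r: "(q, r) \<in> a \<or> (r, q) \<in> a" "r \<in> ?L" "r \<noteq> q" using L(1) by auto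
    then have "r = p \<or> r = p'" using x by auto
    note r = this r(1)
    have "(r, 0) \<in> circle (stage a b a ?s2) (q, 0)"
      using r(2) by (intro circle_step[OF circle_self]) (auto simp: stage_iff)
    then have "(r, 1) \<in> circle (stage a b a ?s2) (q, 0)"
      using r(1) by (rule_tac circle_step) (auto simp: stage_iff)
    then show ?thesis using r(2) by (rule_tac circle_step) (auto simp: stage_iff)
  qed
  have circ: "circle (stage a b a ?s3) (r, 0) = {r, r'} \<times> {0, 1}"
    if r: "(r, r') \<in> {(x, x'), (y, y'), (x', x), (y', y)}" for r r'
  proof
    have ra: "(r, r') \<in> a \<or> (r', r) \<in> a" using r a by auto
    then have riff: "(u, v) \<in> a \<Longrightarrow> u \<in> {r, r'} \<longleftrightarrow> v \<in> {r, r'}" for u v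
      using matching_iff[OF ab(1), of r r' u v] matching_iff[OF ab(1), of r' r u v] by auto
    have rL: "r \<in> ?L" "r' \<in> ?L" using r L by auto
    show "circle (stage a b a ?s3) (r, 0) \<subseteq> {r, r'} \<times> {0, 1}"
    proof (rule stage_closed)
      fix u v assume "(u, v) \<in> b - ?s3"
      then have "(u, v) \<in> g" using b by auto
      from g[OF this] rL show "(u, 0) \<in> {r, r'} \<times> {0, 1} \<longleftrightarrow> (v, 0) \<in> {r, r'} \<times> {0, 1::nat}"
        "(u, 1) \<in> {r, r'} \<times> {0, 1} \<longleftrightarrow> (v, 1) \<in> {r, r'} \<times> {0, 1::nat}" by auto
    qed (use riff in auto)
    have *: "(r, 1) \<in> circle (stage a b a ?s3) (r, 0)"
      using rL by (intro circle_step[OF circle_self]) (auto simp: stage_iff)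
    moreover have "(r', 0) \<in> circle (stage a b a ?s3) (r, 0)"
      using ra by (intro circle_step[OF circle_self]) (auto simp: stage_iff)
    moreover have "(r', 1) \<in> circle (stage a b a ?s3) (r, 0)"
      using ra by (intro circle_step[OF * ]) (auto simp: stage_iff)
    ultimately show "{r, r'} \<times> {0, 1} \<subseteq> circle (stage a b a ?s3) (r, 0)" by auto
  qed
  have cx: "circle (stage a b a ?s3) (r, 0) = {x, x'} \<times> {0, 1}" if "r \<in> {x, x'}" for r
    using that circ[of x x'] circ[of x' x, unfolded insert_commute[of x' x]] by blast
  have cy: "circle (stage a b a ?s3) (r, 0) = {y, y'} \<times> {0, 1}" if "r \<in> {y, y'}" for r
    using that circ[of y y'] circ[of y' y, unfolded insert_commute[of y' y]] by blast
  \<comment> \<open>After the split the circles are the two components of the double of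
    \<open>a\<close>, and \<open>q\<close>, \<open>q'\<close> lie on different ones because no cup
    of \<open>a\<close> joins them. Which of the two comes first depends on the case, hence the
    multiset.\<close>
  have split: "mset [circle (stage a b a ?s3) (q, 0), circle (stage a b a ?s3) (q', 0)] =
     {# {x, x'} \<times> {0, 1}, {y, y'} \<times> {0, 1} #}"
  proof -
    have "q \<in> {x, x', y, y'}" "q' \<in> {x, x', y, y'}" using L(1) by blast+
    moreover have "(x, x') \<in> a" "(y, y') \<in> a" using a by auto
    ultimately have "(q \<in> {x, x'} \<and> q' \<in> {y, y'}) \<or> (q \<in> {y, y'} \<and> q' \<in> {x, x'})"
      using x(1,2) L(2) by auto
    then show ?thesis
    proof (elim disjE conjE)
      assume "q \<in> {x, x'}" "q' \<in> {y, y'}"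
      then show ?thesis by (simp only: cx cy mset.simps)
    next
      assume "q \<in> {y, y'}" "q' \<in> {x, x'}"
      then show ?thesis by (simp only: cx cy mset.simps add_mset_commute)
    qed
  qed
  have "surgeries a b a {} ps {} = concat (map (surgeries a b a ?s1 ((p, p') # ps2 @ (q, q') # ps3)) [{}])"
  proof -
    have "surgeries a b a {} ps1 {} = [{}]" by (rule un) (use ps g123 in auto)
    then show ?thesis by (simp only: ps(1) surgeries_append Un_empty_left)
  qed
  also have "\<dots> = surgeries a b a (insert (p, p') ?s1) (ps2 @ (q, q') # ps3) {}"
    using merge by (simp add: surgery_def)
  also have "\<dots> = surgeries a b a ?s2 ((q, q') # ps3) {}"
  proof -
    have "surgeries a b a (insert (p, p') ?s1) ps2 {} = [{}]" by (rule un) (use ps g123 in auto)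
    then show ?thesis by (simp add: surgeries_append)
  qed
  also have "\<dots> = concat (map (surgeries a b a ?s3 ps3)
      [circle (stage a b a ?s3) (q, 0), circle (stage a b a ?s3) (q', 0)])"
    using conn by (simp add: surgery_def)
  also have "\<dots> = [circle (stage a b a ?s3) (q, 0), circle (stage a b a ?s3) (q', 0)]"
  proof -
    have "surgeries a b a ?s3 ps3 (circle (stage a b a ?s3) (r, 0)) = [circle (stage a b a ?s3) (r, 0)]"
      if "r \<in> ?L" for r
    proof (rule un)
      have sub: "{x, x'} \<subseteq> ?L" "{y, y'} \<subseteq> ?L" using L(1) by blast+
      show "circle (stage a b a ?s3) (r, 0) \<subseteq> ?L \<times> UNIV"
      proof (cases "r \<in> {x, x'}")
        case True
        show ?thesis unfolding cx[OF True] by (rule Sigma_mono[OF sub(1)]) simp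
      next
        case False
        then have "r \<in> {y, y'}" using that L(1) by blast
        then show ?thesis unfolding cy[OF \<open>r \<in> {y, y'}\<close>] by (intro Sigma_mono[OF sub(2)]) simp
      qed
    qed (use ps g123 in auto)
    from this[of q] this[of q']
    have "surgeries a b a ?s3 ps3 (circle (stage a b a ?s3) (q, 0)) = [circle (stage a b a ?s3) (q, 0)]"
      and "surgeries a b a ?s3 ps3 (circle (stage a b a ?s3) (q', 0)) = [circle (stage a b a ?s3) (q', 0)]"
      by blast+
    then show ?thesis unfolding list.map concat.simps by (metis append.simps)
  qed
  finally show ?thesis using split by (simp only:)
qed

section \<open>Structure constants of the arc algebra\<close>

context one_wedge
begin

abbreviation eE :: "nat \<Rightarrow> diagram" where "eE i \<equiv> diag i i i"
abbreviation eX :: "nat \<Rightarrow> diagram" where "eX i \<equiv> diag (Suc i) i (Suc i)"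
abbreviation eU :: "nat \<Rightarrow> diagram" where "eU i \<equiv> diag i i (Suc i)"
abbreviation eV :: "nat \<Rightarrow> diagram" where "eV i \<equiv> diag (Suc i) i i"

lemma diagram_cases:
  assumes "p \<in> diagrams N 1"
  obtains i where "i \<le> N" "p = eE i" | i where "i < N" "p = eX i"
    | i where "i < N" "p = eU i" | i where "i < N" "p = eV i"
proof -
  from assms obtain i k j where *: "p = diag i k j" "i \<le> N" "k \<le> N" "j \<le> N"
    "k = i \<or> Suc k = i" "k = j \<or> Suc k = j" unfolding diagrams_eq by blast
  from *(5,6) show thesis
    by (elim disjE) (use * that in auto)
qed

lemma in_diagrams [simp]:
  "i \<le> N \<Longrightarrow> eE i \<in> diagrams N 1" "i < N \<Longrightarrow> eX i \<in> diagrams N 1"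
  "i < N \<Longrightarrow> eU i \<in> diagrams N 1" "i < N \<Longrightarrow> eV i \<in> diagrams N 1"
  unfolding diagrams_eq by (blast intro: less_imp_le Suc_leI)+

lemma finite_diagrams: "finite (diagrams N 1)"
proof -
  have "diagrams N 1 \<subseteq> weights N 1 \<times> weights N 1 \<times> weights N 1"
    unfolding diagrams_def by auto
  then show ?thesis using finite_weights by (meson finite_SigmaI finite_subset)
qed

lemma finite_cupset: "k \<le> N \<Longrightarrow> finite (cupset k)"
  by (rule finite_subset[of _ "{..<2 * N + 2} \<times> {..<2 * N + 2}"]) (use cupset_bounds in fastforce)+

lemma matching_cupset: "k \<le> N \<Longrightarrow> matching (cupset k)"
  using cupset_disjoint unfolding matching_def by blast

text \<open>Sorting by left end is a fold whose insertions commute only for elements with different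
  keys. Left ends of distinct cups differ, so the fold is interpreted on \<open>cupset k\<close>
  rather than on all pairs.\<close>

lemma cap_list:
  assumes "k \<le> N"
  shows "set (sorted_key_list_of_set fst (cupset k)) = cupset k"
    and "distinct (sorted_key_list_of_set fst (cupset k))"
proof -
  let ?ins = "insort_key (fst :: nat \<times> nat \<Rightarrow> nat)"
  have inj: "fst p \<noteq> fst q" if "p \<in> cupset k" "q \<in> cupset k" "p \<noteq> q" for p q
    using that cupset_disjoint[OF assms that] by auto
  interpret folding_on "cupset k" ?ins "[]"
  proof
    fix x y assume "x \<in> cupset k" "y \<in> cupset k"
    then show "?ins y \<circ> ?ins x = ?ins x \<circ> ?ins y"
      using inj[of x y] by (cases "x = y") (auto simp: fun_eq_iff insort_key_left_comm)
  qed
  have "A \<subseteq> cupset k \<longrightarrow> set (F A) = A \<and> distinct (F A)" if "finite A" for A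
    using that by (induction A) (auto simp: set_insort_key distinct_insort)
  from this[OF finite_cupset[OF assms]] show "set (sorted_key_list_of_set fst (cupset k)) = cupset k"
    and "distinct (sorted_key_list_of_set fst (cupset k))"
    unfolding sorted_key_list_of_set_def by auto
qed

lemma cl_diagram_diag:
  "i \<le> N \<Longrightarrow> k \<le> N \<Longrightarrow> j \<le> N \<Longrightarrow> cl_diagram N 1 (diag i k j) = (cupset i, clw k, cupset j)"
  using underline_clw by (simp add: cl_diagram_def diag_def clw_def)

text \<open>The leftmost vertex of a circle is a left end both of its cup and of its cap, since the
  other end lies on the same circle and so cannot be further left.\<close>

lemma cupset_circle:
  assumes "i \<le> N" "j \<le> N" "v < 2 * N + 2"
  shows "finite (circle (cupset i \<union> cupset j) v)"
    and "Min (circle (cupset i \<union> cupset j) v) < 2 * N + 2"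
    and "\<exists>w. (Min (circle (cupset i \<union> cupset j) v), w) \<in> cupset i"
    and "\<exists>w. (Min (circle (cupset i \<union> cupset j) v), w) \<in> cupset j"
proof -
  let ?E = "cupset i \<union> cupset j" and ?m = "Min (circle (cupset i \<union> cupset j) v)"
  have sub: "circle ?E v \<subseteq> {..<2 * N + 2}"
    by (rule circle_subset) (use assms cupset_bounds[of i] cupset_bounds[of j] in fastforce)+
  then show fin: "finite (circle ?E v)" by (rule finite_subset) simp
  have m: "?m \<in> circle ?E v" by (rule Min_in[OF fin]) (use circle_self[of v ?E] in blast)
  then show lt: "?m < 2 * N + 2" using sub by blast
  have "\<exists>w. (?m, w) \<in> cupset l" if l: "l \<le> N" "cupset l \<subseteq> ?E" for l
  proof -
    from cupset_cover[OF l(1) lt] obtain x y where xy: "(x, y) \<in> cupset l" "?m = x \<or> ?m = y" by auto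
    then have "x \<in> circle ?E v" using m l circle_step[of y ?E v x] by auto
    then have "?m \<le> x" using fin by simp
    then show ?thesis using xy cupset_bounds[OF l(1) xy(1)] by auto
  qed
  then show "\<exists>w. (?m, w) \<in> cupset i" "\<exists>w. (?m, w) \<in> cupset j" using assms by auto
qed

text \<open>All left ends of \<open>cupset k\<close> carry \<open>Vee\<close> in
  \<open>clw k\<close>. The leftmost vertex of a circle is a left end for the lower and for the
  upper diagram, so agreement of \<open>k\<close> with one of them makes every circle
  anticlockwise.\<close>

lemma clockwise_none:
  assumes "i \<le> N" "j \<le> N" "k = i \<or> k = j"
  shows "clockwise_vertices (cupset i, clw k, cupset j) = {}"
proof -
  have "clw k ! Min (circle (cupset i \<union> cupset j) v) = Vee" if v: "v < 2 * N + 2" for v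
  proof -
    have k: "k \<le> N" using assms by auto
    obtain w where w: "(Min (circle (cupset i \<union> cupset j) v), w) \<in> cupset k"
      using cupset_circle(3,4)[OF assms(1,2) v] assms(3) by blast
    then have "Min (circle (cupset i \<union> cupset j) v) \<noteq> Suc k" "Min (circle (cupset i \<union> cupset j) v) < N + 2"
      using k by (auto simp: cupset_def)
    then show ?thesis using nth_clw[OF k, of "Min (circle (cupset i \<union> cupset j) v)"] k by simp
  qed
  then show ?thesis using assms by (auto simp: clockwise_vertices_def)
qed

text \<open>With equal diagrams below and above, each circle consists of two vertices. Compared with
  the weight \<open>clw (Suc i)\<close>, which makes all circles anticlockwise, \<open>clw i\<close>
  interchanges the labels at \<open>Suc i\<close> and \<open>Suc (Suc i)\<close>, the ends of the
  small cup.\<close>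

lemma clockwise_X:
  assumes "i < N"
  shows "clockwise_vertices (cupset (Suc i), clw i, cupset (Suc i)) = {Suc i, Suc (Suc i)}"
proof -
  let ?c = "cupset (Suc i)"
  have circ: "circle (?c \<union> ?c) x = {x, y} \<and> circle (?c \<union> ?c) y = {x, y}" if xy: "(x, y) \<in> ?c" for x y
  proof -
    have mi: "\<And>u v. (u, v) \<in> ?c \<union> ?c \<Longrightarrow> u \<in> {x, y} \<longleftrightarrow> v \<in> {x, y}"
      using matching_iff[OF matching_cupset xy] assms by auto
    have "circle (?c \<union> ?c) x \<subseteq> {x, y}" "circle (?c \<union> ?c) y \<subseteq> {x, y}"
      by (rule circle_subset; use mi in blast)+
    moreover have "y \<in> circle (?c \<union> ?c) x" "x \<in> circle (?c \<union> ?c) y"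
      by (rule circle_step[OF circle_self]; use xy in blast)+
    ultimately show ?thesis using circle_self[of x "?c \<union> ?c"] circle_self[of y "?c \<union> ?c"] by blast
  qed
  have "clw i ! Min (circle (?c \<union> ?c) v) = Wedge \<longleftrightarrow> v \<in> {Suc i, Suc (Suc i)}" if v: "v < 2 * N + 2" for v
  proof -
    from cupset_cover[of "Suc i" v] assms v obtain x y where xy: "(x, y) \<in> ?c" "v = x \<or> v = y" by auto
    have lt: "x < y" "y < 2 * N + 2" using cupset_bounds[OF _ xy(1)] assms by auto
    have "circle (?c \<union> ?c) v = {x, y}" using circ[OF xy(1)] xy(2) by auto
    then have "Min (circle (?c \<union> ?c) v) = x" using lt by simp
    moreover have "clw i ! x = Wedge \<longleftrightarrow> x = Suc i" using lt assms xy(1) by (auto simp: nth_clw cupset_def)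
    moreover have "x = Suc i \<longleftrightarrow> v \<in> {Suc i, Suc (Suc i)}"
    proof -
      have in_c: "(Suc i, Suc (Suc i)) \<in> ?c" by (simp add: cupset_def)
      have "matching ?c" using matching_cupset assms by simp
      from matching_disjoint[OF this xy(1) in_c] show ?thesis using xy(2) by fastforce
    qed
    ultimately show ?thesis by simp
  qed
  then show ?thesis using assms by (auto simp: clockwise_vertices_def)
qed

text \<open>The vertices on clockwise circles. In an oriented diagram with \<open>k\<close>
  different from \<open>i\<close> and \<open>j\<close> one has \<open>i = j = Suc k\<close>, and the
  only clockwise circle is the one through the small cup \<open>(i, Suc i)\<close>.\<close>

definition marked :: "nat \<Rightarrow> nat \<Rightarrow> nat \<Rightarrow> nat set" where
  "marked i k j = (if k = i \<or> k = j then {} else {i, Suc i})"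

lemma clockwise_marked:
  assumes "diag i k j \<in> diagrams N 1" "i \<le> N" "j \<le> N" "k \<le> N"
  shows "clockwise_vertices (cupset i, clw k, cupset j) = marked i k j"
  using assms(1)
proof (cases rule: diagram_cases)
  case (2 l)
  then show ?thesis using clockwise_X[of l] assms by (simp add: marked_def)
qed (use clockwise_none assms in \<open>auto simp: marked_def\<close>)

lemma arc_coeff_diag:
  assumes "diag i k j \<in> diagrams N 1" "diag j' l n \<in> diagrams N 1" "diag i' r n' \<in> diagrams N 1"
    and "i \<le> N" "j \<le> N" "k \<le> N" "j' \<le> N" "l \<le> N" "n \<le> N" "i' \<le> N" "r \<le> N" "n' \<le> N"
  shows "arc_coeff (cl_diagram N 1 (diag i k j)) (cl_diagram N 1 (diag j' l n)) (cl_diagram N 1 (diag i' r n')) =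
    (if j = j' \<and> i' = i \<and> n' = n then
      count_list (surgeries (cupset i) (cupset j) (cupset n) {} (sorted_key_list_of_set fst (cupset j))
          (marked i k j \<times> {0} \<union> marked j l n \<times> {1})) (marked i r n \<times> {0, 1}) else 0)"
  using clockwise_marked[OF assms(1,4,5,6)] clockwise_marked[OF assms(2,7,9,8)] clockwise_marked[OF assms(3,10,12,11)]
    cupset_inject[OF assms(5,7)] cupset_inject[OF assms(10,4)] cupset_inject[OF assms(9,12)]
  unfolding cl_diagram_diag[OF assms(4,6,5)] cl_diagram_diag[OF assms(7,8,9)] cl_diagram_diag[OF assms(10,11,12)]
    arc_coeff_def prod.case
  by auto

lemma surgeries_unmarked_cupset:
  assumes "i \<le> N" "j \<le> N" "n \<le> N" "i = j \<or> j = n"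
  shows "surgeries (cupset i) (cupset j) (cupset n) {} (sorted_key_list_of_set fst (cupset j)) {} = [{}]"
  by (rule surgeries_unmarked) (use assms matching_cupset cap_list[OF assms(2)] in auto)

lemma count_marked:
  assumes "S \<noteq> {}"
  shows "count_list (surgeries a b d s ps S) {} = 0"
  using surgeries_increasing[of "{}" a b d s ps S] assms by (auto simp: count_list_0_iff)

section \<open>Surgery between neighbouring cup diagrams\<close>

lemma cupset_shared:
  assumes "i < N"
  shows "cupset i = {(i, Suc i), (Suc (Suc i), 2 * N + 1 - i)} \<union> (cupset i \<inter> cupset (Suc i))"
    and "cupset (Suc i) = {(i, 2 * N + 1 - i), (Suc i, Suc (Suc i))} \<union> (cupset i \<inter> cupset (Suc i))"
  using assms by (auto simp: cupset_def)

lemma shared_avoids: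
  assumes "i < N" "(u, v) \<in> cupset i \<inter> cupset (Suc i)"
  shows "u \<notin> {i, Suc i, Suc (Suc i), 2 * N + 1 - i} \<and> v \<notin> {i, Suc i, Suc (Suc i), 2 * N + 1 - i}"
  using assms by (auto simp: cupset_def)

lemma two_split:
  assumes "distinct ps" "p \<in> set ps" "q \<in> set ps" "p \<noteq> q"
  obtains ps1 ps2 ps3 where "ps = ps1 @ p # ps2 @ q # ps3" | ps1 ps2 ps3 where "ps = ps1 @ q # ps2 @ p # ps3"
proof -
  obtain xs ys where xs: "ps = xs @ p # ys" using assms by (meson split_list)
  with assms consider "q \<in> set xs" | "q \<in> set ys" by auto
  then show thesis
  proof cases
    case 1
    then obtain as bs where "xs = as @ q # bs" by (meson split_list)
    then show thesis using that(2)[of as bs ys] xs by simp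
  next
    case 2
    then obtain as bs where "ys = as @ q # bs" by (meson split_list)
    then show thesis using that(1)[of xs as bs] xs by simp
  qed
qed

text \<open>This is \<open>u_i v_i\<close> in the arc algebra. For \<open>i > 0\<close> the first
  summand is \<open>x_(i-1)\<close>. The second puts a \<open>Vee\<close> at
  \<open>2 * N + 1 - i\<close>, inside the block of \<open>Wedge\<close> symbols added by the
  closure, and so dies in the quotient. For \<open>i = 0\<close> the first summand dies as well,
  since it has a \<open>Wedge\<close> at vertex 0; hence \<open>u_0 v_0 = 0\<close>. The list order
  of the two special caps is left open, so both orders are treated.\<close>

lemma surgeries_up_down:
  assumes i: "i < N" and ps: "distinct ps" "set ps = cupset (Suc i)"
  shows "mset (surgeries (cupset i) (cupset (Suc i)) (cupset i) {} ps {}) =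
    {# {i, Suc i} \<times> {0, 1}, {Suc (Suc i), 2 * N + 1 - i} \<times> {0, 1} #}"
proof -
  let ?p = "(i, 2 * N + 1 - i)" and ?q = "(Suc i, Suc (Suc i))"
  have m: "matching (cupset i)" "matching (cupset (Suc i))" using matching_cupset i by auto
  note sh = cupset_shared[OF i]
  note sh' = sh(1) sh(2)[unfolded insert_commute[of ?p ?q]]
  have pq: "?p \<in> set ps" "?q \<in> set ps" "?p \<noteq> ?q" using ps sh(2) by auto
  from ps(1) pq show ?thesis
  proof (cases rule: two_split)
    case (1 ps1 ps2 ps3)
    show ?thesis
      by (rule surgeries_merge_split[OF m sh _ _ _ _ _ _ 1 ps])
        (use i shared_avoids[OF i] in \<open>auto simp: cupset_def\<close>)
  next
    case (2 ps1 ps2 ps3)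
    show ?thesis
      by (rule surgeries_merge_split[OF m sh' _ _ _ _ _ _ 2 ps])
        (use i shared_avoids[OF i] in \<open>auto simp: cupset_def\<close>)
  qed
qed

text \<open>This is \<open>v_i u_i\<close>. The summand on the small cup
  \<open>(Suc i, Suc (Suc i))\<close> is \<open>x_i\<close>; the other one has a \<open>Vee\<close>
  at \<open>2 * N + 1 - i\<close> and is not the diagram of a closure.\<close>

lemma surgeries_down_up:
  assumes i: "i < N" and ps: "distinct ps" "set ps = cupset i"
  shows "mset (surgeries (cupset (Suc i)) (cupset i) (cupset (Suc i)) {} ps {}) =
    {# {i, 2 * N + 1 - i} \<times> {0, 1}, {Suc i, Suc (Suc i)} \<times> {0, 1} #}"
proof -
  let ?p = "(i, Suc i)" and ?q = "(Suc (Suc i), 2 * N + 1 - i)"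
  have m: "matching (cupset (Suc i))" "matching (cupset i)" using matching_cupset i by auto
  note sh = cupset_shared(2,1)[OF i]
  note sh' = sh(1) sh(2)[unfolded insert_commute[of ?p ?q]]
  have pq: "?p \<in> set ps" "?q \<in> set ps" "?p \<noteq> ?q" using ps sh(2) by auto
  from ps(1) pq show ?thesis
  proof (cases rule: two_split)
    case (1 ps1 ps2 ps3)
    show ?thesis
      by (rule surgeries_merge_split[OF m sh _ _ _ _ _ _ 1 ps])
        (use i shared_avoids[OF i] in \<open>auto simp: cupset_def\<close>)
  next
    case (2 ps1 ps2 ps3)
    show ?thesis
      by (rule surgeries_merge_split[OF m sh' _ _ _ _ _ _ 2 ps])
        (use i shared_avoids[OF i] in \<open>auto simp: cupset_def\<close>)
  qed
qed

end

section \<open>The algebra in coordinates\<close>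

context one_wedge
begin

definition diags :: "diagram set" where "diags = diagrams N 1"

definition arc :: "diagram \<Rightarrow> diagram \<Rightarrow> diagram \<Rightarrow> nat" where
  "arc p q b = arc_coeff (cl_diagram N 1 p) (cl_diagram N 1 q) (cl_diagram N 1 b)"

text \<open>The structure constant for fixed cup diagrams \<open>i\<close>, \<open>j\<close>,
  \<open>n\<close>; \<open>A\<close> and \<open>B\<close> are the vertices on clockwise circles of
  the two factors, \<open>C\<close> those of the product.\<close>

definition sc :: "nat \<Rightarrow> nat \<Rightarrow> nat \<Rightarrow> nat set \<Rightarrow> nat set \<Rightarrow> nat set \<Rightarrow> nat" where
  "sc i j n A B C = count_list (surgeries (cupset i) (cupset j) (cupset n) {}
     (sorted_key_list_of_set fst (cupset j)) (A \<times> {0} \<union> B \<times> {1})) (C \<times> {0, 1})"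

lemma diags_simps [simp]:
  "i \<le> N \<Longrightarrow> eE i \<in> diags" "i < N \<Longrightarrow> eX i \<in> diags" "i < N \<Longrightarrow> eU i \<in> diags" "i < N \<Longrightarrow> eV i \<in> diags"
  unfolding diags_def by (rule in_diagrams; assumption)+

lemmas diags_cases = diagram_cases[folded diags_def, consumes 1, case_names 1 2 3 4]

lemma finite_diags: "finite diags"
  unfolding diags_def by (rule finite_diagrams)

lemma arc_diag:
  assumes "diag i k j \<in> diags" "diag j' l n \<in> diags" "diag i' r n' \<in> diags"
    and "i \<le> N" "j \<le> N" "k \<le> N" "j' \<le> N" "l \<le> N" "n \<le> N" "i' \<le> N" "r \<le> N" "n' \<le> N"
  shows "arc (diag i k j) (diag j' l n) (diag i' r n') =
    (if j = j' \<and> i' = i \<and> n' = n then sc i j n (marked i k j) (marked j l n) (marked i r n) else 0)"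
  using arc_coeff_diag[OF assms[unfolded diags_def]] unfolding arc_def sc_def .

lemma marked_simps [simp]:
  "marked i i j = {}" "marked i j j = {}" "marked (Suc i) i (Suc i) = {Suc i, Suc (Suc i)}"
  by (auto simp: marked_def)

lemma sc_unmarked:
  "i \<le> N \<Longrightarrow> j \<le> N \<Longrightarrow> n \<le> N \<Longrightarrow> i = j \<or> j = n \<Longrightarrow> sc i j n {} {} C = (if C = {} then 1 else 0)"
  using surgeries_unmarked_cupset[of i j n] unfolding sc_def by auto

lemma sc_marked: "A \<noteq> {} \<or> B \<noteq> {} \<Longrightarrow> sc i j n A B {} = 0"
  using count_marked[of "A \<times> {0} \<union> B \<times> {1}"] unfolding sc_def by auto

lemma sc_idempotent:
  assumes "i \<le> N"
  shows "sc i i i {i, Suc i} {} {i, Suc i} = 1" "sc i i i {} {i, Suc i} {i, Suc i} = 1"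
    "sc i i i {i, Suc i} {i, Suc i} {i, Suc i} = 0"
proof -
  have c: "(i, Suc i) \<in> cupset i" by (simp add: cupset_def)
  have e: "{i, Suc i} \<times> {0} \<union> {i, Suc i} \<times> {1} = {i, Suc i} \<times> {0, 1}" by auto
  note s = surgeries_idempotent[OF matching_cupset[OF assms] c cap_list(2,1)[OF assms]]
  show "sc i i i {i, Suc i} {} {i, Suc i} = 1" "sc i i i {} {i, Suc i} {i, Suc i} = 1"
    "sc i i i {i, Suc i} {i, Suc i} {i, Suc i} = 0"
    unfolding sc_def e Sigma_empty1 Un_empty_left Un_empty_right s by simp_all
qed

lemma count_two:
  "A \<noteq> C \<Longrightarrow> B \<noteq> C \<Longrightarrow> count {#A, B#} C = 0"
  "B \<noteq> C \<Longrightarrow> count {#C, B#} C = 1" "A \<noteq> C \<Longrightarrow> count {#A, C#} C = 1"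
  by simp_all

lemma prod_neq: "x \<in> A \<Longrightarrow> x \<notin> B \<Longrightarrow> A \<times> {0, 1::nat} \<noteq> B \<times> {0, 1}" "x \<in> A \<Longrightarrow> A \<times> {0, 1::nat} \<noteq> {}"
  by blast+

lemma sc_up_down:
  assumes i: "i < N"
  shows "sc i (Suc i) i {} {} {} = 0" "sc i (Suc i) i {} {} {i, Suc i} = 1"
proof -
  have "distinct (sorted_key_list_of_set fst (cupset (Suc i)))"
    "set (sorted_key_list_of_set fst (cupset (Suc i))) = cupset (Suc i)" using cap_list[of "Suc i"] i by auto
  note s = surgeries_up_down[OF i this]
  show "sc i (Suc i) i {} {} {} = 0"
    unfolding sc_def count_mset[symmetric] Sigma_empty1 Un_empty_left s by (rule count_two) auto
  show "sc i (Suc i) i {} {} {i, Suc i} = 1"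
    unfolding sc_def count_mset[symmetric] Sigma_empty1 Un_empty_left s
    by (rule count_two(2), rule prod_neq(1)[of "Suc (Suc i)"]) (use i in simp_all)
qed

lemma sc_down_up:
  assumes i: "i < N"
  shows "sc (Suc i) i (Suc i) {} {} {} = 0" "sc (Suc i) i (Suc i) {} {} {Suc i, Suc (Suc i)} = 1"
proof -
  have "distinct (sorted_key_list_of_set fst (cupset i))"
    "set (sorted_key_list_of_set fst (cupset i)) = cupset i" using cap_list[of i] i by auto
  note s = surgeries_down_up[OF i this]
  show "sc (Suc i) i (Suc i) {} {} {} = 0"
    unfolding sc_def count_mset[symmetric] Sigma_empty1 Un_empty_left s by (rule count_two) auto
  show "sc (Suc i) i (Suc i) {} {} {Suc i, Suc (Suc i)} = 1"
    unfolding sc_def count_mset[symmetric] Sigma_empty1 Un_empty_left s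
    by (rule count_two(3), rule prod_neq(1)[of i]) (use i in simp_all)
qed

text \<open>This and the next three lemmas form the multiplication table. At an idempotent only
  \<open>e_i e_i\<close> contributes: a factor \<open>x\<close> leaves a mark, and both summands of
  \<open>u_i v_i\<close> and of \<open>v_i u_i\<close> are marked.\<close>

lemma arc_E:
  assumes "i \<le> N" "p \<in> diags" "q \<in> diags"
  shows "arc p q (eE i) = (if (p, q) = (eE i, eE i) then 1 else 0)"
  using assms(2)
proof (cases rule: diags_cases)
  case (1 m)
  show ?thesis using assms(3)
    by (cases rule: diags_cases; use 1 assms(1) in \<open>auto simp: arc_diag sc_unmarked sc_marked sc_idempotent sc_up_down sc_down_up\<close>)
next
  case (2 m)
  show ?thesis using assms(3)
    by (cases rule: diags_cases; use 2 assms(1) in \<open>auto simp: arc_diag sc_unmarked sc_marked sc_idempotent sc_up_down sc_down_up\<close>)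
next
  case (3 m)
  show ?thesis using assms(3)
    by (cases rule: diags_cases; use 3 assms(1) in \<open>auto simp: arc_diag sc_unmarked sc_marked sc_idempotent sc_up_down sc_down_up\<close>)
next
  case (4 m)
  show ?thesis using assms(3)
    by (cases rule: diags_cases; use 4 assms(1) in \<open>auto simp: arc_diag sc_unmarked sc_marked sc_idempotent sc_up_down sc_down_up\<close>)
qed

lemma arc_U:
  assumes "i < N" "p \<in> diags" "q \<in> diags"
  shows "arc p q (eU i) = (if (p, q) = (eE i, eU i) \<or> (p, q) = (eU i, eE (Suc i)) then 1 else 0)"
  using assms(2)
proof (cases rule: diags_cases)
  case (1 m)
  show ?thesis using assms(3)
    by (cases rule: diags_cases; use 1 assms(1) in \<open>auto simp: arc_diag sc_unmarked sc_marked sc_idempotent sc_up_down sc_down_up\<close>)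
next
  case (2 m)
  show ?thesis using assms(3)
    by (cases rule: diags_cases; use 2 assms(1) in \<open>auto simp: arc_diag sc_unmarked sc_marked sc_idempotent sc_up_down sc_down_up\<close>)
next
  case (3 m)
  show ?thesis using assms(3)
    by (cases rule: diags_cases; use 3 assms(1) in \<open>auto simp: arc_diag sc_unmarked sc_marked sc_idempotent sc_up_down sc_down_up\<close>)
next
  case (4 m)
  show ?thesis using assms(3)
    by (cases rule: diags_cases; use 4 assms(1) in \<open>auto simp: arc_diag sc_unmarked sc_marked sc_idempotent sc_up_down sc_down_up\<close>)
qed

lemma arc_V:
  assumes "i < N" "p \<in> diags" "q \<in> diags"
  shows "arc p q (eV i) = (if (p, q) = (eE (Suc i), eV i) \<or> (p, q) = (eV i, eE i) then 1 else 0)"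
  using assms(2)
proof (cases rule: diags_cases)
  case (1 m)
  show ?thesis using assms(3)
    by (cases rule: diags_cases; use 1 assms(1) in \<open>auto simp: arc_diag sc_unmarked sc_marked sc_idempotent sc_up_down sc_down_up\<close>)
next
  case (2 m)
  show ?thesis using assms(3)
    by (cases rule: diags_cases; use 2 assms(1) in \<open>auto simp: arc_diag sc_unmarked sc_marked sc_idempotent sc_up_down sc_down_up\<close>)
next
  case (3 m)
  show ?thesis using assms(3)
    by (cases rule: diags_cases; use 3 assms(1) in \<open>auto simp: arc_diag sc_unmarked sc_marked sc_idempotent sc_up_down sc_down_up\<close>)
next
  case (4 m)
  show ?thesis using assms(3)
    by (cases rule: diags_cases; use 4 assms(1) in \<open>auto simp: arc_diag sc_unmarked sc_marked sc_idempotent sc_up_down sc_down_up\<close>)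
qed

text \<open>The last two alternatives are the zigzag relation: \<open>x_i\<close> is
  \<open>v_i u_i\<close> by \<open>sc_down_up\<close> and \<open>u_(i+1) v_(i+1)\<close> by
  \<open>sc_up_down\<close> at \<open>Suc i\<close>, the latter only if the vertex
  \<open>i + 2\<close> exists.\<close>

lemma arc_X:
  assumes "i < N" "p \<in> diags" "q \<in> diags"
  shows "arc p q (eX i) = (if (p, q) = (eE (Suc i), eX i) \<or> (p, q) = (eX i, eE (Suc i)) \<or> (p, q) = (eV i, eU i)
     \<or> (Suc i < N \<and> (p, q) = (eU (Suc i), eV (Suc i))) then 1 else 0)"
  using assms(2)
proof (cases rule: diags_cases)
  case (1 m)
  show ?thesis using assms(3)
    by (cases rule: diags_cases; use 1 assms(1) in \<open>auto simp: arc_diag sc_unmarked sc_marked sc_idempotent sc_up_down sc_down_up\<close>)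
next
  case (2 m)
  show ?thesis using assms(3)
    by (cases rule: diags_cases; use 2 assms(1) in \<open>auto simp: arc_diag sc_unmarked sc_marked sc_idempotent sc_up_down sc_down_up\<close>)
next
  case (3 m)
  show ?thesis using assms(3)
    by (cases rule: diags_cases; use 3 assms(1) in \<open>auto simp: arc_diag sc_unmarked sc_marked sc_idempotent sc_up_down sc_down_up\<close>)
next
  case (4 m)
  show ?thesis using assms(3)
    by (cases rule: diags_cases; use 4 assms(1) in \<open>auto simp: arc_diag sc_unmarked sc_marked sc_idempotent sc_up_down sc_down_up\<close>)
qed

section \<open>The product of the diagram algebra in coordinates\<close>

definition kmul :: "kvec \<Rightarrow> kvec \<Rightarrow> kvec" (infixl "\<star>" 70) where
  "x \<star> y = monoid.mult (khovanov N 1) x y"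

text \<open>The structure constants are all 0 or 1, so the double sum over the basis collapses to
  the pairs in \<open>Q\<close> whose product contains \<open>b\<close>.\<close>

lemma kmul_sum:
  assumes "b \<in> diags" "Q \<subseteq> diags \<times> diags" "\<And>p q. p \<in> diags \<Longrightarrow> q \<in> diags \<Longrightarrow> arc p q b = (if (p, q) \<in> Q then 1 else 0)"
  shows "(x \<star> y) b = (\<Sum>(p, q) \<in> Q. x p * y q)"
proof -
  have "(x \<star> y) b = (\<Sum>p \<in> diags. \<Sum>q \<in> diags. x p * y q * of_nat (arc p q b))"
    using assms(1) by (simp add: kmul_def khovanov_def diags_def arc_def)
  also have "\<dots> = (\<Sum>(p, q) \<in> diags \<times> diags. x p * y q * of_nat (arc p q b))"
    by (simp add: sum.cartesian_product)
  also have "\<dots> = (\<Sum>(p, q) \<in> Q. x p * y q)"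
    by (rule sum.mono_neutral_cong_right) (use assms finite_diags in auto)
  finally show ?thesis .
qed

lemma kmul_outside: "b \<notin> diags \<Longrightarrow> (x \<star> y) b = 0"
  by (simp add: kmul_def khovanov_def diags_def)

lemma kmul_E: "i \<le> N \<Longrightarrow> (x \<star> y) (eE i) = x (eE i) * y (eE i)"
  by (subst kmul_sum[where Q = "{(eE i, eE i)}"]) (auto simp: arc_E)

lemma kmul_U: "i < N \<Longrightarrow> (x \<star> y) (eU i) = x (eE i) * y (eU i) + x (eU i) * y (eE (Suc i))"
  by (subst kmul_sum[where Q = "{(eE i, eU i), (eU i, eE (Suc i))}"]) (auto simp: arc_U)

lemma kmul_V: "i < N \<Longrightarrow> (x \<star> y) (eV i) = x (eE (Suc i)) * y (eV i) + x (eV i) * y (eE i)"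
  by (subst kmul_sum[where Q = "{(eE (Suc i), eV i), (eV i, eE i)}"]) (auto simp: arc_V)

lemma kmul_X:
  assumes "i < N"
  shows "(x \<star> y) (eX i) = x (eE (Suc i)) * y (eX i) + x (eX i) * y (eE (Suc i)) + x (eV i) * y (eU i)
     + (if Suc i < N then x (eU (Suc i)) * y (eV (Suc i)) else 0)"
proof (cases "Suc i < N")
  case True
  then show ?thesis using assms
    by (subst kmul_sum[where Q = "{(eE (Suc i), eX i), (eX i, eE (Suc i)), (eV i, eU i), (eU (Suc i), eV (Suc i))}"])
      (auto simp: arc_X)
next
  case False
  then show ?thesis using assms
    by (subst kmul_sum[where Q = "{(eE (Suc i), eX i), (eX i, eE (Suc i)), (eV i, eU i)}"]) (auto simp: arc_X)
qed

lemmas kmul_simps = kmul_E kmul_U kmul_V kmul_X kmul_outside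

lemma kvec_eqI:
  assumes "\<And>b. b \<notin> diags \<Longrightarrow> x b = y b" "\<And>i. i \<le> N \<Longrightarrow> x (eE i) = y (eE i)" "\<And>i. i < N \<Longrightarrow> x (eX i) = y (eX i)"
    "\<And>i. i < N \<Longrightarrow> x (eU i) = y (eU i)" "\<And>i. i < N \<Longrightarrow> x (eV i) = y (eV i)"
  shows "x = (y :: kvec)"
proof
  fix b show "x b = y b" by (cases "b \<in> diags") (use assms in \<open>auto elim: diags_cases\<close>)
qed

text \<open>Associativity is checked coordinate by coordinate with the explicit product formulas,
  not through the invariance of surgery under reordering.\<close>

lemma kmul_assoc: "x \<star> y \<star> z = x \<star> (y \<star> z)"
  by (rule kvec_eqI) (auto simp: kmul_simps algebra_simps)

lemma kmul_add_left: "(x + y) \<star> z = x \<star> z + y \<star> z"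
  by (rule kvec_eqI) (auto simp: kmul_simps algebra_simps)

lemma kmul_add_right: "x \<star> (y + z) = x \<star> y + x \<star> z"
  by (rule kvec_eqI) (auto simp: kmul_simps algebra_simps)

lemma kmul_zero [simp]: "0 \<star> x = 0" "x \<star> 0 = 0"
  by (rule kvec_eqI; auto simp: kmul_simps)+

definition scl :: "complex \<Rightarrow> kvec \<Rightarrow> kvec" where "scl c x = (\<lambda>b. c * x b)"

lemma scl_apply [simp]: "scl c x b = c * x b" by (simp add: scl_def)

lemma kmul_scl [simp]: "scl c x \<star> y = scl c (x \<star> y)" "x \<star> scl c y = scl c (x \<star> y)"
  by (rule kvec_eqI; auto simp: kmul_simps algebra_simps)+

lemma kmul_sum_left: "(\<Sum>i \<in> A. f i) \<star> x = (\<Sum>i \<in> A. f i \<star> x)"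
  by (induction A rule: infinite_finite_induct) (simp_all only: sum.infinite sum.empty sum.insert kmul_zero kmul_add_left not_False_eq_True)

lemma kmul_sum_right: "x \<star> (\<Sum>i \<in> A. f i) = (\<Sum>i \<in> A. x \<star> f i)"
  by (induction A rule: infinite_finite_induct) (simp_all only: sum.infinite sum.empty sum.insert kmul_zero kmul_add_right not_False_eq_True)

lemma kmul_diff_left: "(x - y) \<star> z = x \<star> z - y \<star> z"
  by (rule kvec_eqI) (auto simp: kmul_simps algebra_simps)

lemma kmul_diff_right: "x \<star> (y - z) = x \<star> y - x \<star> z"
  by (rule kvec_eqI) (auto simp: kmul_simps algebra_simps)

definition bE :: "nat \<Rightarrow> kvec" where "bE i = basis_vec (eE i)"
definition bU :: "nat \<Rightarrow> kvec" where "bU i = basis_vec (eU i)"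

lemma bE_apply: "bE i b = (if b = eE i then 1 else 0)" by (simp add: bE_def basis_vec_def)
lemma bU_apply: "bU i b = (if b = eU i then 1 else 0)" by (simp add: bU_def basis_vec_def)

end

section \<open>Projective modules and cell modules\<close>

context one_wedge
begin

text \<open>Constants hide the literal \<open>1 :: nat\<close>, which the simplifier would rewrite to \<open>Suc 0\<close>.\<close>

definition ws :: "weight set" where "ws = weights N 1"
definition Kh :: "(complex, kvec) module" where "Kh = khovanov N 1"
definition prj :: "weight \<Rightarrow> (kvec, kvec) graded_module" where "prj = projective N 1"
definition csub :: "weight \<Rightarrow> kvec set" where "csub = cell_submodule N 1"
definition cmod :: "weight \<Rightarrow> (kvec, kvec set) graded_module" where "cmod = cell_module N 1"
definition rterm :: "(int \<Rightarrow> weight list) \<Rightarrow> int \<Rightarrow> (kvec, nat \<Rightarrow> kvec) graded_module" where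
  "rterm = resolution_term N 1"

lemma wt_in_ws [simp]: "k \<le> N \<Longrightarrow> wt k \<in> ws"
  unfolding ws_def by (rule wt_in_weights)

definition idm :: "weight \<Rightarrow> kvec" where "idm \<mu> = basis_vec (\<mu>, \<mu>, \<mu>)"

lemma idm_wt [simp]: "idm (wt j) = bE j"
  by (simp add: idm_def bE_def diag_def)

lemma carrier_khovanov: "carrier Kh = {x. \<forall>b. b \<notin> diags \<longrightarrow> x b = 0}"
  by (simp add: Kh_def khovanov_def diags_def)

lemma kmul_carrier: "x \<star> y \<in> carrier Kh"
  unfolding carrier_khovanov by (simp add: kmul_outside)

lemma bE_idem: "j \<le> N \<Longrightarrow> bE j \<star> bE j = bE j"
  by (rule kvec_eqI) (auto simp: kmul_simps bE_apply)

lemma idm_idem: "\<mu> \<in> ws \<Longrightarrow> idm \<mu> \<star> idm \<mu> = idm \<mu>"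
  unfolding ws_def weights_eq by (auto simp: bE_idem)

lemma bE_nonzero: "bE j \<noteq> 0"
  by (metis bE_apply zero_fun_apply zero_neq_one)

lemma left_bE:
  "l \<le> N \<Longrightarrow> i \<le> N \<Longrightarrow> (bE l \<star> y) (eE i) = (if i = l then y (eE i) else 0)"
  "l \<le> N \<Longrightarrow> i < N \<Longrightarrow> (bE l \<star> y) (eX i) = (if Suc i = l then y (eX i) else 0)"
  "l \<le> N \<Longrightarrow> i < N \<Longrightarrow> (bE l \<star> y) (eU i) = (if i = l then y (eU i) else 0)"
  "l \<le> N \<Longrightarrow> i < N \<Longrightarrow> (bE l \<star> y) (eV i) = (if Suc i = l then y (eV i) else 0)"
  by (auto simp: kmul_simps bE_apply)

lemma right_bE:
  "l \<le> N \<Longrightarrow> i \<le> N \<Longrightarrow> (y \<star> bE l) (eE i) = (if i = l then y (eE i) else 0)"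
  "l \<le> N \<Longrightarrow> i < N \<Longrightarrow> (y \<star> bE l) (eX i) = (if Suc i = l then y (eX i) else 0)"
  "l \<le> N \<Longrightarrow> i < N \<Longrightarrow> (y \<star> bE l) (eU i) = (if Suc i = l then y (eU i) else 0)"
  "l \<le> N \<Longrightarrow> i < N \<Longrightarrow> (y \<star> bE l) (eV i) = (if i = l then y (eV i) else 0)"
  by (auto simp: kmul_simps bE_apply)

lemma degree_simps:
  "i \<le> N \<Longrightarrow> diagram_degree (eE i) = 0" "i < N \<Longrightarrow> diagram_degree (eX i) = 2"
  "i < N \<Longrightarrow> diagram_degree (eU i) = 1" "i < N \<Longrightarrow> diagram_degree (eV i) = 1"
  by (simp_all add: diagram_degree_diag)

text \<open>The left ideal generated by an idempotent is the fixed space of right multiplication by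
  it, which turns membership into an equation.\<close>

definition Pc :: "weight \<Rightarrow> kvec set" where "Pc \<mu> = {x. x \<star> idm \<mu> = x}"

lemma carrier_projective:
  assumes "\<mu> \<in> ws"
  shows "carrier (prj \<mu>) = Pc \<mu>"
proof -
  have "carrier (prj \<mu>) = {x \<star> idm \<mu> | x. x \<in> carrier Kh}"
    by (simp add: prj_def projective_def Let_def kmul_def idm_def Kh_def)
  also have "\<dots> = Pc \<mu>"
    using idm_idem[OF assms] kmul_carrier unfolding Pc_def by (auto simp: kmul_assoc) metis
  finally show ?thesis .
qed

lemma projective_ops:
  "\<zero>\<^bsub>prj \<mu>\<^esub> = 0" "x \<oplus>\<^bsub>prj \<mu>\<^esub> y = x + y"
  "a \<odot>\<^bsub>prj \<mu>\<^esub> x = a \<star> x"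
  by (auto simp: prj_def projective_def Let_def khovanov_def kmul_def fun_eq_iff)

lemma grade_projective:
  assumes "\<mu> \<in> ws"
  shows "grade (prj \<mu>) j = {x \<in> Pc \<mu>. \<forall>b. x b \<noteq> 0 \<longrightarrow> int (diagram_degree b) = j}"
  using carrier_projective[OF assms] by (auto simp: prj_def projective_def Let_def)

lemma Pc_zero: "0 \<in> Pc \<mu>" by (simp add: Pc_def)
lemma Pc_add: "x \<in> Pc \<mu> \<Longrightarrow> y \<in> Pc \<mu> \<Longrightarrow> x + y \<in> Pc \<mu>" by (simp add: Pc_def kmul_add_left)
lemma Pc_diff: "x \<in> Pc \<mu> \<Longrightarrow> y \<in> Pc \<mu> \<Longrightarrow> x - y \<in> Pc \<mu>" by (simp add: Pc_def kmul_diff_left)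
lemma Pc_mul: "x \<in> Pc \<mu> \<Longrightarrow> a \<star> x \<in> Pc \<mu>" by (simp add: Pc_def kmul_assoc)
lemma Pc_scl: "x \<in> Pc \<mu> \<Longrightarrow> scl c x \<in> Pc \<mu>" by (simp add: Pc_def)
lemma Pc_idm: "\<mu> \<in> ws \<Longrightarrow> idm \<mu> \<in> Pc \<mu>" by (simp only: Pc_def mem_Collect_eq idm_idem)
lemma Pc_carrier: "x \<in> Pc \<mu> \<Longrightarrow> x \<in> carrier Kh" using kmul_carrier[of x "idm \<mu>"] by (simp add: Pc_def)

section \<open>Direct sums of projectives and their homomorphisms\<close>

definition RT :: "weight list \<Rightarrow> int \<Rightarrow> (kvec, nat \<Rightarrow> kvec) graded_module" where
  "RT ms i = direct_sum (map (\<lambda>\<mu>. shift i (prj \<mu>)) ms)"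

lemma resolution_term_RT: "rterm W i = RT (W i) i"
  by (simp add: rterm_def resolution_term_def RT_def prj_def)

lemma shift_ops: "carrier (shift i M) = carrier M" "\<zero>\<^bsub>shift i M\<^esub> = \<zero>\<^bsub>M\<^esub>"
  "x \<oplus>\<^bsub>shift i M\<^esub> y = x \<oplus>\<^bsub>M\<^esub> y" "a \<odot>\<^bsub>shift i M\<^esub> x = a \<odot>\<^bsub>M\<^esub> x" "grade (shift i M) j = grade M (j - i)"
  by (simp_all add: shift_def)

lemma carrier_RT:
  assumes "set ms \<subseteq> ws"
  shows "carrier (RT ms i) = (\<Pi>\<^sub>E k \<in> {..<length ms}. Pc (ms ! k))"
  unfolding RT_def direct_sum_def Let_def product_module_def
  using assms by (auto intro!: PiE_cong simp: shift_ops carrier_projective[OF subsetD[OF assms nth_mem]])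

lemma RT_ops:
  "\<zero>\<^bsub>RT ms i\<^esub> = (\<lambda>k \<in> {..<length ms}. 0)"
  "x \<oplus>\<^bsub>RT ms i\<^esub> y = (\<lambda>k \<in> {..<length ms}. x k + y k)"
  "a \<odot>\<^bsub>RT ms i\<^esub> x = (\<lambda>k \<in> {..<length ms}. a \<star> x k)"
  unfolding RT_def direct_sum_def Let_def product_module_def
  by (auto intro!: restrict_ext simp: shift_ops projective_ops)

lemma grade_RT:
  assumes "set ms \<subseteq> ws"
  shows "grade (RT ms i) j =
    (\<Pi>\<^sub>E k \<in> {..<length ms}. {x \<in> Pc (ms ! k). \<forall>b. x b \<noteq> 0 \<longrightarrow> int (diagram_degree b) = j - i})"
  unfolding RT_def direct_sum_def Let_def product_module_def
  using assms by (auto intro!: PiE_cong simp: shift_ops grade_projective[OF subsetD[OF assms nth_mem]])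

definition gen :: "weight list \<Rightarrow> nat \<Rightarrow> nat \<Rightarrow> kvec" where
  "gen ms m = (\<lambda>k \<in> {..<length ms}. if k = m then idm (ms ! m) else 0)"

lemma gen_carrier: "set ms \<subseteq> ws \<Longrightarrow> gen ms m \<in> carrier (RT ms i)"
  unfolding carrier_RT gen_def by (auto simp: Pc_zero intro!: Pc_idm subsetD[OF _ nth_mem])

lemma homsD:
  assumes "f \<in> homs Kh L M"
  shows "x \<in> carrier L \<Longrightarrow> f x \<in> carrier M"
    and "x \<in> carrier L \<Longrightarrow> y \<in> carrier L \<Longrightarrow> f (x \<oplus>\<^bsub>L\<^esub> y) = f x \<oplus>\<^bsub>M\<^esub> f y"
    and "a \<in> carrier Kh \<Longrightarrow> x \<in> carrier L \<Longrightarrow> f (a \<odot>\<^bsub>L\<^esub> x) = a \<odot>\<^bsub>M\<^esub> f x"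
  using assms unfolding homs_def by auto

text \<open>A homomorphism between sums of modules \<open>K e\<close> is right multiplication by the
  matrix of the images of the generators. The truncations \<open>trunc l\<close> assemble
  \<open>z\<close> one summand at a time, so that additivity for two elements suffices.\<close>

lemma hom_expand:
  assumes ms: "set ms \<subseteq> ws" and f: "f \<in> homs Kh (RT ms i) (RT ns j)"
    and z: "z \<in> carrier (RT ms i)" and n: "n < length ns"
  shows "f z n = (\<Sum>m < length ms. z m \<star> f (gen ms m) n)"
proof -
  define trunc where "trunc l = (\<lambda>k \<in> {..<length ms}. if k < l then z k else 0)" for l
  have zP: "z k \<in> Pc (ms ! k)" if "k < length ms" for k
    using z that unfolding carrier_RT[OF ms] by (auto simp: PiE_iff)
  have tc: "trunc l \<in> carrier (RT ms i)" for l
    unfolding carrier_RT[OF ms] trunc_def using zP by (auto simp: Pc_zero)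
  have exp: "l \<le> length ms \<Longrightarrow> f (trunc l) n = (\<Sum>m < l. z m \<star> f (gen ms m) n)" for l
  proof (induction l)
    case 0
    have "trunc 0 = 0 \<odot>\<^bsub>RT ms i\<^esub> z" unfolding RT_ops trunc_def by simp
    then have "f (trunc 0) = 0 \<odot>\<^bsub>RT ns j\<^esub> f z"
      using homsD(3)[OF f, of 0 z] z by (simp add: carrier_khovanov)
    then show ?case using n by (simp add: RT_ops)
  next
    case (Suc l)
    then have l: "l < length ms" by simp
    then have "ms ! l \<in> ws" using ms by (meson nth_mem subsetD)
    have "trunc (Suc l) = trunc l \<oplus>\<^bsub>RT ms i\<^esub> (z l \<odot>\<^bsub>RT ms i\<^esub> gen ms l)"
      unfolding RT_ops trunc_def gen_def using zP[OF l] by (auto simp: Pc_def less_Suc_eq intro!: restrict_ext)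
    moreover have "z l \<odot>\<^bsub>RT ms i\<^esub> gen ms l \<in> carrier (RT ms i)"
      using gen_carrier[OF ms, of l] unfolding RT_ops carrier_RT[OF ms] by (auto simp: PiE_iff Pc_mul)
    ultimately have "f (trunc (Suc l)) = f (trunc l) \<oplus>\<^bsub>RT ns j\<^esub> (z l \<odot>\<^bsub>RT ns j\<^esub> f (gen ms l))"
      using homsD(2)[OF f tc] homsD(3)[OF f Pc_carrier[OF zP[OF l]] gen_carrier[OF ms]] by metis
    then have "f (trunc (Suc l)) n = f (trunc l) n + z l \<star> f (gen ms l) n"
      using n by (simp add: RT_ops)
    then show ?case using Suc by (simp only: sum.lessThan_Suc)
  qed
  have "trunc (length ms) = z"
    using z unfolding carrier_RT[OF ms] trunc_def by (auto simp: PiE_iff extensional_def)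
  then show ?thesis using exp[OF order_refl] by simp
qed

lemma RT_eqI:
  assumes "x \<in> carrier (RT ms i)" "y \<in> carrier (RT ms i)" "set ms \<subseteq> ws"
    "\<And>k. k < length ms \<Longrightarrow> x k = y k"
  shows "x = y"
  by (rule PiE_ext[OF assms(1,2)[unfolded carrier_RT[OF assms(3)]]]) (simp add: assms(4))

lemma RT_zero_closed: "set ms \<subseteq> ws \<Longrightarrow> \<zero>\<^bsub>RT ms i\<^esub> \<in> carrier (RT ms i)"
  by (simp add: RT_ops carrier_RT PiE_iff Pc_zero)

lemma a_kernel_iff: "x \<in> a_kernel L M f \<longleftrightarrow> x \<in> carrier L \<and> f x = \<zero>\<^bsub>M\<^esub>"
  by (simp add: a_kernel_def kernel_def)

text \<open>Within \<open>K e_k\<close> the diagrams with weight \<open>wt k\<close> are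
  \<open>e_k\<close> and, if \<open>k < N\<close>, \<open>v_k\<close>; the cell module kills the
  others. For \<open>k < N\<close> the same set is the left annihilator of \<open>u_k\<close>
  (\<open>mul_bU\<close>), and this coincidence drives the computation of the resolution.\<close>

definition cell :: "nat \<Rightarrow> kvec set" where
  "cell k = {x. x (eE k) = 0 \<and> (k < N \<longrightarrow> x (eV k) = 0)}"

lemma Pc_support:
  assumes "k \<le> N" "x \<in> Pc (wt k)"
  shows "b \<notin> diags \<Longrightarrow> x b = 0" "i \<le> N \<Longrightarrow> i \<noteq> k \<Longrightarrow> x (eE i) = 0" "i < N \<Longrightarrow> Suc i \<noteq> k \<Longrightarrow> x (eX i) = 0"
    "i < N \<Longrightarrow> Suc i \<noteq> k \<Longrightarrow> x (eU i) = 0" "i < N \<Longrightarrow> i \<noteq> k \<Longrightarrow> x (eV i) = 0"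
proof -
  have e: "(x \<star> bE k) b = x b" for b using assms by (simp add: Pc_def)
  show "b \<notin> diags \<Longrightarrow> x b = 0" using kmul_outside[of b x "bE k"] e[of b] by simp
  show "i \<le> N \<Longrightarrow> i \<noteq> k \<Longrightarrow> x (eE i) = 0" "i < N \<Longrightarrow> Suc i \<noteq> k \<Longrightarrow> x (eX i) = 0"
    "i < N \<Longrightarrow> Suc i \<noteq> k \<Longrightarrow> x (eU i) = 0" "i < N \<Longrightarrow> i \<noteq> k \<Longrightarrow> x (eV i) = 0"
    using right_bE[OF assms(1), of i x] unfolding e by auto
qed

lemma cell_submodule_eq:
  assumes "k \<le> N"
  shows "csub (wt k) = Pc (wt k) \<inter> cell k"
proof -
  have "(\<forall>\<alpha> \<nu> \<beta>. x (\<alpha>, \<nu>, \<beta>) \<noteq> 0 \<longrightarrow> \<nu> \<noteq> wt k) \<longleftrightarrow> x \<in> cell k" if x: "x \<in> Pc (wt k)" for x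
  proof
    assume *: "\<forall>\<alpha> \<nu> \<beta>. x (\<alpha>, \<nu>, \<beta>) \<noteq> 0 \<longrightarrow> \<nu> \<noteq> wt k"
    then show "x \<in> cell k" unfolding cell_def diag_def by blast
  next
    assume c: "x \<in> cell k"
    show "\<forall>\<alpha> \<nu> \<beta>. x (\<alpha>, \<nu>, \<beta>) \<noteq> 0 \<longrightarrow> \<nu> \<noteq> wt k"
    proof (intro allI impI)
      fix \<alpha> \<nu> \<beta> assume nz: "x (\<alpha>, \<nu>, \<beta>) \<noteq> 0"
      then have "(\<alpha>, \<nu>, \<beta>) \<in> diags" using Pc_support(1)[OF assms x] by blast
      then show "\<nu> \<noteq> wt k"
      proof (cases rule: diags_cases)
        case (1 i)
        then show ?thesis using nz c Pc_support(2)[OF assms x, of i] assms by (auto simp: cell_def diag_def)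
      next
        case (2 i)
        then have "Suc i = k" using nz Pc_support(3)[OF assms x, of i] by auto
        then show ?thesis using 2 assms by (auto simp: diag_def)
      next
        case (3 i)
        then have "Suc i = k" using nz Pc_support(4)[OF assms x, of i] by auto
        then show ?thesis using 3 assms by (auto simp: diag_def)
      next
        case (4 i)
        then have "i = k" using nz Pc_support(5)[OF assms x, of i] by auto
        then show ?thesis using 4 nz c by (auto simp: cell_def)
      qed
    qed
  qed
  then show ?thesis unfolding csub_def cell_submodule_def prj_def[symmetric] using carrier_projective[OF wt_in_ws[OF assms]] by auto
qed

lemma cell_mul: "k \<le> N \<Longrightarrow> x \<in> cell k \<Longrightarrow> a \<star> x \<in> cell k"
  by (auto simp: cell_def kmul_simps)

lemma cell_add: "x \<in> cell k \<Longrightarrow> y \<in> cell k \<Longrightarrow> x + y \<in> cell k"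
  and cell_diff: "x \<in> cell k \<Longrightarrow> y \<in> cell k \<Longrightarrow> x - y \<in> cell k"
  by (auto simp: cell_def)

text \<open>The augmentation is given only as some graded surjection. It sends the generator, of
  degree 0, to the class of a degree 0 element \<open>y\<close> of \<open>K e_k\<close>, hence of a
  multiple of \<open>e_k\<close>; surjectivity makes the factor nonzero. So the kernel does not
  depend on the surjection.\<close>

lemma cell_module_kernel:
  assumes k: "k \<le> N"
    and eps: "\<epsilon> \<in> graded_homs Kh (RT [wt k] 0) (cmod (wt k))"
    and surj: "\<epsilon> ` carrier (RT [wt k] 0) = carrier (cmod (wt k))"
    and z: "z \<in> carrier (RT [wt k] 0)"
  shows "z \<in> a_kernel (RT [wt k] 0) (cmod (wt k)) \<epsilon> \<longleftrightarrow> z 0 \<in> cell k"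
proof -
  let ?P = "prj (wt k)" and ?M = "cmod (wt k)"
  define B where "B = Pc (wt k) \<inter> cell k"
  have w: "set [wt k] \<subseteq> ws" using k by simp
  have rc: "H +>\<^bsub>?P\<^esub> x = (\<lambda>h. h + x) ` H" for H x
    unfolding a_r_coset_def' projective_ops by auto
  have sa: "H <+>\<^bsub>?P\<^esub> G = (\<lambda>(h, g). h + g) ` (H \<times> G)" for H G
    unfolding set_add_def' projective_ops by auto
  have zM: "\<zero>\<^bsub>?M\<^esub> = B"
    and cM: "carrier ?M = (\<lambda>x. B +>\<^bsub>?P\<^esub> x) ` Pc (wt k)"
    and sM: "\<And>a C. a \<odot>\<^bsub>?M\<^esub> C = B <+>\<^bsub>?P\<^esub> ((\<lambda>x. a \<star> x) ` C)"
    and gM: "\<And>j. grade ?M j = (\<lambda>x. B +>\<^bsub>?P\<^esub> x) ` grade ?P j"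
    unfolding cmod_def cell_module_def Let_def quotient_module_def B_def cell_submodule_eq[OF k, symmetric] prj_def[symmetric] csub_def[symmetric]
    by (auto simp: A_RCOSETS_def'  carrier_projective[OF wt_in_ws[OF k]]
      projective_ops)
  have e: "\<epsilon> \<in> homs Kh (RT [wt k] 0) ?M" and eg: "\<And>j. \<epsilon> ` grade (RT [wt k] 0) j \<subseteq> grade ?M j"
    using eps by (auto simp: graded_homs_def)
  have B0: "0 \<in> B" by (simp add: B_def Pc_zero cell_def)
  let ?g = "gen [wt k] 0"
  have g: "?g \<in> grade (RT [wt k] 0) 0"
    unfolding grade_RT[OF w] gen_def using k by (auto simp: bE_apply degree_simps Pc_def bE_idem)
  then obtain y where y: "y \<in> grade ?P 0" "\<epsilon> ?g = B +>\<^bsub>?P\<^esub> y" using eg gM by blast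
  then have yP: "y \<in> Pc (wt k)" and yd: "\<And>b. y b \<noteq> 0 \<Longrightarrow> diagram_degree b = 0"
    using grade_projective[OF wt_in_ws[OF k]] by auto
  define c where "c = y (eE k)"
  have yc: "y = scl c (bE k)"
  proof (rule kvec_eqI)
    show "b \<notin> diags \<Longrightarrow> y b = scl c (bE k) b" for b
      using Pc_support(1)[OF k yP] k by (auto simp: bE_apply)
    show "i \<le> N \<Longrightarrow> y (eE i) = scl c (bE k) (eE i)" for i
      using Pc_support(2)[OF k yP, of i] k by (auto simp: bE_apply c_def)
    show "i < N \<Longrightarrow> y (eX i) = scl c (bE k) (eX i)" for i
      using yd[of "eX i"] k by (auto simp: bE_apply degree_simps)
    show "i < N \<Longrightarrow> y (eU i) = scl c (bE k) (eU i)" for i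
      using yd[of "eU i"] k by (auto simp: bE_apply degree_simps)
    show "i < N \<Longrightarrow> y (eV i) = scl c (bE k) (eV i)" for i
      using yd[of "eV i"] k by (auto simp: bE_apply degree_simps)
  qed
  have ez: "\<epsilon> x = B <+>\<^bsub>?P\<^esub> ((\<lambda>v. x 0 \<star> v) ` (B +>\<^bsub>?P\<^esub> y))" if x: "x \<in> carrier (RT [wt k] 0)" for x
  proof -
    have xP: "x 0 \<in> Pc (wt k)" using x unfolding carrier_RT[OF w] by (auto simp: PiE_iff)
    have "x = x 0 \<odot>\<^bsub>RT [wt k] 0\<^esub> ?g"
      using x xP unfolding carrier_RT[OF w] RT_ops gen_def
      by (auto simp: PiE_iff extensional_def Pc_def fun_eq_iff)
    then have "\<epsilon> x = x 0 \<odot>\<^bsub>?M\<^esub> \<epsilon> ?g"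
      using homsD(3)[OF e Pc_carrier[OF xP] gen_carrier[OF w]] by metis
    then show ?thesis using sM y by simp
  qed
  have ker: "\<epsilon> x = B \<longleftrightarrow> x 0 \<star> y \<in> B" if x: "x \<in> carrier (RT [wt k] 0)" for x
  proof
    assume "\<epsilon> x = B"
    moreover have "0 + x 0 \<star> (0 + y) \<in> \<epsilon> x" unfolding ez[OF x] sa rc using B0 by fastforce
    ultimately show "x 0 \<star> y \<in> B" by simp
  next
    assume xy: "x 0 \<star> y \<in> B"
    have mul: "a \<star> h \<in> B" if "h \<in> B" for a h using that by (auto simp: B_def Pc_mul cell_mul k)
    have ad: "h + h' \<in> B" "h - h' \<in> B" if "h \<in> B" "h' \<in> B" for h h'
      using that by (auto simp: B_def Pc_add Pc_diff cell_add cell_diff)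
    show "\<epsilon> x = B"
    proof (rule equalityI)
      show "\<epsilon> x \<subseteq> B" unfolding ez[OF x] sa rc using xy mul ad by (auto simp: kmul_add_right)
      show "B \<subseteq> \<epsilon> x"
      proof
        fix h assume "h \<in> B"
        then have "h - x 0 \<star> y \<in> B" using xy ad by auto
        moreover have "h = (h - x 0 \<star> y) + x 0 \<star> (0 + y)" by (simp only: add_0_left diff_add_cancel)
        ultimately show "h \<in> \<epsilon> x" unfolding ez[OF x] sa rc using B0
          by (intro image_eqI[of _ _ "(h - x 0 \<star> y, x 0 \<star> (0 + y))"]) auto
      qed
    qed
  qed
  have c0: "c \<noteq> 0"
  proof
    assume "c = 0"
    then have y0: "y = 0" using yc by (simp add: fun_eq_iff)
    have "bE k \<in> Pc (wt k)" using k by (simp add: Pc_def bE_idem)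
    then have "B +>\<^bsub>?P\<^esub> bE k \<in> \<epsilon> ` carrier (RT [wt k] 0)" using cM surj by auto
    then have "B +>\<^bsub>?P\<^esub> bE k = B" using ker y0 B0 by auto
    then have "bE k \<in> B" unfolding rc using B0 by (metis add_0_left image_eqI)
    then show False using k by (auto simp: B_def cell_def bE_apply)
  qed
  have zP: "z 0 \<in> Pc (wt k)" using z unfolding carrier_RT[OF w] by (auto simp: PiE_iff)
  have "z 0 \<star> y = scl c (z 0)" using zP by (simp add: yc Pc_def)
  then have "z 0 \<star> y \<in> B \<longleftrightarrow> z 0 \<in> cell k" using zP c0 by (auto simp: B_def Pc_scl cell_def)
  then show ?thesis using ker[OF z] z unfolding a_kernel_iff zM by simp
qed

end

section \<open>Linear resolutions\<close>

lemma sum_fun_apply: "(\<Sum>i \<in> A. f i) x = (\<Sum>i \<in> A. f i (x :: 'b) :: 'c :: comm_monoid_add)"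
  by (induction A rule: infinite_finite_induct) (simp_all only: sum.infinite sum.empty sum.insert zero_fun_apply plus_fun_apply not_False_eq_True)

context one_wedge
begin

lemma bU_simps:
  assumes "j < N"
  shows "i < N \<Longrightarrow> bU j (eU i) = (if i = j then 1 else 0)" "i < N \<Longrightarrow> bU j (eV i) = 0"
    "i < N \<Longrightarrow> bU j (eX i) = 0" "i \<le> N \<Longrightarrow> bU j (eE i) = 0"
  using assms by (auto simp: bU_apply)

text \<open>Among the products of basis elements with \<open>u_j\<close> only
  \<open>e_j u_j = u_j\<close> and \<open>v_j u_j = x_j\<close> are nonzero. Thus right
  multiplication by \<open>u_j\<close> on \<open>K e_j\<close> has the kernel of
  \<open>K e_j\<close> onto its cell module.\<close>

lemma mul_bU:
  assumes "j < N"
  shows "x \<star> bU j = 0 \<longleftrightarrow> x \<in> cell j"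
proof
  assume "x \<star> bU j = 0"
  then have "(x \<star> bU j) (eU j) = 0" "(x \<star> bU j) (eX j) = 0" by simp_all
  then show "x \<in> cell j" using assms by (auto simp: kmul_simps bU_simps cell_def split: if_splits)
next
  assume "x \<in> cell j"
  then show "x \<star> bU j = 0"
    by (intro kvec_eqI) (use assms in \<open>auto simp: kmul_simps bU_simps cell_def\<close>)
qed

lemma bE_bU: "j < N \<Longrightarrow> bE j \<star> bU j = bU j" "j < N \<Longrightarrow> bU j \<star> bE (Suc j) = bU j"
  by (rule kvec_eqI; auto simp: kmul_simps bE_apply bU_apply)+

lemma bU_nonzero: "bU j \<noteq> 0"
  by (metis bU_apply zero_fun_apply zero_neq_one)

end

locale resolution = one_wedge +
  fixes k :: nat and W :: "int \<Rightarrow> weight list" and D :: "int \<Rightarrow> (nat \<Rightarrow> kvec) \<Rightarrow> (nat \<Rightarrow> kvec)"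
  assumes k_le: "k \<le> N" and res: "linear_resolution N 1 (wt k) W D"
begin

abbreviation Pt :: "int \<Rightarrow> (kvec, nat \<Rightarrow> kvec) graded_module" where "Pt i \<equiv> RT (W i) i"

lemma resolution_facts:
  "(\<forall>i. set (W i) \<subseteq> ws) \<and> (\<forall>i<0. W i = []) \<and> (\<exists>b. \<forall>i>b. W i = []) \<and> W 0 = [wt k] \<and>
   (\<forall>i. D i \<in> graded_homs Kh (Pt i) (Pt (i - 1))) \<and>
   (\<forall>i\<ge>1. a_kernel (Pt i) (Pt (i - 1)) (D i) = D (i + 1) ` carrier (Pt (i + 1))) \<and>
   (\<exists>\<epsilon> \<in> graded_homs Kh (Pt 0) (cmod (wt k)).
      \<epsilon> ` carrier (Pt 0) = carrier (cmod (wt k)) \<and> a_kernel (Pt 0) (cmod (wt k)) \<epsilon> = D 1 ` carrier (Pt 1))"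
  using res unfolding linear_resolution_def Let_def ws_def[symmetric] Kh_def[symmetric] cmod_def[symmetric]
    rterm_def[symmetric] resolution_term_RT .

lemma W_ws: "set (W i) \<subseteq> ws" using resolution_facts by (elim conjE) simp
lemma W_neg: "i < 0 \<Longrightarrow> W i = []" using resolution_facts by (elim conjE) simp
lemma W_0: "W 0 = [wt k]" using resolution_facts by (elim conjE)
lemma D_graded: "D i \<in> graded_homs Kh (Pt i) (Pt (i - 1))"
  using resolution_facts[THEN conjunct2, THEN conjunct2, THEN conjunct2, THEN conjunct2, THEN conjunct1] by (rule spec)
lemma exact: "i \<ge> 1 \<Longrightarrow> a_kernel (Pt i) (Pt (i - 1)) (D i) = D (i + 1) ` carrier (Pt (i + 1))"
  using resolution_facts[THEN conjunct2, THEN conjunct2, THEN conjunct2, THEN conjunct2, THEN conjunct2, THEN conjunct1]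
  by simp
lemma augmented: "\<exists>\<epsilon> \<in> graded_homs Kh (Pt 0) (cmod (wt k)).
   \<epsilon> ` carrier (Pt 0) = carrier (cmod (wt k)) \<and> a_kernel (Pt 0) (cmod (wt k)) \<epsilon> = D 1 ` carrier (Pt 1)"
  using resolution_facts by (elim conjE)

lemma D_hom: "D i \<in> homs Kh (Pt i) (Pt (i - 1))"
  using D_graded by (simp add: graded_homs_def)

text \<open>The matrix entry of the differential at the \<open>m\<close>-th generator and the
  \<open>n\<close>-th summand of the target.\<close>

definition dc :: "int \<Rightarrow> nat \<Rightarrow> nat \<Rightarrow> kvec" where
  "dc i m n = D i (gen (W i) m) n"

lemma D_expand: "z \<in> carrier (Pt i) \<Longrightarrow> n < length (W (i - 1)) \<Longrightarrow> D i z n = (\<Sum>m < length (W i). z m \<star> dc i m n)"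
  unfolding dc_def by (rule hom_expand[OF W_ws D_hom])

lemma W_nth: "m < length (W i) \<Longrightarrow> W i ! m \<in> ws"
  using W_ws by (meson nth_mem subsetD)

lemma idm_degree: "\<mu> \<in> ws \<Longrightarrow> idm \<mu> b \<noteq> 0 \<Longrightarrow> diagram_degree b = 0"
  unfolding ws_def weights_eq by (auto simp: bE_apply degree_simps split: if_splits)

lemma gen_grade: "gen (W i) m \<in> grade (Pt i) i"
  unfolding grade_RT[OF W_ws] gen_def PiE_iff
proof (intro conjI ballI)
  fix n assume "n \<in> {..<length (W i)}"
  then show "(\<lambda>k \<in> {..<length (W i)}. if k = m then idm (W i ! m) else 0) n
     \<in> {x \<in> Pc (W i ! n). \<forall>b. x b \<noteq> 0 \<longrightarrow> int (diagram_degree b) = i - i}"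
    using idm_degree[OF W_nth[of m i]] Pc_idm[OF W_nth[of m i]] by (cases "n = m") (simp_all add: Pc_zero)
qed simp

text \<open>Generators of the \<open>i\<close>-th term sit in degree \<open>i\<close>, while the
  summands of the target are shifted by \<open>i - 1\<close> only; this difference is the linearity
  of the resolution.\<close>

lemma dc_degree:
  assumes "n < length (W (i - 1))" "dc i m n b \<noteq> 0"
  shows "diagram_degree b = 1"
proof -
  have "D i (gen (W i) m) \<in> grade (Pt (i - 1)) i"
    using D_graded[of i] gen_grade[of i m] unfolding graded_homs_def by blast
  from PiE_mem[OF this[unfolded grade_RT[OF W_ws]], of n] assms(1)
  have "D i (gen (W i) m) n \<in> {x \<in> Pc (W (i - 1) ! n). \<forall>b. x b \<noteq> 0 \<longrightarrow> int (diagram_degree b) = i - (i - 1)}"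
    by blast
  then have "int (diagram_degree b) = i - (i - 1)" using assms(2) unfolding dc_def by blast
  then show ?thesis by simp
qed

lemma dc_E_X:
  assumes "n < length (W (i - 1))"
  shows "j \<le> N \<Longrightarrow> dc i m n (eE j) = 0" "j < N \<Longrightarrow> dc i m n (eX j) = 0"
  using dc_degree[OF assms, of m "eE j"] dc_degree[OF assms, of m "eX j"] by (auto simp: degree_simps)

lemma dc_Pc: "n < length (W (i - 1)) \<Longrightarrow> dc i m n \<in> Pc (W (i - 1) ! n)"
  using homsD(1)[OF D_hom[of i] gen_carrier[OF W_ws, of i m]] unfolding carrier_RT[OF W_ws] dc_def
  by (auto simp: PiE_iff)

lemma dc_left:
  assumes "m < length (W i)" "n < length (W (i - 1))"
  shows "idm (W i ! m) \<star> dc i m n = dc i m n"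
proof -
  have "idm (W i ! m) \<odot>\<^bsub>Pt i\<^esub> gen (W i) m = gen (W i) m"
    unfolding RT_ops gen_def using W_nth[OF assms(1)] by (auto simp: idm_idem intro!: restrict_ext)
  then have "D i (gen (W i) m) = idm (W i ! m) \<odot>\<^bsub>Pt (i - 1)\<^esub> D i (gen (W i) m)"
    using homsD(3)[OF D_hom[of i] Pc_carrier[OF Pc_idm[OF W_nth[OF assms(1)]]] gen_carrier[OF W_ws, of i m]]
    by simp
  then show ?thesis using assms(2) unfolding RT_ops dc_def by (metis lessThan_iff restrict_apply')
qed

text \<open>An element in the degree of the generators has coordinates only at the idempotents. If
  the differential kills it, exactness makes it an image under \<open>D (i + 1)\<close>; the entries
  of that differential have degree 1, so all coordinates at the idempotents vanish.\<close>

lemma injective_top: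
  assumes i: "i \<ge> 1" and z: "z \<in> grade (Pt i) i" and Dz: "D i z = \<zero>\<^bsub>Pt (i - 1)\<^esub>"
  shows "z = \<zero>\<^bsub>Pt i\<^esub>"
proof -
  have zc: "z \<in> carrier (Pt i)" using z unfolding grade_RT[OF W_ws] carrier_RT[OF W_ws] by (auto simp: PiE_iff)
  then have "z \<in> a_kernel (Pt i) (Pt (i - 1)) (D i)" using Dz by (simp add: a_kernel_iff)
  then obtain w where w: "w \<in> carrier (Pt (i + 1))" "z = D (i + 1) w" using exact[OF i] by auto
  show ?thesis
  proof (rule RT_eqI[OF zc RT_zero_closed[OF W_ws] W_ws])
    fix n assume n: "n < length (W i)"
    have deg: "diagram_degree b = 0" if "z n b \<noteq> 0" for b
    proof -
      have "z n \<in> {x \<in> Pc (W i ! n). \<forall>b. x b \<noteq> 0 \<longrightarrow> int (diagram_degree b) = i - i}"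
        using PiE_mem[OF z[unfolded grade_RT[OF W_ws]], of n] n by blast
      then have "int (diagram_degree b) = i - i" using that by blast
      then show ?thesis by simp
    qed
    have zE: "z n (eE j) = 0" if "j \<le> N" for j
    proof -
      have "z n (eE j) = (\<Sum>m < length (W (i + 1)). (w m \<star> dc (i + 1) m n) (eE j))"
        using D_expand[OF w(1), of n] n w(2) by (simp add: sum_fun_apply)
      also have "\<dots> = 0" using n dc_E_X(1)[of n "i + 1" j] that by (simp add: kmul_E)
      finally show ?thesis .
    qed
    have "z n \<in> Pc (W i ! n)" using zc n unfolding carrier_RT[OF W_ws] by (auto simp: PiE_iff)
    then have "z n b = 0" if "b \<notin> diags" for b
      using kmul_outside[OF that, of "z n" "idm (W i ! n)"] by (simp add: Pc_def)
    moreover have "z n (eX j) = 0" "z n (eU j) = 0" "z n (eV j) = 0" if "j < N" for j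
      using deg[of "eX j"] deg[of "eU j"] deg[of "eV j"] degree_simps(2-4)[OF that] by fastforce+
    ultimately have "z n = 0" using zE by (intro kvec_eqI) simp_all
    then show "z n = \<zero>\<^bsub>Pt i\<^esub> n" using n by (simp add: RT_ops)
  qed
qed

lemma gen_nonzero: "m < length (W i) \<Longrightarrow> gen (W i) m \<noteq> \<zero>\<^bsub>Pt i\<^esub>"
proof
  assume m: "m < length (W i)" "gen (W i) m = \<zero>\<^bsub>Pt i\<^esub>"
  from fun_cong[OF m(2), of m] have "idm (W i ! m) = 0" using m(1) by (simp add: gen_def RT_ops)
  moreover obtain j where "W i ! m = wt j" using W_nth[OF m(1)] unfolding ws_def weights_eq by blast
  ultimately show False using bE_nonzero by simp
qed

lemma W_Nil_step:
  assumes "i \<ge> 0" "W i = []"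
  shows "W (i + 1) = []"
proof (rule ccontr)
  assume "W (i + 1) \<noteq> []"
  then have m: "0 < length (W (i + 1))" by simp
  have "D (i + 1) (gen (W (i + 1)) 0) = \<zero>\<^bsub>Pt (i + 1 - 1)\<^esub>"
    by (rule RT_eqI[OF homsD(1)[OF D_hom gen_carrier[OF W_ws]] RT_zero_closed[OF W_ws] W_ws]) (use assms in simp)
  then show False using injective_top[OF _ gen_grade] gen_nonzero[OF m] assms by auto
qed

text \<open>A generator of the next term maps to a nonzero element of degree 1 in
  \<open>K e_j\<close>, where only \<open>u_(j-1)\<close> and \<open>v_j\<close> are available, and
  \<open>cell j\<close> rules out \<open>v_j\<close>. So every generator belongs to the weight
  \<open>j - 1\<close>. Without generators \<open>u_(j-1)\<close> would not be attained, and two of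
  them would have a combination in the kernel, against \<open>injective_top\<close>.\<close>

lemma W_step:
  assumes i: "i \<ge> 0" and W: "W i = [wt j]" and j: "j \<le> N"
    and im: "\<And>z. z \<in> carrier (Pt i) \<Longrightarrow> z \<in> D (i + 1) ` carrier (Pt (i + 1)) \<longleftrightarrow> z 0 \<in> cell j"
  shows "j = 0 \<Longrightarrow> W (i + 1) = []"
    and "j > 0 \<Longrightarrow> W (i + 1) = [wt (j - 1)] \<and> (\<exists>c. c \<noteq> 0 \<and> dc (i + 1) 0 0 = scl c (bU (j - 1)))"
proof -
  let ?L = "W (i + 1)"
  have n: "0 < length (W (i + 1 - 1))" using W by simp
  have main: "\<exists>l c. j = Suc l \<and> ?L ! m = wt l \<and> c \<noteq> 0 \<and> dc (i + 1) m 0 = scl c (bU l)" if m: "m < length ?L" for m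
  proof -
    let ?d = "dc (i + 1) m 0"
    have gc: "gen ?L m \<in> carrier (Pt (i + 1))" by (rule gen_carrier[OF W_ws])
    have "D (i + 1) (gen ?L m) \<in> carrier (Pt i)" using homsD(1)[OF D_hom gc] by simp
    then have cell: "?d \<in> cell j" using im gc unfolding dc_def by blast
    have dP: "?d \<in> Pc (wt j)" using dc_Pc[OF n, of m] W by simp
    from W_nth[OF m] obtain l where l: "?L ! m = wt l" "l \<le> N" unfolding ws_def weights_eq by auto
    have left: "(bE l \<star> ?d) b = ?d b" for b using dc_left[OF m n] l by simp
    have vU: "?d (eU q) = 0" if "q < N" "\<not> (q = l \<and> Suc q = j)" for q
      using left_bE(3)[OF l(2) that(1), of ?d] Pc_support(4)[OF j dP that(1)] that(2)
      unfolding left by (cases "q = l") auto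
    have vV: "?d (eV q) = 0" if "q < N" for q
    proof (cases "q = j")
      case True
      then show ?thesis using cell that unfolding cell_def by blast
    next
      case False
      then show ?thesis using Pc_support(5)[OF j dP that] by blast
    qed
    have nz: "?d \<noteq> 0"
    proof
      assume "?d = 0"
      then have "D (i + 1) (gen ?L m) = \<zero>\<^bsub>Pt (i + 1 - 1)\<^esub>"
        by (intro RT_eqI[OF homsD(1)[OF D_hom gc] RT_zero_closed[OF W_ws] W_ws]) (use W in \<open>auto simp: dc_def RT_ops\<close>)
      then show False using injective_top[OF _ gen_grade] gen_nonzero[OF m] i by auto
    qed
    have out: "?d b = 0" if "b \<notin> diags" for b using Pc_support(1)[OF j dP that] .
    have lj: "j = Suc l"
    proof (rule ccontr)
      assume "j \<noteq> Suc l"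
      then have "?d (eU q) = 0" if "q < N" for q using vU[OF that] by blast
      then have "?d = 0" using out dc_E_X[OF n] vV by (intro kvec_eqI) (simp_all only: zero_fun_apply)
      then show False using nz by simp
    qed
    have "l < N" using lj j by simp
    then have eq: "?d = scl (?d (eU l)) (bU l)"
      using out dc_E_X[OF n] vV vU by (intro kvec_eqI) (auto simp: bU_apply bU_simps)
    moreover have "?d (eU l) \<noteq> 0"
    proof
      assume "?d (eU l) = 0"
      then have "?d = scl 0 (bU l)" using eq by metis
      then show False using nz by (simp add: fun_eq_iff)
    qed
    ultimately show ?thesis using l lj by blast
  qed
  show "j = 0 \<Longrightarrow> ?L = []" using main[of 0] by auto
  assume j0: "j > 0"
  have ne: "?L \<noteq> []"
  proof
    assume L: "?L = []"
    have "(\<lambda>k \<in> {..<1}. bU (j - 1)) \<in> carrier (Pt i)"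
    proof -
      have "set [wt j] \<subseteq> ws" using j by simp
      from carrier_RT[OF this] show ?thesis unfolding W using bE_bU(2)[of "j - 1"] j j0 by (auto simp: Pc_def)
    qed
    moreover have "bU (j - 1) \<in> cell j" using j j0 bU_simps[of "j - 1" j] by (auto simp: cell_def)
    ultimately have "(\<lambda>k \<in> {..<1}. bU (j - 1)) \<in> D (i + 1) ` carrier (Pt (i + 1))" using im by simp
    then obtain w where w: "w \<in> carrier (Pt (i + 1))" "(\<lambda>k \<in> {..<1}. bU (j - 1)) = D (i + 1) w" by auto
    have "bU (j - 1) = D (i + 1) w 0" using fun_cong[OF w(2), of 0] by simp
    then show False using D_expand[OF w(1) n] L bU_nonzero by simp
  qed
  have "length ?L < 2"
  proof (rule ccontr)
    assume "\<not> length ?L < 2"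
    then have m: "0 < length ?L" "1 < length ?L" by auto
    obtain c where c: "c \<noteq> 0" "dc (i + 1) 0 0 = scl c (bU (j - 1))" "?L ! 0 = wt (j - 1)" using main[OF m(1)] by auto
    obtain d where d: "d \<noteq> 0" "dc (i + 1) 1 0 = scl d (bU (j - 1))" "?L ! 1 = wt (j - 1)" using main[OF m(2)] by auto
    \<comment> \<open>The generators 0 and 1 map to \<open>c\<close> and \<open>d\<close> times the
      same \<open>u_(j-1)\<close>; \<open>d\<close> times the first minus \<open>c\<close> times the
      second is killed and lies in the degree of the generators.\<close>
    define z where "z = (\<lambda>q \<in> {..<length ?L}. if q = 0 then scl d (bE (j - 1)) else if q = 1 then scl (- c) (bE (j - 1)) else 0)"
    have zg: "z \<in> grade (Pt (i + 1)) (i + 1)"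
    proof -
      have jN: "j - 1 \<le> N" using j by simp
      have "z q \<in> {x \<in> Pc (?L ! q). \<forall>b. x b \<noteq> 0 \<longrightarrow> int (diagram_degree b) = i + 1 - (i + 1)}"
        if "q < length ?L" for q
        using that c(3) d(3) bE_idem[OF jN] degree_simps(1)[OF jN]
        by (cases "q = 0"; cases "q = 1") (simp_all add: z_def Pc_zero Pc_def bE_apply del: One_nat_def)
      then show ?thesis unfolding grade_RT[OF W_ws] PiE_iff by (simp add: z_def)
    qed
    then have zc: "z \<in> carrier (Pt (i + 1))"
      unfolding grade_RT[OF W_ws] carrier_RT[OF W_ws] by (auto simp: PiE_iff)
    have "D (i + 1) z 0 = (\<Sum>q < length ?L. z q \<star> dc (i + 1) q 0)" using D_expand[OF zc n] .
    also have "\<dots> = (\<Sum>q \<in> {0, 1}. z q \<star> dc (i + 1) q 0)"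
      by (rule sum.mono_neutral_right) (use m in \<open>auto simp: z_def\<close>)
    also have "\<dots> = scl d (bE (j - 1)) \<star> scl c (bU (j - 1)) + scl (- c) (bE (j - 1)) \<star> scl d (bU (j - 1))"
      using m c(2) d(2) by (simp add: z_def)
    also have "\<dots> = 0" by (auto simp: fun_eq_iff)
    finally have "D (i + 1) z = \<zero>\<^bsub>Pt (i + 1 - 1)\<^esub>"
      by (intro RT_eqI[OF homsD(1)[OF D_hom zc] RT_zero_closed[OF W_ws] W_ws]) (use W in \<open>auto simp: RT_ops\<close>)
    then have "z = \<zero>\<^bsub>Pt (i + 1)\<^esub>" using injective_top[OF _ zg] i by simp
    then have "z 0 = 0" using m by (simp add: RT_ops)
    then have "scl d (bE (j - 1)) = 0" using m by (simp add: z_def)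
    then have "scl d (bE (j - 1)) (eE (j - 1)) = 0" by (simp only: zero_fun_apply)
    then show False using d by (simp add: bE_apply)
  qed
  then have len: "length ?L = 1" using ne by (cases ?L) auto
  then obtain l c where "j = Suc l" "?L ! 0 = wt l" "c \<noteq> 0" "dc (i + 1) 0 0 = scl c (bU l)" using main[of 0] by auto
  moreover from len obtain a where "?L = [a]" by (auto simp: length_Suc_conv)
  ultimately show "?L = [wt (j - 1)] \<and> (\<exists>c. c \<noteq> 0 \<and> dc (i + 1) 0 0 = scl c (bU (j - 1)))" by auto
qed

text \<open>The induction carries the description of the image of the next differential along. It
  starts with the kernel of the augmentation; at the next term the image is by exactness the kernel
  of right multiplication by a nonzero multiple of some \<open>u_j\<close>, which is again given by
  \<open>cell j\<close>.\<close>

lemma W_invariant: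
  "p \<le> k \<Longrightarrow> W (int p) = [wt (k - p)] \<and>
    (\<forall>z \<in> carrier (Pt (int p)). z \<in> D (int p + 1) ` carrier (Pt (int p + 1)) \<longleftrightarrow> z 0 \<in> cell (k - p)) \<and>
    (p > 0 \<longrightarrow> (\<exists>c. c \<noteq> 0 \<and> dc (int p) 0 0 = scl c (bU (k - p))))"
proof (induction p)
  case 0
  obtain \<epsilon> where e: "\<epsilon> \<in> graded_homs Kh (Pt 0) (cmod (wt k))"
    "\<epsilon> ` carrier (Pt 0) = carrier (cmod (wt k))" "a_kernel (Pt 0) (cmod (wt k)) \<epsilon> = D 1 ` carrier (Pt 1)"
    using augmented by blast
  show ?case using cell_module_kernel[OF k_le e(1,2)[unfolded W_0]] e(3) unfolding W_0 by (auto simp: W_0)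
next
  case (Suc p)
  then have IH: "W (int p) = [wt (k - p)]"
    "\<And>z. z \<in> carrier (Pt (int p)) \<Longrightarrow> z \<in> D (int p + 1) ` carrier (Pt (int p + 1)) \<longleftrightarrow> z 0 \<in> cell (k - p)" by auto
  have kp: "k - p > 0" "k - p \<le> N" "k - p - 1 = k - Suc p" "int (Suc p) = int p + 1" "k - Suc p < N" using Suc.prems k_le by auto
  obtain c where c: "W (int p + 1) = [wt (k - Suc p)]" "c \<noteq> 0" "dc (int p + 1) 0 0 = scl c (bU (k - Suc p))"
    using W_step(2)[OF _ IH(1) kp(2) IH(2) kp(1)] kp(3) by auto
  have "z \<in> D (int p + 1 + 1) ` carrier (Pt (int p + 1 + 1)) \<longleftrightarrow> z 0 \<in> cell (k - Suc p)"
    if z: "z \<in> carrier (Pt (int p + 1))" for z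
  proof -
    have n: "0 < length (W (int p + 1 - 1))" using IH(1) by simp
    have Dz: "D (int p + 1) z 0 = scl c (z 0 \<star> bU (k - Suc p))" using D_expand[OF z n] c by simp
    have "z \<in> D (int p + 1 + 1) ` carrier (Pt (int p + 1 + 1)) \<longleftrightarrow> D (int p + 1) z = \<zero>\<^bsub>Pt (int p + 1 - 1)\<^esub>"
    proof -
      have "z \<in> a_kernel (Pt (int p + 1)) (Pt (int p + 1 - 1)) (D (int p + 1)) \<longleftrightarrow>
        D (int p + 1) z = \<zero>\<^bsub>Pt (int p + 1 - 1)\<^esub>" using z by (simp only: a_kernel_iff simp_thms)
      then show ?thesis using exact[of "int p + 1"] by simp
    qed
    also have "\<dots> \<longleftrightarrow> D (int p + 1) z 0 = 0"
    proof
      assume "D (int p + 1) z = \<zero>\<^bsub>Pt (int p + 1 - 1)\<^esub>"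
      then show "D (int p + 1) z 0 = 0" using n by (simp add: RT_ops)
    next
      assume "D (int p + 1) z 0 = 0"
      then show "D (int p + 1) z = \<zero>\<^bsub>Pt (int p + 1 - 1)\<^esub>"
        by (intro RT_eqI[OF homsD(1)[OF D_hom z] RT_zero_closed[OF W_ws] W_ws]) (use IH(1) in \<open>auto simp: RT_ops\<close>)
    qed
    also have "\<dots> \<longleftrightarrow> z 0 \<star> bU (k - Suc p) = 0" using Dz c(2) by (auto simp: fun_eq_iff)
    also have "\<dots> \<longleftrightarrow> z 0 \<in> cell (k - Suc p)" by (rule mul_bU) (rule kp(5))
    finally show ?thesis .
  qed
  then show ?case using c unfolding kp(4) by blast
qed

text \<open>There is no weight below 0 to which a further generator could belong, so the term after
  \<open>K e_0\<close> is empty; an empty term forces the next one to be empty, because the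
  generators would be killed.\<close>

lemma W_beyond: "W (int k + 1 + int q) = []"
proof (induction q)
  case 0
  show ?case using W_step(1)[of "int k" 0] W_invariant[of k] k_le by simp
next
  case (Suc q)
  then show ?case using W_Nil_step[of "int k + 1 + int q"] by (simp add: algebra_simps)
qed

theorem W_eq: "W p = (if 0 \<le> p \<and> p \<le> int k then [wt (nat (int k - p))] else [])"
proof -
  consider "p < 0" | "0 \<le> p" "p \<le> int k" | "p > int k" by linarith
  then show ?thesis
  proof cases
    case 2
    then have "nat (int k - p) = k - nat p" "int (nat p) = p" "nat p \<le> k" by auto
    then show ?thesis using 2 W_invariant[of "nat p"] by simp
  next
    case 3
    then have "p = int k + 1 + int (nat (p - int k - 1))" by simp
    then show ?thesis using W_beyond[of "nat (p - int k - 1)"] 3 by simp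
  qed (simp add: W_neg)
qed

lemma dc_eq:
  assumes "0 < p" "p \<le> int k"
  shows "\<exists>c. c \<noteq> 0 \<and> dc p 0 0 = scl c (bU (nat (int k - p)))"
proof -
  have "nat (int k - p) = k - nat p" "int (nat p) = p" "nat p \<le> k" "nat p > 0" using assms by auto
  then show ?thesis using W_invariant[of "nat p"] by simp
qed

end

section \<open>Modules and diags algebras over the complex numbers\<close>

lemma complex_ring_simps [simp]:
  "carrier complex_ring = UNIV" "a \<oplus>\<^bsub>complex_ring\<^esub> b = a + b" "a \<otimes>\<^bsub>complex_ring\<^esub> b = a * b"
  "\<one>\<^bsub>complex_ring\<^esub> = 1" "\<zero>\<^bsub>complex_ring\<^esub> = 0"
  by (simp_all add: ring_of_type_algebra_def)

text \<open>Complex vector spaces as modules over \<open>complex_ring\<close>, with the module laws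
  restated in the arithmetic of the complex numbers instead of the operations of that
  record.\<close>

locale cvs =
  fixes M :: "(complex, 'v) module" (structure)
  assumes mod: "module complex_ring M"
begin

sublocale M: module complex_ring M by (rule mod)

lemmas a_comm = M.M.a_comm and a_assoc = M.M.a_assoc and zero_closed = M.M.zero_closed and a_closed = M.M.a_closed
  and finsum_insert = M.M.finsum_insert and add_l_cancel = M.M.add.l_cancel and a_lcomm = M.M.a_lcomm
  and abelian_group = M.M.abelian_group_axioms

lemma smult_closed' [simp, intro]: "x \<in> carrier M \<Longrightarrow> c \<odot> x \<in> carrier M"
  using M.smult_closed by simp

lemma smult_l_distr: "x \<in> carrier M \<Longrightarrow> (a + b) \<odot> x = a \<odot> x \<oplus> b \<odot> x"
  using M.smult_l_distr[of a b x] by simp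

lemma smult_r_distr: "x \<in> carrier M \<Longrightarrow> y \<in> carrier M \<Longrightarrow> c \<odot> (x \<oplus> y) = c \<odot> x \<oplus> c \<odot> y"
  using M.smult_r_distr[of c x y] by simp

lemma smult_assoc: "x \<in> carrier M \<Longrightarrow> (a * b) \<odot> x = a \<odot> (b \<odot> x)"
  using M.smult_assoc1[of a b x] by simp

lemma smult_one [simp]: "x \<in> carrier M \<Longrightarrow> 1 \<odot> x = x"
  using M.smult_one by simp

lemma smult_0_left [simp]: "x \<in> carrier M \<Longrightarrow> 0 \<odot> x = \<zero>"
proof -
  assume x: "x \<in> carrier M"
  have "0 \<odot> x \<oplus> 0 \<odot> x = 0 \<odot> x \<oplus> \<zero>" using smult_l_distr[OF x, of 0 0] x by simp
  then show ?thesis using x by (subst (asm) add_l_cancel) auto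
qed

lemma smult_0_right [simp]: "c \<odot> \<zero> = \<zero>"
proof -
  have "c \<odot> \<zero> = c \<odot> (0 \<odot> \<zero>)" by simp
  also have "\<dots> = (c * 0) \<odot> \<zero>" by (rule smult_assoc[symmetric]) simp
  finally show ?thesis by simp
qed

lemma add_neg: "x \<in> carrier M \<Longrightarrow> x \<oplus> (-1) \<odot> x = \<zero>"
  using smult_l_distr[of x 1 "-1"] by simp

lemma eq_of_add_neg:
  assumes "x \<in> carrier M" "y \<in> carrier M" "x \<oplus> (-1) \<odot> y = \<zero>"
  shows "x = y"
proof -
  have "x = x \<oplus> ((-1) \<odot> y \<oplus> y)" using add_neg[OF assms(2)] assms by (simp add: a_comm)
  also have "\<dots> = y" using assms by (simp add: a_assoc[symmetric])
  finally show ?thesis .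
qed

lemma finsum_pair:
  "p \<noteq> q \<Longrightarrow> g p \<in> carrier M \<Longrightarrow> g q \<in> carrier M \<Longrightarrow> finsum M g {p, q} = g p \<oplus> g q"
  by (simp add: finsum_insert)

lemma finsum_triple:
  "p \<noteq> q \<Longrightarrow> p \<noteq> r \<Longrightarrow> q \<noteq> r \<Longrightarrow> g p \<in> carrier M \<Longrightarrow> g q \<in> carrier M \<Longrightarrow> g r \<in> carrier M \<Longrightarrow>
    finsum M g {p, q, r} = g p \<oplus> (g q \<oplus> g r)"
  by (simp add: finsum_insert)

lemma finsum_neutral:
  assumes "finite S" "S0 \<subseteq> S" "\<And>p. p \<in> S - S0 \<Longrightarrow> g p = \<zero>" "\<And>p. p \<in> S0 \<Longrightarrow> g p \<in> carrier M"
  shows "finsum M g S = finsum M g S0"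
  by (rule M.M.add.finprod_mono_neutral_cong_right) (use assms in \<open>auto, metis DiffI zero_closed\<close>)

end

text \<open>Vector space laws for cosets and for families of homomorphisms are pulled back along an
  injective coordinate map, which avoids checking them on the sets and functions themselves.\<close>

lemma module_transfer:
  fixes L :: "(complex, 'u) module" and M :: "(complex, 'v) module"
  assumes M: "module complex_ring M"
    and inj: "inj_on \<phi> (carrier L)" and im: "\<phi> ` carrier L \<subseteq> carrier M"
    and zero: "\<zero>\<^bsub>L\<^esub> \<in> carrier L" "\<phi> \<zero>\<^bsub>L\<^esub> = \<zero>\<^bsub>M\<^esub>"
    and add: "\<And>x y. x \<in> carrier L \<Longrightarrow> y \<in> carrier L \<Longrightarrow> x \<oplus>\<^bsub>L\<^esub> y \<in> carrier L \<and> \<phi> (x \<oplus>\<^bsub>L\<^esub> y) = \<phi> x \<oplus>\<^bsub>M\<^esub> \<phi> y"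
    and smult: "\<And>c x. x \<in> carrier L \<Longrightarrow> c \<odot>\<^bsub>L\<^esub> x \<in> carrier L \<and> \<phi> (c \<odot>\<^bsub>L\<^esub> x) = c \<odot>\<^bsub>M\<^esub> \<phi> x"
  shows "module complex_ring L"
proof -
  interpret M: cvs M by (rule cvs.intro) (rule M)
  have car: "\<phi> x \<in> carrier M" if "x \<in> carrier L" for x using im that by auto
  note eq = inj_onD[OF inj]
  have ab: "abelian_group L"
  proof (rule abelian_groupI)
    fix x assume x: "x \<in> carrier L"
    show "\<exists>y\<in>carrier L. y \<oplus>\<^bsub>L\<^esub> x = \<zero>\<^bsub>L\<^esub>"
    proof (rule bexI[of _ "(-1) \<odot>\<^bsub>L\<^esub> x"])
      show "(-1) \<odot>\<^bsub>L\<^esub> x \<oplus>\<^bsub>L\<^esub> x = \<zero>\<^bsub>L\<^esub>"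
        by (rule eq) (use x add smult zero car M.add_neg in \<open>simp_all add: M.a_comm\<close>)
    qed (use x smult in simp)
  next
    fix x y z assume "x \<in> carrier L" "y \<in> carrier L" "z \<in> carrier L"
    then show "x \<oplus>\<^bsub>L\<^esub> y \<oplus>\<^bsub>L\<^esub> z = x \<oplus>\<^bsub>L\<^esub> (y \<oplus>\<^bsub>L\<^esub> z)"
      by (intro eq) (simp_all add: add car M.a_assoc)
  next
    fix x y assume "x \<in> carrier L" "y \<in> carrier L"
    then show "x \<oplus>\<^bsub>L\<^esub> y = y \<oplus>\<^bsub>L\<^esub> x" by (intro eq) (simp_all add: add car M.a_comm)
  next
    fix x assume "x \<in> carrier L"
    then show "\<zero>\<^bsub>L\<^esub> \<oplus>\<^bsub>L\<^esub> x = x" by (intro eq) (simp_all add: add zero car)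
  qed (use add zero in auto)
  show ?thesis
  proof (rule moduleI)
    show "cring complex_ring" by (rule cring_from_type_algebra)
    show "abelian_group L" by (rule ab)
    fix a b :: complex and x y assume x: "x \<in> carrier L"
    then show "(a \<oplus>\<^bsub>complex_ring\<^esub> b) \<odot>\<^bsub>L\<^esub> x = a \<odot>\<^bsub>L\<^esub> x \<oplus>\<^bsub>L\<^esub> b \<odot>\<^bsub>L\<^esub> x"
      by (intro eq) (simp_all add: add smult car M.smult_l_distr)
    show "(a \<otimes>\<^bsub>complex_ring\<^esub> b) \<odot>\<^bsub>L\<^esub> x = a \<odot>\<^bsub>L\<^esub> (b \<odot>\<^bsub>L\<^esub> x)"
      using x by (intro eq) (simp_all add: smult car M.smult_assoc)
    assume "y \<in> carrier L"
    then show "a \<odot>\<^bsub>L\<^esub> (x \<oplus>\<^bsub>L\<^esub> y) = a \<odot>\<^bsub>L\<^esub> x \<oplus>\<^bsub>L\<^esub> a \<odot>\<^bsub>L\<^esub> y"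
      using x by (intro eq) (simp_all add: add smult car M.smult_r_distr)
  next
    fix x assume "x \<in> carrier L"
    then show "\<one>\<^bsub>complex_ring\<^esub> \<odot>\<^bsub>L\<^esub> x = x" by (intro eq) (simp_all add: smult car)
  qed (use smult in simp)
qed

section \<open>Tensors and the terms of the insertion sum\<close>

lemma tensor_degree_simps [simp]:
  "tensor_degree [] = 0" "tensor_degree (p # z) = fst p + tensor_degree z"
  "tensor_degree (y @ z) = tensor_degree y + tensor_degree z"
  by (simp_all add: tensor_degree_def)

lemma tensors_iff: "z \<in> tensors V \<longleftrightarrow> z \<noteq> [] \<and> (\<forall>p \<in> set z. snd p \<in> carrier (V (fst p)))"
  by (auto simp: tensors_def)

lemma length_cases:
  obtains "z = []" | d x where "z = [(d, x)]" | d x e y where "z = [(d, x), (e, y)]" | "length z \<ge> 3"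
proof (cases z)
  case (Cons p w)
  note 1 = this
  show thesis
  proof (cases w)
    case Nil
    then show thesis using that(2)[of "fst p" "snd p"] 1 by simp
  next
    case (Cons q u)
    then show thesis using that(3)[of "fst p" "snd p" "fst q" "snd q"] that(4) 1 by (cases u) auto
  qed
qed (use that in simp)

lemma dg_operations_simps [simp]:
  "dg_operations V df mu [(d, x)] = df d x"
  "dg_operations V df mu [(d, x), (e, y)] = mu d x e y"
  by (simp_all add: dg_operations_def)

lemma dg_operations_long:
  "length z \<ge> 3 \<Longrightarrow> dg_operations V df mu z = \<zero>\<^bsub>V (tensor_degree z + 2 - int (length z))\<^esub>"
  by (auto simp: dg_operations_def algebra_simps split: list.split)

definition insertion_set :: "'a list \<Rightarrow> (nat \<times> nat \<times> nat) set" where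
  "insertion_set z = {(r, s, t). r + s + t = length z \<and> s \<ge> 1}"

definition insertion_term ::
  "(complex, 'u) module \<Rightarrow> ('v tensor \<Rightarrow> 'v) \<Rightarrow> ('v tensor \<Rightarrow> 'u) \<Rightarrow> 'v tensor \<Rightarrow> nat \<times> nat \<times> nat \<Rightarrow> 'u" where
  "insertion_term T m f z = (\<lambda>(r, s, t). let y = take s (drop r z) in
          (-1) powi (int (r + s * t) + (2 - int s) * tensor_degree (take r z)) \<odot>\<^bsub>T\<^esub>
            f (take r z @ [(tensor_degree y + 2 - int s, m y)] @ drop (r + s) z))"

lemma insertion_sum_alt: "insertion_sum T m f z = finsum T (insertion_term T m f z) (insertion_set z)"
  by (simp add: insertion_sum_def insertion_term_def insertion_set_def)

lemma finite_insertion_set: "finite (insertion_set z)"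
  by (rule finite_subset[of _ "{..length z} \<times> {..length z} \<times> {..length z}"]) (auto simp: insertion_set_def)

lemma insertion_set_small:
  "insertion_set [p] = {(0, 1, 0)}" "insertion_set [p, q] = {(0, 2, 0), (0, 1, 1), (1, 1, 0)}"
  by (auto simp: insertion_set_def)

lemma composition_set_finite: "finite {is. sum_list is = (n :: nat) \<and> (\<forall>i \<in> set is. i \<ge> 1)}"
proof (rule finite_subset)
  have "length is \<le> sum_list is" if "\<forall>i \<in> set is. i \<ge> 1" for "is" :: "nat list"
    using that by (induction "is") auto
  then show "{is. sum_list is = n \<and> (\<forall>i \<in> set is. i \<ge> 1)} \<subseteq> {is. set is \<subseteq> {..n} \<and> length is \<le> n}"
    by (auto intro: member_le_sum_list)
qed (rule finite_lists_length_le, simp)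

lemma map_length_blocks: "sum_list is = length z \<Longrightarrow> map length (blocks is z) = is"
  by (induction "is" arbitrary: z) auto

lemma set_blocks: "y \<in> set (blocks is z) \<Longrightarrow> set y \<subseteq> set z"
proof (induction "is" arbitrary: z)
  case (Cons i "is")
  then show ?case using set_take_subset[of i z] set_drop_subset[of i z] by fastforce
qed simp

lemma blocks_ones: "blocks (replicate (length z) 1) z = map (\<lambda>a. [a]) z"
  by (induction z) simp_all

lemma all_ones: "(\<forall>i \<in> set is. i = (1 :: nat)) \<Longrightarrow> is = replicate (sum_list is) 1"
  by (induction "is") auto

text \<open>The sign in \<open>leibniz\<close> is the Koszul sign of moving the differential past a
  first factor of degree \<open>d\<close>, as the A-infinity relation on two factors
  requires.\<close>

locale dg_algebra =
  fixes V :: "'v gspace" and df :: "int \<Rightarrow> 'v \<Rightarrow> 'v" and mu :: "int \<Rightarrow> 'v \<Rightarrow> int \<Rightarrow> 'v \<Rightarrow> 'v"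
  assumes vs: "module complex_ring (V d)"
    and df_closed: "x \<in> carrier (V d) \<Longrightarrow> df d x \<in> carrier (V (d + 1))"
    and df_add: "x \<in> carrier (V d) \<Longrightarrow> y \<in> carrier (V d) \<Longrightarrow> df d (x \<oplus>\<^bsub>V d\<^esub> y) = df d x \<oplus>\<^bsub>V (d + 1)\<^esub> df d y"
    and df_smult: "x \<in> carrier (V d) \<Longrightarrow> df d (c \<odot>\<^bsub>V d\<^esub> x) = c \<odot>\<^bsub>V (d + 1)\<^esub> df d x"
    and df_df: "x \<in> carrier (V d) \<Longrightarrow> df (d + 1) (df d x) = \<zero>\<^bsub>V (d + 1 + 1)\<^esub>"
    and mu_closed: "x \<in> carrier (V d) \<Longrightarrow> y \<in> carrier (V e) \<Longrightarrow> mu d x e y \<in> carrier (V (d + e))"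
    and mu_add_left: "x \<in> carrier (V d) \<Longrightarrow> x' \<in> carrier (V d) \<Longrightarrow> y \<in> carrier (V e) \<Longrightarrow>
      mu d (x \<oplus>\<^bsub>V d\<^esub> x') e y = mu d x e y \<oplus>\<^bsub>V (d + e)\<^esub> mu d x' e y"
    and mu_add_right: "x \<in> carrier (V d) \<Longrightarrow> y \<in> carrier (V e) \<Longrightarrow> y' \<in> carrier (V e) \<Longrightarrow>
      mu d x e (y \<oplus>\<^bsub>V e\<^esub> y') = mu d x e y \<oplus>\<^bsub>V (d + e)\<^esub> mu d x e y'"
    and mu_smult_left: "x \<in> carrier (V d) \<Longrightarrow> y \<in> carrier (V e) \<Longrightarrow>
      mu d (c \<odot>\<^bsub>V d\<^esub> x) e y = c \<odot>\<^bsub>V (d + e)\<^esub> mu d x e y"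
    and mu_smult_right: "x \<in> carrier (V d) \<Longrightarrow> y \<in> carrier (V e) \<Longrightarrow>
      mu d x e (c \<odot>\<^bsub>V e\<^esub> y) = c \<odot>\<^bsub>V (d + e)\<^esub> mu d x e y"
    and mu_assoc: "x \<in> carrier (V d) \<Longrightarrow> y \<in> carrier (V e) \<Longrightarrow> z \<in> carrier (V g) \<Longrightarrow>
      mu (d + e) (mu d x e y) g z = mu d x (e + g) (mu e y g z)"
    and leibniz: "x \<in> carrier (V d) \<Longrightarrow> y \<in> carrier (V e) \<Longrightarrow>
      df (d + e) (mu d x e y) = mu (d + 1) (df d x) e y \<oplus>\<^bsub>V (d + e + 1)\<^esub>
        (-1) powi d \<odot>\<^bsub>V (d + e + 1)\<^esub> mu d x (e + 1) (df e y)"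
begin

abbreviation ops :: "'v tensor \<Rightarrow> 'v" where "ops \<equiv> dg_operations V df mu"

sublocale V: cvs "V q" for q by (rule cvs.intro) (rule vs)

lemma zero_closed: "\<zero>\<^bsub>V d\<^esub> \<in> carrier (V d)" by simp

lemma df_zero [simp]: "df d \<zero>\<^bsub>V d\<^esub> = \<zero>\<^bsub>V (d + 1)\<^esub>"
  using df_smult[OF zero_closed, of d 0] df_closed[OF zero_closed, of d] by simp

lemma mu_zero_left [simp]: "y \<in> carrier (V e) \<Longrightarrow> mu d \<zero>\<^bsub>V d\<^esub> e y = \<zero>\<^bsub>V (d + e)\<^esub>"
  using mu_smult_left[OF zero_closed, of y e d 0] mu_closed[OF zero_closed, of y e d] by simp

lemma mu_zero_right [simp]: "x \<in> carrier (V d) \<Longrightarrow> mu d x e \<zero>\<^bsub>V e\<^esub> = \<zero>\<^bsub>V (d + e)\<^esub>"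
  using mu_smult_right[OF _ zero_closed, of x d e 0] mu_closed[OF _ zero_closed, of x d e] by simp

lemma ops_closed:
  assumes "z \<in> tensors V"
  shows "ops z \<in> carrier (V (tensor_degree z + 2 - int (length z)))"
proof (cases rule: length_cases[of z])
  case (2 d x)
  then show ?thesis using df_closed[of x d] assms by (simp add: tensors_iff add.commute)
next
  case (3 d x e y)
  then show ?thesis using mu_closed[of x d y e] assms by (simp add: tensors_iff)
next
  case 4
  then show ?thesis by (simp add: dg_operations_long)
qed (use assms in \<open>simp add: tensors_iff\<close>)

lemma multilinear_ops: "multilinear_family 2 V V ops"
  unfolding multilinear_family_def
proof (intro conjI ballI allI impI)
  fix z assume "z \<in> tensors V"
  then show "ops z \<in> carrier (V (tensor_degree z + 2 - int (length z)))" by (rule ops_closed)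
next
  fix y z d a b assume ab: "a \<in> carrier (V d)" "b \<in> carrier (V d)" and t: "y @ (d, a) # z \<in> tensors V"
  show "let T = V (tensor_degree y + d + tensor_degree z + 2 - int (length y + 1 + length z)) in
      ops (y @ (d, a \<oplus>\<^bsub>V d\<^esub> b) # z) = ops (y @ (d, a) # z) \<oplus>\<^bsub>T\<^esub> ops (y @ (d, b) # z) \<and>
      (\<forall>c. ops (y @ (d, c \<odot>\<^bsub>V d\<^esub> a) # z) = c \<odot>\<^bsub>T\<^esub> ops (y @ (d, a) # z))"
  proof (cases "length y + length z \<ge> 2")
    case True
    then have *: "ops (y @ (d, v) # z) = \<zero>\<^bsub>V (tensor_degree y + d + tensor_degree z + 2 - int (length y + 1 + length z))\<^esub>" for v
      by (subst dg_operations_long) (auto simp: algebra_simps)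
    show ?thesis unfolding Let_def * by simp
  next
    case False
    then consider "y = []" "z = []" | p where "y = [p]" "z = []" | p where "y = []" "z = [p]"
      by (cases y; cases z) (auto simp: Suc_le_eq)
    then show ?thesis
    proof cases
      case 1
      then show ?thesis using ab df_add df_smult by (simp add: Let_def algebra_simps)
    next
      case (2 p)
      then obtain e v where "y = [(e, v)]" "v \<in> carrier (V e)" using t by (cases p) (auto simp: tensors_iff)
      then show ?thesis using ab mu_add_right mu_smult_right 2 by (simp add: Let_def)
    next
      case (3 p)
      then obtain e v where "z = [(e, v)]" "v \<in> carrier (V e)" using t by (cases p) (auto simp: tensors_iff)
      then show ?thesis using ab mu_add_left mu_smult_left 3 by (simp add: Let_def)
    qed
  qed
qed

end

lemma multilinear_closed:
  "multilinear_family e V U f \<Longrightarrow> z \<in> tensors V \<Longrightarrow> f z \<in> carrier (U (tensor_degree z + e - int (length z)))"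
  unfolding multilinear_family_def by (elim conjE) (drule (1) bspec)

lemma multilinear_smult:
  assumes "multilinear_family e V U f" "a \<in> carrier (V d)" "y @ (d, a) # z \<in> tensors V"
    and g: "g = tensor_degree y + d + tensor_degree z + e - int (length y + 1 + length z)"
  shows "f (y @ (d, c \<odot>\<^bsub>V d\<^esub> a) # z) = c \<odot>\<^bsub>U g\<^esub> f (y @ (d, a) # z)"
proof -
  have "let T = U (tensor_degree y + d + tensor_degree z + e - int (length y + 1 + length z)) in
     f (y @ (d, a \<oplus>\<^bsub>V d\<^esub> a) # z) = f (y @ (d, a) # z) \<oplus>\<^bsub>T\<^esub> f (y @ (d, a) # z) \<and>
     (\<forall>c. f (y @ (d, c \<odot>\<^bsub>V d\<^esub> a) # z) = c \<odot>\<^bsub>T\<^esub> f (y @ (d, a) # z))"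
    using assms(1-3) unfolding multilinear_family_def by blast
  then show ?thesis unfolding Let_def g by blast
qed

lemma multilinear_zero:
  assumes f: "multilinear_family e V U f" and V: "\<And>d. module complex_ring (V d)" and U: "\<And>d. module complex_ring (U d)"
    and t: "y @ (d, \<zero>\<^bsub>V d\<^esub>) # z \<in> tensors V"
    and g: "g = tensor_degree y + d + tensor_degree z + e - int (length y + 1 + length z)"
  shows "f (y @ (d, \<zero>\<^bsub>V d\<^esub>) # z) = \<zero>\<^bsub>U g\<^esub>"
proof -
  interpret V: cvs "V q" for q by (rule cvs.intro) (rule V)
  interpret U: cvs "U q" for q by (rule cvs.intro) (rule U)
  have c: "f (y @ (d, \<zero>\<^bsub>V d\<^esub>) # z) \<in> carrier (U g)"
  proof -
    have "g = tensor_degree (y @ (d, \<zero>\<^bsub>V d\<^esub>) # z) + e - int (length (y @ (d, \<zero>\<^bsub>V d\<^esub>) # z))"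
      unfolding g by simp
    then show ?thesis using multilinear_closed[OF f t] by (simp only:)
  qed
  have "f (y @ (d, 0 \<odot>\<^bsub>V d\<^esub> \<zero>\<^bsub>V d\<^esub>) # z) = 0 \<odot>\<^bsub>U g\<^esub> f (y @ (d, \<zero>\<^bsub>V d\<^esub>) # z)"
    by (rule multilinear_smult[OF f V.zero_closed t g])
  then show ?thesis using c by simp
qed

text \<open>Multilinearity carries the vanishing of the inner operation over to the whole term;
  \<open>g\<close> records the degree in which the resulting zero lives, since each degree has its
  own zero.\<close>

lemma insertion_term_zero:
  assumes f: "multilinear_family e V U f" and V: "\<And>d. module complex_ring (V d)" and U: "\<And>d. module complex_ring (U d)"
    and z: "z \<in> tensors V" and rst: "(r, s, t) \<in> insertion_set z"
    and m: "m (take s (drop r z)) = \<zero>\<^bsub>V (tensor_degree (take s (drop r z)) + 2 - int s)\<^esub>"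
    and g: "g = tensor_degree z + e + 1 - int (length z)"
  shows "insertion_term (U g) m f z (r, s, t) = \<zero>\<^bsub>U g\<^esub>"
proof -
  interpret U: cvs "U q" for q by (rule cvs.intro) (rule U)
  interpret V: cvs "V q" for q by (rule cvs.intro) (rule V)
  have len: "r + s + t = length z" "s \<ge> 1" using rst by (auto simp: insertion_set_def)
  have zz: "z = take r z @ take s (drop r z) @ drop (r + s) z"
    by (metis append_take_drop_id drop_drop add.commute)
  then have deg: "tensor_degree z = tensor_degree (take r z) + tensor_degree (take s (drop r z)) + tensor_degree (drop (r + s) z)"
    by (metis tensor_degree_simps(3) add.assoc)
  have "f (take r z @ (tensor_degree (take s (drop r z)) + 2 - int s, m (take s (drop r z))) # drop (r + s) z) = \<zero>\<^bsub>U g\<^esub>"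
    unfolding m
  proof (rule multilinear_zero[OF f V U])
    show "take r z @ (tensor_degree (take s (drop r z)) + 2 - int s, \<zero>\<^bsub>V (tensor_degree (take s (drop r z)) + 2 - int s)\<^esub>) # drop (r + s) z \<in> tensors V"
      using z by (auto simp: tensors_iff dest: in_set_takeD in_set_dropD)
    show "g = tensor_degree (take r z) + (tensor_degree (take s (drop r z)) + 2 - int s) + tensor_degree (drop (r + s) z) + e -
      int (length (take r z) + 1 + length (drop (r + s) z))"
      using len unfolding g deg by (simp add: min_def)
  qed
  then show ?thesis by (simp add: insertion_term_def Let_def)
qed

text \<open>The exponent is \<open>r + s * t\<close> plus the Koszul part \<open>2 - s\<close> times
  the degree of the first \<open>r\<close> factors. The Koszul part vanishes for
  \<open>s = 2\<close> and contributes \<open>d\<close> at \<open>(1, 1, 0)\<close>.\<close>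

lemma insertion_term_small:
  "insertion_term T m f [(d, x)] (0, 1, 0) = 1 \<odot>\<^bsub>T\<^esub> f [(1 + d, m [(d, x)])]"
  "insertion_term T m f [(d, x), (e, y)] (0, 2, 0) = 1 \<odot>\<^bsub>T\<^esub> f [(d + e, m [(d, x), (e, y)])]"
  "insertion_term T m f [(d, x), (e, y)] (0, 1, 1) = (-1) \<odot>\<^bsub>T\<^esub> f [(1 + d, m [(d, x)]), (e, y)]"
  "insertion_term T m f [(d, x), (e, y)] (1, 1, 0) = (- ((-1) powi d)) \<odot>\<^bsub>T\<^esub> f [(d, x), (1 + e, m [(e, y)])]"
  "insertion_term T m f [(d, x), (e, y), (h, w)] (0, 2, 1) = 1 \<odot>\<^bsub>T\<^esub> f [(d + e, m [(d, x), (e, y)]), (h, w)]"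
  "insertion_term T m f [(d, x), (e, y), (h, w)] (1, 2, 0) = (-1) \<odot>\<^bsub>T\<^esub> f [(d, x), (e + h, m [(e, y), (h, w)])]"
  proof -
  show "insertion_term T m f [(d, x), (e, y)] (1, 1, 0) = (- ((-1) powi d)) \<odot>\<^bsub>T\<^esub> f [(d, x), (1 + e, m [(e, y)])]"
  proof -
    have "(-1 :: complex) powi (1 + d) = - ((-1) powi d)"
      by (subst add.commute, subst power_int_add_1') simp_all
    then show ?thesis by (simp add: insertion_term_def)
  qed
qed (simp_all add: insertion_term_def numeral_2_eq_2)

lemma insertion_sum_vanishes:
  assumes "cvs T" "\<And>p. p \<in> insertion_set z \<Longrightarrow> insertion_term T m f z p = \<zero>\<^bsub>T\<^esub>"
  shows "insertion_sum T m f z = \<zero>\<^bsub>T\<^esub>"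
proof -
  interpret T: cvs T by (rule assms)
  show ?thesis unfolding insertion_sum_alt
    using T.finsum_neutral[of "insertion_set z" "{}" "insertion_term T m f z"] assms(2) finite_insertion_set[of z] by simp
qed

context dg_algebra
begin

text \<open>On one, two and three factors the relations are the vanishing of the square of the
  differential, the Leibniz rule and associativity. On more factors every term involves an operation
  with at least three arguments.\<close>

lemma ainf_algebra_ops: "ainf_algebra V ops"
  unfolding ainf_algebra_def Let_def
proof (intro conjI ballI allI)
  show "module complex_ring (V d)" for d by (rule vs)
  show "multilinear_family 2 V V ops" by (rule multilinear_ops)
  fix z assume z: "z \<in> tensors V"
  show "insertion_sum (V (tensor_degree z + 3 - int (length z))) ops ops z = \<zero>\<^bsub>V (tensor_degree z + 3 - int (length z))\<^esub>"
  proof (cases rule: length_cases[of z])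
    case 1
    then show ?thesis using z by (simp add: tensors_iff)
  next
    case (2 d x)
    then have x: "x \<in> carrier (V d)" using z by (simp add: tensors_iff)
    have g: "tensor_degree z + 3 - int (length z) = d + 1 + 1" using 2 by simp
    note c = df_closed[OF df_closed[OF x]]
    show ?thesis unfolding g insertion_sum_alt 2 insertion_set_small
      using V.finsum_insert[of "{}" "(0, 1, 0)" "insertion_term (V (d + 1 + 1)) ops ops [(d, x)]" "d + 1 + 1"] c df_df[OF x]
      by (simp add: insertion_term_small[unfolded One_nat_def] add.commute[of 1])
  next
    case (3 d x e y)
    then have xy: "x \<in> carrier (V d)" "y \<in> carrier (V e)" using z by (auto simp: tensors_iff)
    have g: "tensor_degree z + 3 - int (length z) = d + e + 1" using 3 by simp
    let ?T = "V (d + e + 1)" and ?t = "insertion_term (V (d + e + 1)) ops ops [(d, x), (e, y)]"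
    let ?A = "mu (d + 1) (df d x) e y" and ?B = "mu d x (e + 1) (df e y)"
    have e1: "d + 1 + e = d + e + 1" "d + (e + 1) = d + e + 1" by simp_all
    have c: "?A \<in> carrier ?T" "?B \<in> carrier ?T" "df (d + e) (mu d x e y) \<in> carrier ?T"
      using mu_closed[OF df_closed[OF xy(1)] xy(2)] mu_closed[OF xy(1) df_closed[OF xy(2)]] df_closed[OF mu_closed[OF xy]]
      unfolding e1 .
    have B: "(-1) powi d \<odot>\<^bsub>?T\<^esub> ?B \<in> carrier ?T" using c by simp
    have t: "?t (0, 2, 0) = ?A \<oplus>\<^bsub>?T\<^esub> (-1) powi d \<odot>\<^bsub>?T\<^esub> ?B"
      "?t (0, 1, 1) = (-1) \<odot>\<^bsub>?T\<^esub> ?A" "?t (1, 1, 0) = (-1) \<odot>\<^bsub>?T\<^esub> ((-1) powi d \<odot>\<^bsub>?T\<^esub> ?B)"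
      unfolding insertion_term_small add.commute[of 1] using c leibniz[OF xy] V.smult_assoc[OF c(2), of "-1" "(-1) powi d"] by simp_all
    have "finsum ?T ?t {(0, 2, 0), (0, 1, 1), (1, 1, 0)} = ?t (0, 2, 0) \<oplus>\<^bsub>?T\<^esub> (?t (0, 1, 1) \<oplus>\<^bsub>?T\<^esub> ?t (1, 1, 0))"
      by (rule V.finsum_triple) (simp_all del: One_nat_def add: t c B V.a_closed)
    also have "\<dots> = (?A \<oplus>\<^bsub>?T\<^esub> (-1) powi d \<odot>\<^bsub>?T\<^esub> ?B) \<oplus>\<^bsub>?T\<^esub> (-1) \<odot>\<^bsub>?T\<^esub> (?A \<oplus>\<^bsub>?T\<^esub> (-1) powi d \<odot>\<^bsub>?T\<^esub> ?B)"
      unfolding t using V.smult_r_distr[OF c(1) B] by simp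
    also have "\<dots> = \<zero>\<^bsub>?T\<^esub>" by (rule V.add_neg) (rule V.a_closed[OF c(1) B])
    finally show ?thesis unfolding g unfolding insertion_sum_alt 3 insertion_set_small .
  next
    case 4
    let ?g = "tensor_degree z + 3 - int (length z)"
    have g: "?g = tensor_degree z + 2 + 1 - int (length z)" by simp
    \<comment> \<open>The term at \<open>s\<close> composes an operation of \<open>s\<close>
      arguments with one of \<open>length z + 1 - s\<close>. Both numbers are at most 2 only for
      \<open>length z = 3\<close> and \<open>s = 2\<close>.\<close>
    have zeroI: "insertion_term (V ?g) ops ops z (r, s, t) = \<zero>\<^bsub>V ?g\<^esub>"
      if rst: "(r, s, t) \<in> insertion_set z" and not: "\<not> (length z = 3 \<and> s = 2)" for r s t
    proof (cases "s \<ge> 3")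
      case True
      have "length (take s (drop r z)) = s" using rst by (auto simp: insertion_set_def)
      then have "ops (take s (drop r z)) = \<zero>\<^bsub>V (tensor_degree (take s (drop r z)) + 2 - int s)\<^esub>"
        using dg_operations_long[of "take s (drop r z)" V df mu] True by simp
      then show ?thesis by (rule insertion_term_zero[OF multilinear_ops vs vs z rst _ g])
    next
      case False
      then have l: "length (take r z @ [(tensor_degree (take s (drop r z)) + 2 - int s, ops (take s (drop r z)))] @ drop (r + s) z) \<ge> 3"
        using 4 not rst by (auto simp: insertion_set_def min_def)
      have zz: "z = take r z @ take s (drop r z) @ drop (r + s) z"
        by (metis append_take_drop_id drop_drop add.commute)
      then have deg: "tensor_degree z = tensor_degree (take r z) + tensor_degree (take s (drop r z)) + tensor_degree (drop (r + s) z)"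
        by (metis tensor_degree_simps(3) add.assoc)
      have gg: "tensor_degree (take r z @ [(tensor_degree (take s (drop r z)) + 2 - int s, ops (take s (drop r z)))] @ drop (r + s) z) + 2 -
         int (length (take r z @ [(tensor_degree (take s (drop r z)) + 2 - int s, ops (take s (drop r z)))] @ drop (r + s) z)) = ?g"
        unfolding deg using rst by (auto simp: insertion_set_def min_def)
      show ?thesis unfolding insertion_term_def Let_def prod.case using dg_operations_long[OF l, of V df mu] unfolding gg by simp
    qed
    show ?thesis
    proof (cases "length z = 3")
      case False
      then show ?thesis
        by (intro insertion_sum_vanishes[OF V.cvs_axioms]) (use zeroI in auto)
    next
      case True
      then obtain d x e y h w where zz: "z = [(d, x), (e, y), (h, w)]"
        by (auto simp: numeral_3_eq_3 length_Suc_conv)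
      have xyw: "x \<in> carrier (V d)" "y \<in> carrier (V e)" "w \<in> carrier (V h)" using z zz by (auto simp: tensors_iff)
      have gg: "?g = d + e + h" using zz by simp
      let ?T = "V (d + e + h)"
      have c: "mu (d + e) (mu d x e y) h w \<in> carrier ?T" using xyw by (intro mu_closed)
      have sub: "{(0, 2, 1), (1, 2, 0)} \<subseteq> insertion_set z" using zz by (auto simp: insertion_set_def)
      have t: "insertion_term ?T ops ops z (0, 2, 1) = mu (d + e) (mu d x e y) h w"
        "insertion_term ?T ops ops z (1, 2, 0) = (-1) \<odot>\<^bsub>?T\<^esub> mu (d + e) (mu d x e y) h w"
        unfolding zz insertion_term_small using c mu_assoc[OF xyw] by simp_all
      have "insertion_sum ?T ops ops z = finsum ?T (insertion_term ?T ops ops z) {(0, 2, 1), (1, 2, 0)}"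
        unfolding insertion_sum_alt
      proof (rule V.finsum_neutral[OF finite_insertion_set sub])
        fix p assume p: "p \<in> insertion_set z - {(0, 2, 1), (1, 2, 0)}"
        obtain r q l where rql: "p = (r, q, l)" by (metis surj_pair)
        then have "r + q + l = 3" "p \<noteq> (0, 2, 1)" "p \<noteq> (1, 2, 0)" using p True by (auto simp: insertion_set_def)
        then have "q \<noteq> 2" unfolding rql by auto
        then show "insertion_term ?T ops ops z p = \<zero>\<^bsub>?T\<^esub>" using zeroI[of r q l] p unfolding rql gg by blast
      next
        fix p :: "nat \<times> nat \<times> nat" assume "p \<in> {(0, 2, 1), (1, 2, 0)}"
        then consider "p = (0, 2, 1)" | "p = (1, 2, 0)" by blast
        then show "insertion_term ?T ops ops z p \<in> carrier ?T"
          by cases (simp_all only: t c V.smult_closed')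
      qed
      also have "\<dots> = insertion_term ?T ops ops z (0, 2, 1) \<oplus>\<^bsub>?T\<^esub> insertion_term ?T ops ops z (1, 2, 0)"
        by (rule V.finsum_pair) (simp_all del: One_nat_def add: t c)
      also have "\<dots> = \<zero>\<^bsub>?T\<^esub>" unfolding t by (rule V.add_neg[OF c])
      finally show ?thesis unfolding gg .
    qed
  qed
qed

end

section \<open>Minimal models from strict subalgebras of representatives\<close>

definition strict_family :: "'u gspace \<Rightarrow> (int \<Rightarrow> 'v \<Rightarrow> 'u) \<Rightarrow> 'v tensor \<Rightarrow> 'u" where
  "strict_family U \<phi> z = (case z of [(d, x)] \<Rightarrow> \<phi> d x | _ \<Rightarrow> \<zero>\<^bsub>U (tensor_degree z + 1 - int (length z))\<^esub>)"

lemma strict_family_single [simp]: "strict_family U \<phi> [a] = \<phi> (fst a) (snd a)"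
  by (simp add: strict_family_def split_beta)

lemma strict_family_long: "length z \<ge> 2 \<Longrightarrow> strict_family U \<phi> z = \<zero>\<^bsub>U (tensor_degree z + 1 - int (length z))\<^esub>"
  by (auto simp: strict_family_def algebra_simps split: list.split)

lemma tensor_degree_blocks:
  "sum_list is = length z \<Longrightarrow>
   tensor_degree (map (\<lambda>y. (tensor_degree y + 1 - int (length y), f y)) (blocks is z)) =
   tensor_degree z + int (length is) - int (length z)"
proof (induction "is" arbitrary: z)
  case (Cons i "is")
  have "tensor_degree z = tensor_degree (take i z) + tensor_degree (drop i z)"
    by (metis append_take_drop_id tensor_degree_simps(3))
  then show ?case using Cons.IH[of "drop i z"] Cons.prems by (simp add: min_def)
qed simp

locale dg_hom = V: dg_algebra V dfV muV + U: dg_algebra U dfU muU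
  for V :: "'v gspace" and dfV muV and U :: "'u gspace" and dfU muU +
  fixes \<phi> :: "int \<Rightarrow> 'v \<Rightarrow> 'u"
  assumes hom_closed: "x \<in> carrier (V d) \<Longrightarrow> \<phi> d x \<in> carrier (U d)"
    and hom_add: "x \<in> carrier (V d) \<Longrightarrow> y \<in> carrier (V d) \<Longrightarrow> \<phi> d (x \<oplus>\<^bsub>V d\<^esub> y) = \<phi> d x \<oplus>\<^bsub>U d\<^esub> \<phi> d y"
    and hom_smult: "x \<in> carrier (V d) \<Longrightarrow> \<phi> d (c \<odot>\<^bsub>V d\<^esub> x) = c \<odot>\<^bsub>U d\<^esub> \<phi> d x"
    and hom_df: "x \<in> carrier (V d) \<Longrightarrow> \<phi> (d + 1) (dfV d x) = dfU d (\<phi> d x)"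
    and hom_mu: "x \<in> carrier (V d) \<Longrightarrow> y \<in> carrier (V e) \<Longrightarrow> \<phi> (d + e) (muV d x e y) = muU d (\<phi> d x) e (\<phi> e y)"
begin

abbreviation F :: "'v tensor \<Rightarrow> 'u" where "F \<equiv> strict_family U \<phi>"

lemma F_closed:
  assumes "z \<in> tensors V"
  shows "F z \<in> carrier (U (tensor_degree z + 1 - int (length z)))"
proof (cases "length z \<ge> 2")
  case True
  then show ?thesis by (simp add: strict_family_long)
next
  case False
  then obtain d x where "z = [(d, x)]" using assms by (cases rule: length_cases[of z]) (auto simp: tensors_iff)
  then show ?thesis using assms hom_closed by (simp add: tensors_iff)
qed

lemma multilinear_F: "multilinear_family 1 V U F"
  unfolding multilinear_family_def
proof (intro conjI ballI allI impI)
  fix z assume "z \<in> tensors V"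
  then show "F z \<in> carrier (U (tensor_degree z + 1 - int (length z)))" by (rule F_closed)
next
  fix y z d a b assume ab: "a \<in> carrier (V d)" "b \<in> carrier (V d)" and t: "y @ (d, a) # z \<in> tensors V"
  show "let T = U (tensor_degree y + d + tensor_degree z + 1 - int (length y + 1 + length z)) in
      F (y @ (d, a \<oplus>\<^bsub>V d\<^esub> b) # z) = F (y @ (d, a) # z) \<oplus>\<^bsub>T\<^esub> F (y @ (d, b) # z) \<and>
      (\<forall>c. F (y @ (d, c \<odot>\<^bsub>V d\<^esub> a) # z) = c \<odot>\<^bsub>T\<^esub> F (y @ (d, a) # z))"
  proof (cases "length y + length z \<ge> 1")
    case True
    then have *: "F (y @ (d, v) # z) = \<zero>\<^bsub>U (tensor_degree y + d + tensor_degree z + 1 - int (length y + 1 + length z))\<^esub>" for v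
      by (subst strict_family_long) (auto simp: algebra_simps)
    show ?thesis unfolding Let_def * by simp
  next
    case False
    then have "length y = 0 \<and> length z = 0" by linarith
    then have "y = []" "z = []" by simp_all
    then show ?thesis using ab hom_add hom_smult by (simp add: Let_def)
  qed
qed

text \<open>A block of length at least 2 is sent to 0, so only the decomposition into singletons
  remains. Its sign is 1: the first part of the exponent has factors \<open>is ! j - 1\<close>, the
  second \<open>1 - is ! j\<close>.\<close>

lemma composition_sum_F:
  assumes z: "z \<in> tensors V" and g: "g = tensor_degree z + 2 - int (length z)"
  shows "composition_sum (U g) F U.ops z = U.ops (map (\<lambda>a. (fst a, \<phi> (fst a) (snd a))) z)"
proof -
  let ?S = "{is. sum_list is = length z \<and> (\<forall>i \<in> set is. i \<ge> 1)}"
  let ?L = "\<lambda>is. map (\<lambda>y. (tensor_degree y + 1 - int (length y), F y)) (blocks is z)"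
  define h where "h is = (-1) powi
             ((\<Sum>j<length is. (int (length is) - int (j + 1)) * (int (is ! j) - 1)) +
              (\<Sum>j<length is. (1 - int (is ! j)) * tensor_degree (take (sum_list (take j is)) z))) \<odot>\<^bsub>U g\<^esub> U.ops (?L is)" for "is"
  let ?o = "replicate (length z) 1"
  let ?M = "map (\<lambda>a. (fst a, \<phi> (fst a) (snd a))) z"
  have L_o: "?L ?o = ?M" unfolding blocks_ones by (simp add: split_beta)
  have ten_M: "?M \<in> tensors U" using z hom_closed by (auto simp: tensors_iff)
  have "tensor_degree ?M = tensor_degree z" "length ?M = length z" by (simp_all add: tensor_degree_def o_def)
  then have ops_M: "U.ops ?M \<in> carrier (U g)" using U.ops_closed[OF ten_M] unfolding g by simp
  have "h ?o = 1 \<odot>\<^bsub>U g\<^esub> U.ops ?M" unfolding h_def L_o by simp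
  then have h_o: "h ?o = U.ops ?M" using ops_M by simp
  have h_zero: "h is = \<zero>\<^bsub>U g\<^esub>" if "is": "is \<in> ?S - {?o}" for "is"
  proof -
    have sl: "sum_list is = length z" and pos: "\<And>i. i \<in> set is \<Longrightarrow> i \<ge> 1" using "is" by auto
    have "\<not> (\<forall>i \<in> set is. i = 1)" using all_ones[of "is"] "is" sl by auto
    then obtain i where i: "i \<in> set is" "i \<noteq> 1" by blast
    have ml: "map length (blocks is z) = is" by (rule map_length_blocks[OF sl])
    then have "i \<in> length ` set (blocks is z)" using i by (metis list.set_map)
    then obtain y where y: "y \<in> set (blocks is z)" "length y = i" by blast
    then have y2: "length y \<ge> 2" using i pos[OF i(1)] by simp
    have ten: "v \<in> tensors V" if "v \<in> set (blocks is z)" for v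
    proof -
      have "length v \<in> set is" using that ml by (metis image_eqI list.set_map)
      then have "v \<noteq> []" using pos by fastforce
      then show ?thesis using set_blocks[OF that] z by (auto simp: tensors_iff)
    qed
    from y obtain as bs where ab: "blocks is z = as @ y # bs" by (meson split_list)
    let ?f = "\<lambda>y. (tensor_degree y + 1 - int (length y), F y)"
    let ?d = "tensor_degree y + 1 - int (length y)"
    have L: "?L is = map ?f as @ (?d, \<zero>\<^bsub>U ?d\<^esub>) # map ?f bs"
      unfolding ab by (simp add: strict_family_long[OF y2])
    have "?L is \<in> tensors U" using F_closed[OF ten] ab by (auto simp: tensors_iff)
    then have t: "map ?f as @ (?d, \<zero>\<^bsub>U ?d\<^esub>) # map ?f bs \<in> tensors U" unfolding L .
    have deg: "g = tensor_degree (map ?f as) + ?d + tensor_degree (map ?f bs) + 2 - int (length (map ?f as) + 1 + length (map ?f bs))"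
    proof -
      have "tensor_degree (?L is) = tensor_degree z + int (length is) - int (length z)" by (rule tensor_degree_blocks[OF sl])
      moreover have "length (blocks is z) = length is" using arg_cong[OF ml, of length] by simp
      then have "length is = length as + 1 + length bs" unfolding ab by simp
      ultimately show ?thesis unfolding L g by simp
    qed
    have "U.ops (?L is) = \<zero>\<^bsub>U g\<^esub>" unfolding L by (rule multilinear_zero[OF U.multilinear_ops U.vs U.vs t deg])
    then show ?thesis unfolding h_def by simp
  qed
  have "composition_sum (U g) F U.ops z = finsum (U g) h ?S"
    unfolding composition_sum_def h_def ..
  also have "\<dots> = finsum (U g) h {?o}"
    by (rule U.V.finsum_neutral[OF composition_set_finite]) (use h_zero h_o ops_M in \<open>auto simp: sum_list_replicate\<close>)
  also have "\<dots> = h ?o" using U.V.finsum_insert[of "{}" ?o h g] h_o ops_M by simp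
  finally show ?thesis unfolding h_o .
qed

text \<open>Since \<open>\<phi>\<close> respects differential and product on the nose, no higher
  components are called for: the relation says \<open>hom_df\<close> on one factor,
  \<open>hom_mu\<close> on two, and both sides vanish on more.\<close>

lemma ainf_morphism_F: "ainf_morphism V V.ops U U.ops F"
  unfolding ainf_morphism_def Let_def
proof (intro conjI ballI)
  show "ainf_algebra V V.ops" by (rule V.ainf_algebra_ops)
  show "ainf_algebra U U.ops" by (rule U.ainf_algebra_ops)
  show "multilinear_family 1 V U F" by (rule multilinear_F)
  fix z assume z: "z \<in> tensors V"
  let ?g = "tensor_degree z + 2 - int (length z)"
  have "insertion_sum (U ?g) V.ops F z = U.ops (map (\<lambda>a. (fst a, \<phi> (fst a) (snd a))) z)"
  proof (cases rule: length_cases[of z])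
    case 1
    then show ?thesis using z by (simp add: tensors_iff)
  next
    case (2 d x)
    then have x: "x \<in> carrier (V d)" using z by (simp add: tensors_iff)
    have g: "?g = d + 1" using 2 by simp
    have "insertion_sum (U (d + 1)) V.ops F [(d, x)] = dfU d (\<phi> d x)"
      unfolding insertion_sum_alt insertion_set_small
      using U.V.finsum_insert[of "{}" "(0, 1, 0)" "insertion_term (U (d + 1)) V.ops F [(d, x)]" "d + 1"]
        hom_closed[OF V.df_closed[OF x]] hom_df[OF x]
      by (simp add: insertion_term_small[unfolded One_nat_def] add.commute[of 1])
    then show ?thesis unfolding g unfolding 2 by simp
  next
    case (3 d x e y)
    then have xy: "x \<in> carrier (V d)" "y \<in> carrier (V e)" using z by (auto simp: tensors_iff)
    have g: "?g = d + e" using 3 by simp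
    have c: "\<phi> (d + e) (muV d x e y) \<in> carrier (U (d + e))" using hom_closed[OF V.mu_closed[OF xy]] .
    have t: "insertion_term (U (d + e)) V.ops F [(d, x), (e, y)] (0, 2, 0) = \<phi> (d + e) (muV d x e y)"
      "insertion_term (U (d + e)) V.ops F [(d, x), (e, y)] (0, 1, 1) = \<zero>\<^bsub>U (d + e)\<^esub>"
      "insertion_term (U (d + e)) V.ops F [(d, x), (e, y)] (1, 1, 0) = \<zero>\<^bsub>U (d + e)\<^esub>"
      unfolding insertion_term_small using c by (simp_all add: strict_family_long)
    have "insertion_sum (U (d + e)) V.ops F [(d, x), (e, y)] = muU d (\<phi> d x) e (\<phi> e y)"
      unfolding insertion_sum_alt insertion_set_small
      by (subst U.V.finsum_triple) (simp_all del: One_nat_def add: t c hom_mu[OF xy, symmetric])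
    then show ?thesis unfolding g unfolding 3 by simp
  next
    case 4
    have g: "?g = tensor_degree z + 1 + 1 - int (length z)" by simp
    have "insertion_sum (U ?g) V.ops F z = \<zero>\<^bsub>U ?g\<^esub>"
    proof (rule insertion_sum_vanishes[OF U.V.cvs_axioms])
      fix p assume p: "p \<in> insertion_set z"
      obtain r s t where rst: "p = (r, s, t)" by (metis surj_pair)
      have len: "length (take s (drop r z)) = s" "r + s + t = length z" "s \<ge> 1"
        using p rst by (auto simp: insertion_set_def)
      show "insertion_term (U ?g) V.ops F z p = \<zero>\<^bsub>U ?g\<^esub>"
      proof (cases "s \<ge> 3")
        case True
        then have "V.ops (take s (drop r z)) = \<zero>\<^bsub>V (tensor_degree (take s (drop r z)) + 2 - int s)\<^esub>"
          using dg_operations_long[of "take s (drop r z)" V dfV muV] len by simp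
        then show ?thesis unfolding rst
          by (rule insertion_term_zero[OF multilinear_F V.vs U.vs z p[unfolded rst] _ g])
      next
        case False
        let ?l = "take r z @ [(tensor_degree (take s (drop r z)) + 2 - int s, V.ops (take s (drop r z)))] @ drop (r + s) z"
        have l: "length ?l \<ge> 2" using 4 False len by simp
        have zz: "z = take r z @ take s (drop r z) @ drop (r + s) z"
          by (metis append_take_drop_id drop_drop add.commute)
        then have deg: "tensor_degree z = tensor_degree (take r z) + tensor_degree (take s (drop r z)) + tensor_degree (drop (r + s) z)"
          by (metis tensor_degree_simps(3) add.assoc)
        have gg: "tensor_degree ?l + 1 - int (length ?l) = ?g" unfolding deg using len by simp
        show ?thesis unfolding rst insertion_term_def Let_def prod.case
          using strict_family_long[OF l, of U \<phi>] unfolding gg by simp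
      qed
    qed
    moreover have "U.ops (map (\<lambda>a. (fst a, \<phi> (fst a) (snd a))) z) = \<zero>\<^bsub>U ?g\<^esub>"
      using dg_operations_long[of "map (\<lambda>a. (fst a, \<phi> (fst a) (snd a))) z" U dfU muU] 4
      by (simp add: tensor_degree_def o_def)
    ultimately show ?thesis by simp
  qed
  then show "insertion_sum (U ?g) V.ops F z = composition_sum (U ?g) F U.ops z"
    using composition_sum_F[OF z refl] by simp
qed

end

text \<open>\<open>C\<close> is a graded subspace of cocycles, closed under the product, that
  represents each cohomology class exactly once. Products of representatives are then again
  representatives, so no correction terms, and hence no higher operations, arise.
  \<open>decomposition\<close> is stated in degree \<open>d + 1\<close> so that \<open>w\<close> has
  degree \<open>d\<close>.\<close>

locale dg_formal = dg_algebra +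
  fixes C :: "int \<Rightarrow> 'a set"
  assumes C_sub: "x \<in> C d \<Longrightarrow> x \<in> carrier (V d)"
    and C_add: "x \<in> C d \<Longrightarrow> y \<in> C d \<Longrightarrow> x \<oplus>\<^bsub>V d\<^esub> y \<in> C d"
    and C_smult: "x \<in> C d \<Longrightarrow> c \<odot>\<^bsub>V d\<^esub> x \<in> C d"
    and C_zero: "\<zero>\<^bsub>V d\<^esub> \<in> C d"
    and C_mu: "x \<in> C d \<Longrightarrow> y \<in> C e \<Longrightarrow> mu d x e y \<in> C (d + e)"
    and C_df: "x \<in> C d \<Longrightarrow> df d x = \<zero>\<^bsub>V (d + 1)\<^esub>"
    and decomposition: "x \<in> carrier (V (d + 1)) \<Longrightarrow> df (d + 1) x = \<zero>\<^bsub>V (d + 1 + 1)\<^esub> \<Longrightarrow>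
      \<exists>c \<in> C (d + 1). \<exists>w \<in> carrier (V d). x = df d w \<oplus>\<^bsub>V (d + 1)\<^esub> c"
    and C_exact: "w \<in> carrier (V d) \<Longrightarrow> df d w \<in> C (d + 1) \<Longrightarrow> df d w = \<zero>\<^bsub>V (d + 1)\<^esub>"
begin

definition B :: "int \<Rightarrow> 'a set" where "B d = df (d - 1) ` carrier (V (d - 1))"

lemma B_I: "w \<in> carrier (V d) \<Longrightarrow> df d w \<in> B (d + 1)" by (simp add: B_def)

lemma B_E:
  assumes "b \<in> B d"
  obtains w where "w \<in> carrier (V (d - 1))" "b = df (d - 1) w"
  using assms by (auto simp: B_def)

lemma B_sub: "b \<in> B d \<Longrightarrow> b \<in> carrier (V d)"
  using df_closed[of _ "d - 1"] by (auto simp: B_def)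

lemma B_add:
  assumes "b \<in> B d" "b' \<in> B d"
  shows "b \<oplus>\<^bsub>V d\<^esub> b' \<in> B d"
proof -
  obtain w w' where w: "w \<in> carrier (V (d - 1))" "b = df (d - 1) w" "w' \<in> carrier (V (d - 1))" "b' = df (d - 1) w'"
    using assms by (elim B_E)
  have "b \<oplus>\<^bsub>V d\<^esub> b' = df (d - 1) (w \<oplus>\<^bsub>V (d - 1)\<^esub> w')" using df_add[OF w(1,3)] w by simp
  then show ?thesis using B_I[OF V.a_closed[OF w(1,3)]] by simp
qed

lemma B_smult:
  assumes "b \<in> B d"
  shows "c \<odot>\<^bsub>V d\<^esub> b \<in> B d"
proof -
  obtain w where w: "w \<in> carrier (V (d - 1))" "b = df (d - 1) w" using assms by (elim B_E)
  have "c \<odot>\<^bsub>V d\<^esub> b = df (d - 1) (c \<odot>\<^bsub>V (d - 1)\<^esub> w)" using df_smult[OF w(1)] w by simp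
  then show ?thesis using B_I[OF V.smult_closed'[OF w(1)]] by simp
qed

lemma B_zero: "\<zero>\<^bsub>V d\<^esub> \<in> B d"
  unfolding B_def by (rule image_eqI[of _ _ "\<zero>\<^bsub>V (d - 1)\<^esub>"]) simp_all

lemma B_C: "b \<in> B d \<Longrightarrow> b \<in> C d \<Longrightarrow> b = \<zero>\<^bsub>V d\<^esub>"
  by (elim B_E) (use C_exact[of _ "d - 1"] in auto)

lemma decomp:
  assumes "x \<in> carrier (V d)" "df d x = \<zero>\<^bsub>V (d + 1)\<^esub>"
  obtains c b where "c \<in> C d" "b \<in> B d" "x = b \<oplus>\<^bsub>V d\<^esub> c"
  using decomposition[of x "d - 1"] assms B_I[of _ "d - 1"] by auto

definition cls :: "int \<Rightarrow> 'a \<Rightarrow> 'a set" where "cls d x = B d +>\<^bsub>V d\<^esub> x"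

lemma cls_iff: "y \<in> cls d x \<longleftrightarrow> (\<exists>b \<in> B d. y = b \<oplus>\<^bsub>V d\<^esub> x)"
  by (auto simp: cls_def a_r_coset_def')

lemma set_add_iff: "y \<in> G <+>\<^bsub>V d\<^esub> H \<longleftrightarrow> (\<exists>a \<in> G. \<exists>b \<in> H. y = a \<oplus>\<^bsub>V d\<^esub> b)"
  by (auto simp: set_add_def')

lemma cls_absorb:
  assumes "b \<in> B d" "x \<in> carrier (V d)"
  shows "cls d (b \<oplus>\<^bsub>V d\<^esub> x) = cls d x"
proof (intro subset_antisym subsetI)
  fix y assume "y \<in> cls d (b \<oplus>\<^bsub>V d\<^esub> x)"
  then obtain b' where "b' \<in> B d" "y = b' \<oplus>\<^bsub>V d\<^esub> (b \<oplus>\<^bsub>V d\<^esub> x)" unfolding cls_iff by blast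
  moreover from this have "y = (b' \<oplus>\<^bsub>V d\<^esub> b) \<oplus>\<^bsub>V d\<^esub> x" using assms B_sub by (simp add: V.a_assoc)
  ultimately show "y \<in> cls d x" unfolding cls_iff using B_add assms by blast
next
  fix y assume "y \<in> cls d x"
  then obtain b' where b': "b' \<in> B d" "y = b' \<oplus>\<^bsub>V d\<^esub> x" unfolding cls_iff by blast
  let ?c = "b' \<oplus>\<^bsub>V d\<^esub> (-1) \<odot>\<^bsub>V d\<^esub> b"
  have nb: "(-1) \<odot>\<^bsub>V d\<^esub> b \<oplus>\<^bsub>V d\<^esub> b = \<zero>\<^bsub>V d\<^esub>"
    using V.add_neg[OF B_sub[OF assms(1)]] B_sub[OF assms(1)] by (simp add: V.a_comm)
  have "?c \<oplus>\<^bsub>V d\<^esub> (b \<oplus>\<^bsub>V d\<^esub> x) = b' \<oplus>\<^bsub>V d\<^esub> (((-1) \<odot>\<^bsub>V d\<^esub> b \<oplus>\<^bsub>V d\<^esub> b) \<oplus>\<^bsub>V d\<^esub> x)"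
    using assms b'(1) B_sub by (simp add: V.a_assoc)
  also have "\<dots> = y" unfolding nb using assms b' by simp
  finally have "y = ?c \<oplus>\<^bsub>V d\<^esub> (b \<oplus>\<^bsub>V d\<^esub> x)" ..
  moreover have "?c \<in> B d" using B_add B_smult b' assms by blast
  ultimately show "y \<in> cls d (b \<oplus>\<^bsub>V d\<^esub> x)" unfolding cls_iff by blast
qed

lemma cls_add:
  assumes "x \<in> carrier (V d)" "y \<in> carrier (V d)"
  shows "cls d x <+>\<^bsub>V d\<^esub> cls d y = cls d (x \<oplus>\<^bsub>V d\<^esub> y)"
proof (intro subset_antisym subsetI)
  fix v assume "v \<in> cls d x <+>\<^bsub>V d\<^esub> cls d y"
  then obtain a a' where a: "a \<in> cls d x" "a' \<in> cls d y" "v = a \<oplus>\<^bsub>V d\<^esub> a'" unfolding set_add_iff by blast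
  then obtain b b' where b: "b \<in> B d" "b' \<in> B d" "v = (b \<oplus>\<^bsub>V d\<^esub> x) \<oplus>\<^bsub>V d\<^esub> (b' \<oplus>\<^bsub>V d\<^esub> y)"
    unfolding cls_iff by blast
  then have "v = (b \<oplus>\<^bsub>V d\<^esub> b') \<oplus>\<^bsub>V d\<^esub> (x \<oplus>\<^bsub>V d\<^esub> y)"
    using assms B_sub by (simp add: V.a_assoc V.a_lcomm)
  then show "v \<in> cls d (x \<oplus>\<^bsub>V d\<^esub> y)" unfolding cls_iff using B_add b by blast
next
  fix v assume "v \<in> cls d (x \<oplus>\<^bsub>V d\<^esub> y)"
  then obtain b where b: "b \<in> B d" "v = b \<oplus>\<^bsub>V d\<^esub> (x \<oplus>\<^bsub>V d\<^esub> y)" unfolding cls_iff by blast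
  then have "v = (b \<oplus>\<^bsub>V d\<^esub> x) \<oplus>\<^bsub>V d\<^esub> (\<zero>\<^bsub>V d\<^esub> \<oplus>\<^bsub>V d\<^esub> y)" using assms B_sub by (simp add: V.a_assoc)
  moreover have "b \<oplus>\<^bsub>V d\<^esub> x \<in> cls d x" "\<zero>\<^bsub>V d\<^esub> \<oplus>\<^bsub>V d\<^esub> y \<in> cls d y" unfolding cls_iff using b B_zero by blast+
  ultimately show "v \<in> cls d x <+>\<^bsub>V d\<^esub> cls d y" unfolding set_add_iff by blast
qed

lemma cls_smult:
  assumes "x \<in> carrier (V d)"
  shows "B d <+>\<^bsub>V d\<^esub> ((\<lambda>y. c \<odot>\<^bsub>V d\<^esub> y) ` cls d x) = cls d (c \<odot>\<^bsub>V d\<^esub> x)"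
proof (intro subset_antisym subsetI)
  fix v assume "v \<in> B d <+>\<^bsub>V d\<^esub> ((\<lambda>y. c \<odot>\<^bsub>V d\<^esub> y) ` cls d x)"
  then obtain b a where a: "b \<in> B d" "a \<in> cls d x" "v = b \<oplus>\<^bsub>V d\<^esub> c \<odot>\<^bsub>V d\<^esub> a"
    unfolding set_add_iff by blast
  then obtain b' where b: "b \<in> B d" "b' \<in> B d" "v = b \<oplus>\<^bsub>V d\<^esub> c \<odot>\<^bsub>V d\<^esub> (b' \<oplus>\<^bsub>V d\<^esub> x)"
    unfolding cls_iff by blast
  then have "v = (b \<oplus>\<^bsub>V d\<^esub> c \<odot>\<^bsub>V d\<^esub> b') \<oplus>\<^bsub>V d\<^esub> c \<odot>\<^bsub>V d\<^esub> x"
    using assms B_sub by (simp add: V.a_assoc V.smult_r_distr)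
  then show "v \<in> cls d (c \<odot>\<^bsub>V d\<^esub> x)" unfolding cls_iff using B_add B_smult b by blast
next
  fix v assume "v \<in> cls d (c \<odot>\<^bsub>V d\<^esub> x)"
  then obtain b where b: "b \<in> B d" "v = b \<oplus>\<^bsub>V d\<^esub> c \<odot>\<^bsub>V d\<^esub> x" unfolding cls_iff by blast
  then have "v = b \<oplus>\<^bsub>V d\<^esub> c \<odot>\<^bsub>V d\<^esub> (\<zero>\<^bsub>V d\<^esub> \<oplus>\<^bsub>V d\<^esub> x)" using assms by simp
  moreover have "\<zero>\<^bsub>V d\<^esub> \<oplus>\<^bsub>V d\<^esub> x \<in> cls d x" unfolding cls_iff using B_zero by blast
  ultimately show "v \<in> B d <+>\<^bsub>V d\<^esub> ((\<lambda>y. c \<odot>\<^bsub>V d\<^esub> y) ` cls d x)"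
    unfolding set_add_iff using b(1) by blast
qed

text \<open>The difference of two representatives of one class is a coboundary lying in
  \<open>C\<close>, hence 0.\<close>

lemma cls_inject:
  assumes "x \<in> C d" "y \<in> C d" "cls d x = cls d y"
  shows "x = y"
proof -
  have x: "x \<in> carrier (V d)" and y: "y \<in> carrier (V d)" using C_sub assms by auto
  have "x \<in> cls d x" unfolding cls_iff using B_zero x by (intro bexI[of _ "\<zero>\<^bsub>V d\<^esub>"]) auto
  then obtain b where b: "b \<in> B d" "x = b \<oplus>\<^bsub>V d\<^esub> y" unfolding assms(3) cls_iff by blast
  have "x \<oplus>\<^bsub>V d\<^esub> (-1) \<odot>\<^bsub>V d\<^esub> y = b"
    unfolding b(2) using V.add_neg[OF y] B_sub[OF b(1)] y by (simp add: V.a_assoc)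
  then have "x \<oplus>\<^bsub>V d\<^esub> (-1) \<odot>\<^bsub>V d\<^esub> y = \<zero>\<^bsub>V d\<^esub>"
    using B_C[OF b(1)] C_add C_smult assms(1,2) by metis
  then show ?thesis by (rule V.eq_of_add_neg[OF x y])
qed

abbreviation H :: "'a set gspace" where "H \<equiv> cohomology V ops"

lemma coboundaries_eq: "coboundaries V ops d = B d"
  by (simp add: coboundaries_def B_def)

lemma cocycles_iff: "x \<in> cocycles V ops d \<longleftrightarrow> x \<in> carrier (V d) \<and> df d x = \<zero>\<^bsub>V (d + 1)\<^esub>"
  by (simp add: cocycles_def)

lemma cohomology_class_eq: "cohomology_class V ops d x = cls d x"
  by (simp add: cohomology_class_def cls_def coboundaries_eq)

lemma H_ops:
  "\<zero>\<^bsub>H d\<^esub> = B d" "Q \<oplus>\<^bsub>H d\<^esub> Y = Q <+>\<^bsub>V d\<^esub> Y" "c \<odot>\<^bsub>H d\<^esub> Q = B d <+>\<^bsub>V d\<^esub> ((\<lambda>y. c \<odot>\<^bsub>V d\<^esub> y) ` Q)"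
  by (simp_all add: cohomology_def quotient_module_def coboundaries_eq set_add_def')

lemma cls_zero: "cls d \<zero>\<^bsub>V d\<^esub> = B d"
proof (intro subset_antisym subsetI)
  show "y \<in> B d" if "y \<in> cls d \<zero>\<^bsub>V d\<^esub>" for y using that B_sub unfolding cls_iff by auto
  show "y \<in> cls d \<zero>\<^bsub>V d\<^esub>" if "y \<in> B d" for y using that B_sub[OF that] unfolding cls_iff by (intro bexI[of _ y]) auto
qed

lemma carrier_H_cocycles: "carrier (H d) = cls d ` {x \<in> carrier (V d). df d x = \<zero>\<^bsub>V (d + 1)\<^esub>}"
  unfolding cohomology_def quotient_module_def coboundaries_eq cls_def
  by (auto simp: A_RCOSETS_def' a_r_coset_def' cocycles_iff)

lemma carrier_H: "carrier (H d) = cls d ` C d"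
proof
  show "carrier (H d) \<subseteq> cls d ` C d"
    unfolding carrier_H_cocycles using cls_absorb C_sub by (auto elim!: decomp)
  show "cls d ` C d \<subseteq> carrier (H d)"
    unfolding carrier_H_cocycles using C_sub C_df by auto
qed

lemma H_E:
  assumes "Q \<in> carrier (H d)"
  obtains x where "x \<in> C d" "Q = cls d x"
  using assms unfolding carrier_H by auto

definition rep :: "int \<Rightarrow> 'a set \<Rightarrow> 'a" where "rep d = inv_into (C d) (cls d)"

lemma rep_cls [simp]: "x \<in> C d \<Longrightarrow> rep d (cls d x) = x"
  unfolding rep_def by (rule inv_into_f_f) (auto simp: inj_on_def intro: cls_inject)

lemma H_simps:
  "x \<in> C d \<Longrightarrow> y \<in> C d \<Longrightarrow> cls d x \<oplus>\<^bsub>H d\<^esub> cls d y = cls d (x \<oplus>\<^bsub>V d\<^esub> y)"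
  "x \<in> C d \<Longrightarrow> c \<odot>\<^bsub>H d\<^esub> cls d x = cls d (c \<odot>\<^bsub>V d\<^esub> x)"
  "\<zero>\<^bsub>H d\<^esub> = cls d \<zero>\<^bsub>V d\<^esub>" "x \<in> C d \<Longrightarrow> cls d x \<in> carrier (H d)"
  using C_sub by (auto simp: H_ops cls_add cls_smult cls_zero carrier_H)

definition dfH :: "int \<Rightarrow> 'a set \<Rightarrow> 'a set" where "dfH d Q = \<zero>\<^bsub>H (d + 1)\<^esub>"
text \<open>The product is taken on the representatives in \<open>C\<close>, where the laws of
  \<open>mu\<close> hold without passing to classes. Its agreement with the product of arbitrary
  cocycles is \<open>muH_cls\<close>.\<close>

definition muH :: "int \<Rightarrow> 'a set \<Rightarrow> int \<Rightarrow> 'a set \<Rightarrow> 'a set" where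
  "muH d Q e Y = cls (d + e) (mu d (rep d Q) e (rep e Y))"

lemma module_H: "module complex_ring (H d)"
proof (rule module_transfer[OF vs, where \<phi> = "rep d"])
  show "inj_on (rep d) (carrier (H d))" by (auto simp: inj_on_def elim!: H_E)
  show "rep d ` carrier (H d) \<subseteq> carrier (V d)" using C_sub by (auto elim!: H_E)
  show "\<zero>\<^bsub>H d\<^esub> \<in> carrier (H d)" "rep d \<zero>\<^bsub>H d\<^esub> = \<zero>\<^bsub>V d\<^esub>" by (simp_all add: H_simps C_zero)
  show "Q \<oplus>\<^bsub>H d\<^esub> Y \<in> carrier (H d) \<and> rep d (Q \<oplus>\<^bsub>H d\<^esub> Y) = rep d Q \<oplus>\<^bsub>V d\<^esub> rep d Y"
    if "Q \<in> carrier (H d)" "Y \<in> carrier (H d)" for Q Y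
    using that by (elim H_E) (simp add: H_simps C_add)
  show "c \<odot>\<^bsub>H d\<^esub> Q \<in> carrier (H d) \<and> rep d (c \<odot>\<^bsub>H d\<^esub> Q) = c \<odot>\<^bsub>V d\<^esub> rep d Q"
    if "Q \<in> carrier (H d)" for c Q
    using that by (elim H_E) (simp add: H_simps C_smult)
qed

lemma dg_algebra_H: "dg_algebra H dfH muH"
proof -
  interpret H: cvs "H q" for q by (rule cvs.intro) (rule module_H)
  show ?thesis
  proof (rule dg_algebra.intro)
    show "module complex_ring (H d)" for d by (rule module_H)
  next
    show "muH d Q e Y \<in> carrier (H (d + e))" if "Q \<in> carrier (H d)" "Y \<in> carrier (H e)" for Q d Y e
      using that by (elim H_E) (simp add: muH_def H_simps C_mu)
  next
    show "muH (d + e) (muH d Q e Y) g Z = muH d Q (e + g) (muH e Y g Z)"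
      if "Q \<in> carrier (H d)" "Y \<in> carrier (H e)" "Z \<in> carrier (H g)" for Q d Y e Z g
      using that by (elim H_E) (simp add: muH_def C_mu mu_assoc C_sub add.assoc)
  next
    fix Q d Y e
    assume QY: "Q \<in> carrier (H d)" "Y \<in> carrier (H e)"
    have e: "d + 1 + e = d + e + 1" "d + (e + 1) = d + e + 1" by simp_all
    have "muH (d + 1) (dfH d Q) e Y = \<zero>\<^bsub>H (d + 1 + e)\<^esub>" "muH d Q (e + 1) (dfH e Y) = \<zero>\<^bsub>H (d + (e + 1))\<^esub>"
      using QY by (elim H_E; simp add: dfH_def muH_def H_simps C_zero C_sub)+
    then have "muH (d + 1) (dfH d Q) e Y = \<zero>\<^bsub>H (d + e + 1)\<^esub>" "muH d Q (e + 1) (dfH e Y) = \<zero>\<^bsub>H (d + e + 1)\<^esub>"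
      unfolding e .
    then show "dfH (d + e) (muH d Q e Y) = muH (d + 1) (dfH d Q) e Y \<oplus>\<^bsub>H (d + e + 1)\<^esub>
        (-1) powi d \<odot>\<^bsub>H (d + e + 1)\<^esub> muH d Q (e + 1) (dfH e Y)"
      by (simp add: dfH_def)
  qed (auto simp: dfH_def muH_def H_simps C_mu C_zero C_add C_smult C_sub mu_add_left mu_add_right mu_smult_left
      mu_smult_right mu_closed H.smult_0_right[unfolded H_simps] elim!: H_E)
qed

lemma dg_hom_rep: "dg_hom H dfH muH V df mu rep"
proof -
  interpret H: dg_algebra H dfH muH by (rule dg_algebra_H)
  show ?thesis
    by unfold_locales (auto simp: dfH_def muH_def H_simps C_mu C_zero C_add C_smult C_sub C_df elim!: H_E)
qed

lemma mu_B_left: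
  assumes "b \<in> B d" "y \<in> carrier (V e)" "df e y = \<zero>\<^bsub>V (e + 1)\<^esub>"
  shows "mu d b e y \<in> B (d + e)"
proof -
  obtain w where w: "w \<in> carrier (V (d - 1))" "b = df (d - 1) w" using assms(1) by (rule B_E)
  have c: "mu d b e y \<in> carrier (V (d + e))" using mu_closed[OF B_sub[OF assms(1)] assms(2)] .
  have "df (d - 1 + e) (mu (d - 1) w e y) = mu (d - 1 + 1) (df (d - 1) w) e y \<oplus>\<^bsub>V (d - 1 + e + 1)\<^esub>
        (-1) powi (d - 1) \<odot>\<^bsub>V (d - 1 + e + 1)\<^esub> mu (d - 1) w (e + 1) (df e y)"
    by (rule leibniz[OF w(1) assms(2)])
  moreover have "mu (d - 1) w (e + 1) (df e y) = \<zero>\<^bsub>V (d - 1 + e + 1)\<^esub>"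
    unfolding assms(3) using mu_zero_right[OF w(1), of "e + 1"] by (simp add: add.assoc)
  moreover have e: "d - 1 + e + 1 = d + e" "d - 1 + 1 = d" by simp_all
  ultimately have "df (d - 1 + e) (mu (d - 1) w e y) = mu d b e y" using c unfolding w(2)[symmetric] e by simp
  then show ?thesis using B_I[OF mu_closed[OF w(1) assms(2)]] unfolding e by simp
qed

text \<open>With \<open>b = df w\<close> the Leibniz rule expresses the differential of
  \<open>x w\<close> as \<open>(-1)^d\<close> times \<open>x b\<close>; the sign is its own inverse,
  so a scalar multiple gives \<open>x b\<close> itself.\<close>

lemma mu_B_right:
  assumes "b \<in> B e" "x \<in> carrier (V d)" "df d x = \<zero>\<^bsub>V (d + 1)\<^esub>"
  shows "mu d x e b \<in> B (d + e)"
proof -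
  obtain w where w: "w \<in> carrier (V (e - 1))" "b = df (e - 1) w" using assms(1) by (rule B_E)
  have c: "mu d x e b \<in> carrier (V (d + e))" using mu_closed[OF assms(2) B_sub[OF assms(1)]] .
  have "df (d + (e - 1)) (mu d x (e - 1) w) = mu (d + 1) (df d x) (e - 1) w \<oplus>\<^bsub>V (d + (e - 1) + 1)\<^esub>
        (-1) powi d \<odot>\<^bsub>V (d + (e - 1) + 1)\<^esub> mu d x (e - 1 + 1) (df (e - 1) w)"
    by (rule leibniz[OF assms(2) w(1)])
  moreover have "mu (d + 1) (df d x) (e - 1) w = \<zero>\<^bsub>V (d + (e - 1) + 1)\<^esub>"
    unfolding assms(3) using mu_zero_left[OF w(1), of "d + 1"] by (simp add: algebra_simps)
  moreover have e: "d + (e - 1) + 1 = d + e" "e - 1 + 1 = e" by simp_all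
  ultimately have "df (d + (e - 1)) (mu d x (e - 1) w) = (-1) powi d \<odot>\<^bsub>V (d + e)\<^esub> mu d x e b"
    using c unfolding w(2)[symmetric] e by simp
  moreover have "(-1) powi d \<odot>\<^bsub>V (d + e)\<^esub> ((-1) powi d \<odot>\<^bsub>V (d + e)\<^esub> mu d x e b) = mu d x e b"
    using c by (simp add: V.smult_assoc[symmetric] power_int_mult_distrib[symmetric])
  moreover have "df (d + (e - 1)) (mu d x (e - 1) w) \<in> B (d + e)" using B_I[OF mu_closed[OF assms(2) w(1)]] unfolding e .
  ultimately show ?thesis using B_smult by metis
qed

lemma cls_rep: "x \<in> carrier (V d) \<Longrightarrow> df d x = \<zero>\<^bsub>V (d + 1)\<^esub> \<Longrightarrow> \<exists>c \<in> C d. \<exists>b \<in> B d. x = b \<oplus>\<^bsub>V d\<^esub> c \<and> cls d x = cls d c"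
  using decomp cls_absorb C_sub by metis

lemma muH_cls:
  assumes x: "x \<in> carrier (V d)" "df d x = \<zero>\<^bsub>V (d + 1)\<^esub>" and y: "y \<in> carrier (V e)" "df e y = \<zero>\<^bsub>V (e + 1)\<^esub>"
  shows "muH d (cls d x) e (cls e y) = cls (d + e) (mu d x e y)"
proof -
  obtain c b where c: "c \<in> C d" "b \<in> B d" "x = b \<oplus>\<^bsub>V d\<^esub> c" "cls d x = cls d c" using cls_rep[OF x] by blast
  obtain c' b' where c': "c' \<in> C e" "b' \<in> B e" "y = b' \<oplus>\<^bsub>V e\<^esub> c'" "cls e y = cls e c'" using cls_rep[OF y] by blast
  have "mu d x e y = mu d b e y \<oplus>\<^bsub>V (d + e)\<^esub> (mu d c e b' \<oplus>\<^bsub>V (d + e)\<^esub> mu d c e c')"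
    using mu_add_left[OF B_sub[OF c(2)] C_sub[OF c(1)] y(1)] mu_add_right[OF C_sub[OF c(1)] B_sub[OF c'(2)] C_sub[OF c'(1)]]
    unfolding c(3)[symmetric] c'(3)[symmetric] by simp
  moreover have "mu d b e y \<in> B (d + e)" by (rule mu_B_left[OF c(2) y])
  moreover have "mu d c e b' \<in> B (d + e)" by (rule mu_B_right[OF c'(2) C_sub[OF c(1)] C_df[OF c(1)]])
  moreover have "mu d c e c' \<in> carrier (V (d + e))" using c(1) c'(1) C_mu C_sub by blast
  ultimately have "cls (d + e) (mu d x e y) = cls (d + e) (mu d c e c')"
    using cls_absorb B_sub V.a_closed by metis
  then show ?thesis unfolding muH_def c(4) c'(4) using c(1) c'(1) by simp
qed

text \<open>The quasi-isomorphism is the linear choice of representatives \<open>rep\<close>,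
  extended by 0 to longer tensors; it lifts the identity because \<open>rep d Q\<close> lies in the
  class \<open>Q\<close>.\<close>

lemma minimal_model_exists:
  "\<exists>m f. minimal_model V ops m f \<and>
    (\<forall>z \<in> tensors H. length z \<ge> 3 \<longrightarrow> m z = \<zero>\<^bsub>H (tensor_degree z + 2 - int (length z))\<^esub>)"
proof -
  interpret rep: dg_hom H dfH muH V df mu rep by (rule dg_hom_rep)
  let ?m = "dg_operations H dfH muH" and ?f = "strict_family V rep"
  have HB: "B d <+>\<^bsub>V d\<^esub> {x} = cls d x" for d x by (auto simp: set_add_iff cls_iff)
  have cob: "coboundaries H ?m d = {\<zero>\<^bsub>H d\<^esub>}" for d
    using rep.V.zero_closed[of "d - 1"] unfolding coboundaries_def by (auto simp: dfH_def)
  have coc: "cocycles H ?m d = carrier (H d)" for d unfolding cocycles_def by (auto simp: dfH_def)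
  \<comment> \<open>The differential on \<open>H\<close> is zero, so the cosets forming its
    cohomology are singletons \<open>{Q}\<close>. The map on cohomology then takes
    \<open>{Q}\<close> to the class of its representative, which is \<open>Q\<close>.\<close>
  have HH: "carrier (cohomology H ?m d) = (\<lambda>Q. {Q}) ` carrier (H d)" for d
  proof -
    have "{\<zero>\<^bsub>H d\<^esub>} +>\<^bsub>(H d)\<lparr>carrier := carrier (H d)\<rparr>\<^esub> Q = {Q}" if "Q \<in> carrier (H d)" for Q
      using that by (simp add: a_r_coset_def')
    then show ?thesis unfolding cohomology_def[of H] quotient_module_def cob coc by (auto simp: A_RCOSETS_def')
  qed
  have "bij_betw (\<lambda>Q. coboundaries V ops d <+>\<^bsub>V d\<^esub> ((\<lambda>x. ?f [(d, x)]) ` Q))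
        (carrier (cohomology H ?m d)) (carrier (H d))" for d
    unfolding HH coboundaries_eq bij_betw_def
  proof
    have *: "B d <+>\<^bsub>V d\<^esub> ((\<lambda>x. ?f [(d, x)]) ` {Q}) = Q" if "Q \<in> carrier (H d)" for Q
      using that by (elim H_E) (simp add: HB)
    show "inj_on (\<lambda>Q. B d <+>\<^bsub>V d\<^esub> ((\<lambda>x. ?f [(d, x)]) ` Q)) ((\<lambda>Q. {Q}) ` carrier (H d))"
    proof (rule inj_onI)
      fix Y Y' assume "Y \<in> (\<lambda>Q. {Q}) ` carrier (H d)" "Y' \<in> (\<lambda>Q. {Q}) ` carrier (H d)"
        and e: "B d <+>\<^bsub>V d\<^esub> ((\<lambda>x. ?f [(d, x)]) ` Y) = B d <+>\<^bsub>V d\<^esub> ((\<lambda>x. ?f [(d, x)]) ` Y')"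
      then obtain Q Q' where Q: "Q \<in> carrier (H d)" "Q' \<in> carrier (H d)" "Y = {Q}" "Y' = {Q'}" by blast
      show "Y = Y'" using e unfolding Q(3,4) *[OF Q(1)] *[OF Q(2)] by simp
    qed
    show "(\<lambda>Q. B d <+>\<^bsub>V d\<^esub> ((\<lambda>x. ?f [(d, x)]) ` Q)) ` ((\<lambda>Q. {Q}) ` carrier (H d)) = carrier (H d)"
    proof -
      have "(\<lambda>Q. B d <+>\<^bsub>V d\<^esub> ((\<lambda>x. ?f [(d, x)]) ` {Q})) ` carrier (H d) = (\<lambda>Q. Q) ` carrier (H d)"
        by (rule image_cong[OF refl]) (rule *)
      then show ?thesis unfolding image_image by simp
    qed
  qed
  then have "ainf_quasi_iso H ?m V ops ?f"
    unfolding ainf_quasi_iso_def using rep.ainf_morphism_F by blast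
  moreover have "?f [(d, Q)] \<in> cocycles V ops d \<and> cohomology_class V ops d (?f [(d, Q)]) = Q" if "Q \<in> carrier (H d)" for d Q
    using that by (elim H_E) (simp add: cocycles_iff cohomology_class_eq C_sub C_df)
  moreover have "?m [(d, cohomology_class V ops d x), (e, cohomology_class V ops e y)] =
        cohomology_class V ops (d + e) (ops [(d, x), (e, y)])"
    if "x \<in> cocycles V ops d" "y \<in> cocycles V ops e" for d e x y
    using that muH_cls by (simp add: cocycles_iff cohomology_class_eq)
  ultimately have "minimal_model V ops ?m ?f"
    unfolding minimal_model_def using rep.V.ainf_algebra_ops by (simp add: dfH_def)
  then show ?thesis using dg_operations_long by blast
qed

end

section \<open>Endomorphisms of the resolutions in coordinates\<close>

context one_wedge
begin

lemma RT_abelian: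
  assumes ms: "set ms \<subseteq> ws"
  shows "abelian_group (RT ms i)"
proof (rule abelian_groupI)
  fix x y z assume x: "x \<in> carrier (RT ms i)" and y: "y \<in> carrier (RT ms i)" and z: "z \<in> carrier (RT ms i)"
  show "x \<oplus>\<^bsub>RT ms i\<^esub> y \<oplus>\<^bsub>RT ms i\<^esub> z = x \<oplus>\<^bsub>RT ms i\<^esub> (y \<oplus>\<^bsub>RT ms i\<^esub> z)"
    unfolding RT_ops by (rule restrict_ext) (simp add: add.assoc)
next
  fix x y assume x: "x \<in> carrier (RT ms i)" and y: "y \<in> carrier (RT ms i)"
  show "x \<oplus>\<^bsub>RT ms i\<^esub> y \<in> carrier (RT ms i)"
    using x y unfolding carrier_RT[OF ms] RT_ops by (simp add: PiE_iff Pc_add)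
  show "x \<oplus>\<^bsub>RT ms i\<^esub> y = y \<oplus>\<^bsub>RT ms i\<^esub> x"
    unfolding RT_ops by (rule restrict_ext) (simp add: add.commute)
next
  fix x assume x: "x \<in> carrier (RT ms i)"
  show "\<zero>\<^bsub>RT ms i\<^esub> \<oplus>\<^bsub>RT ms i\<^esub> x = x"
    by (rule RT_eqI[OF _ x ms]) (use x in \<open>simp_all add: carrier_RT[OF ms] RT_ops PiE_iff\<close>)
  show "\<exists>y\<in>carrier (RT ms i). y \<oplus>\<^bsub>RT ms i\<^esub> x = \<zero>\<^bsub>RT ms i\<^esub>"
  proof
    show "(\<lambda>k \<in> {..<length ms}. 0 - x k) \<in> carrier (RT ms i)"
      using x unfolding carrier_RT[OF ms] by (simp add: PiE_iff Pc_diff[OF Pc_zero, simplified])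
    show "(\<lambda>k \<in> {..<length ms}. 0 - x k) \<oplus>\<^bsub>RT ms i\<^esub> x = \<zero>\<^bsub>RT ms i\<^esub>"
      unfolding RT_ops by (rule restrict_ext) simp
  qed
qed (rule RT_zero_closed[OF ms])

lemma RT_minus:
  assumes ms: "set ms \<subseteq> ws" and x: "x \<in> carrier (RT ms i)" and y: "y \<in> carrier (RT ms i)"
  shows "x \<ominus>\<^bsub>RT ms i\<^esub> y = (\<lambda>k \<in> {..<length ms}. x k - y k)"
proof -
  interpret abelian_group "RT ms i" by (rule RT_abelian[OF ms])
  have n: "(\<lambda>k \<in> {..<length ms}. 0 - y k) \<in> carrier (RT ms i)"
    using y unfolding carrier_RT[OF ms] by (simp add: PiE_iff Pc_diff[OF Pc_zero, simplified])
  have "(\<lambda>k \<in> {..<length ms}. 0 - y k) \<oplus>\<^bsub>RT ms i\<^esub> y = \<zero>\<^bsub>RT ms i\<^esub>"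
    unfolding RT_ops by (rule restrict_ext) simp
  then have "\<ominus>\<^bsub>RT ms i\<^esub> y = (\<lambda>k \<in> {..<length ms}. 0 - y k)" using minus_equality n y by blast
  then show ?thesis unfolding a_minus_def RT_ops by (auto intro!: restrict_ext)
qed

text \<open>Scalars act on homomorphism spaces through multiples of the unit of \<open>K\<close>, so
  the unit law enters every computation with \<open>scale\<close>.\<close>

lemma one_Kh: "v \<in> carrier Kh \<Longrightarrow> \<one>\<^bsub>Kh\<^esub> \<star> v = v"
proof -
  assume v: "v \<in> carrier Kh"
  have one: "\<one>\<^bsub>Kh\<^esub> b = (\<Sum>\<kappa> \<in> ws. if b = (\<kappa>, \<kappa>, \<kappa>) then 1 else 0)" for b
    by (simp add: Kh_def khovanov_def basis_vec_def ws_def)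
  have fin: "finite ws" unfolding ws_def by (rule finite_weights)
  have E: "\<one>\<^bsub>Kh\<^esub> (eE i) = 1" if "i \<le> N" for i
  proof -
    have "\<one>\<^bsub>Kh\<^esub> (eE i) = (\<Sum>\<kappa> \<in> ws. if wt i = \<kappa> then 1 else 0)"
      unfolding one by (rule sum.cong) (auto simp: diag_def)
    then show ?thesis using that fin by simp
  qed
  have "\<one>\<^bsub>Kh\<^esub> b = 0" if "\<And>i. b \<noteq> eE i" for b
    unfolding one
  proof (intro sum.neutral ballI)
    fix \<kappa> assume "\<kappa> \<in> ws"
    then obtain i where "\<kappa> = wt i" unfolding ws_def weights_eq by blast
    then show "(if b = (\<kappa>, \<kappa>, \<kappa>) then 1 else 0) = (0 :: complex)" using that[of i] by (simp add: diag_def)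
  qed
  then have Z: "\<one>\<^bsub>Kh\<^esub> (eX i) = 0" "\<one>\<^bsub>Kh\<^esub> (eU i) = 0" "\<one>\<^bsub>Kh\<^esub> (eV i) = 0" if "i < N" for i
    using that by (auto simp: diag_def) (metis wt_inject Suc_leI less_imp_le n_not_Suc_n)+
  show ?thesis
    by (rule kvec_eqI) (use v E Z in \<open>auto simp: kmul_simps carrier_khovanov\<close>)
qed

lemma scale_RT:
  assumes "x \<in> carrier (RT ms i)" "set ms \<subseteq> ws"
  shows "scale Kh (RT ms i) c x = (\<lambda>k \<in> {..<length ms}. scl c (x k))"
proof -
  have e: "(c \<odot>\<^bsub>Kh\<^esub> \<one>\<^bsub>Kh\<^esub>) = scl c \<one>\<^bsub>Kh\<^esub>"
    by (simp add: Kh_def khovanov_def scl_def)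
  have "x k \<in> carrier Kh" if "k < length ms" for k
    using assms that Pc_carrier unfolding carrier_RT[OF assms(2)] by (auto simp: PiE_iff)
  then show ?thesis unfolding scale_def RT_ops e by (intro restrict_ext) (simp add: one_Kh)
qed

end

locale resolutions = one_wedge +
  fixes W :: "weight \<Rightarrow> int \<Rightarrow> weight list"
    and D :: "weight \<Rightarrow> int \<Rightarrow> (nat \<Rightarrow> kvec) \<Rightarrow> (nat \<Rightarrow> kvec)"
  assumes resolutions: "\<forall>\<kappa> \<in> weights N 1. linear_resolution N 1 \<kappa> (W \<kappa>) (D \<kappa>)"
begin

lemma ws_idx: "\<kappa> \<in> ws \<Longrightarrow> idx \<kappa> \<le> N \<and> \<kappa> = wt (idx \<kappa>)"
  unfolding ws_def weights_eq by auto

lemma resolution_at: "\<kappa> \<in> ws \<Longrightarrow> resolution N (idx \<kappa>) (W \<kappa>) (D \<kappa>)"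
  using resolutions ws_idx[of \<kappa>] unfolding ws_def
  by (intro resolution.intro) (simp, metis)

text \<open>The resolution of the cell module at \<open>\<kappa>\<close> has the term \<open>K e\<^sub>i\<close>, \<open>i = vert \<kappa> p\<close>, in the \<open>active\<close> degrees
  \<open>p\<close>, and zero in the others.\<close>

definition active :: "weight \<Rightarrow> int \<Rightarrow> bool" where "active \<kappa> p \<longleftrightarrow> \<kappa> \<in> ws \<and> 0 \<le> p \<and> p \<le> int (idx \<kappa>)"
definition vert :: "weight \<Rightarrow> int \<Rightarrow> nat" where "vert \<kappa> p = nat (int (idx \<kappa>) - p)"
definition gen_idem :: "weight \<Rightarrow> int \<Rightarrow> kvec" where "gen_idem \<kappa> p = (if active \<kappa> p then bE (vert \<kappa> p) else 0)"
abbreviation R :: "weight \<Rightarrow> int \<Rightarrow> (kvec, nat \<Rightarrow> kvec) graded_module" where "R \<kappa> p \<equiv> RT (W \<kappa> p) p"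

lemma W_form: "\<kappa> \<in> ws \<Longrightarrow> W \<kappa> p = (if active \<kappa> p then [wt (vert \<kappa> p)] else [])"
  using resolution.W_eq[OF resolution_at, of \<kappa> p] by (simp add: active_def vert_def)

lemma vert_le: "active \<kappa> p \<Longrightarrow> vert \<kappa> p \<le> N"
  using ws_idx[of \<kappa>] by (auto simp: active_def vert_def)

lemma W_set: "\<kappa> \<in> ws \<Longrightarrow> set (W \<kappa> p) \<subseteq> ws"
  using vert_le by (auto simp: W_form)

lemma carrier_R: "\<kappa> \<in> ws \<Longrightarrow> carrier (R \<kappa> p) = {x. x \<in> extensional {..<length (W \<kappa> p)} \<and> (active \<kappa> p \<longrightarrow> x 0 \<star> gen_idem \<kappa> p = x 0)}"
proof -
  assume \<kappa>: "\<kappa> \<in> ws"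
  show ?thesis
  proof (cases "active \<kappa> p")
    case True
    then have w: "W \<kappa> p = [wt (vert \<kappa> p)]" using W_form[OF \<kappa>] by simp
    have e: "{..<length [wt (vert \<kappa> p)]} = {0}" by auto
    show ?thesis unfolding carrier_RT[OF W_set[OF \<kappa>]] unfolding w e
      using True by (simp add: PiE_def Pi_def Pc_def gen_idem_def set_eq_iff conj_commute)
  next
    case False
    then have w: "W \<kappa> p = []" using W_form[OF \<kappa>] by simp
    show ?thesis unfolding carrier_RT[OF W_set[OF \<kappa>]] unfolding w using False by simp
  qed
qed

lemma R_intro: "\<kappa> \<in> ws \<Longrightarrow> v \<star> gen_idem \<kappa> p = v \<Longrightarrow> (\<lambda>i \<in> {..<length (W \<kappa> p)}. v) \<in> carrier (R \<kappa> p)"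
proof -
  assume a: "\<kappa> \<in> ws" "v \<star> gen_idem \<kappa> p = v"
  show ?thesis unfolding carrier_R[OF a(1)] using a by (simp add: W_form)
qed

text \<open>Homomorphisms between projectives are right multiplications. Component \<open>(\<kappa>, \<mu>, p)\<close> of a family
  of coordinates determines the map from term \<open>p\<close> of the resolution at \<open>\<kappa>\<close> to the one at \<open>\<mu>\<close>.\<close>

definition peirce :: "weight \<Rightarrow> int \<Rightarrow> weight \<Rightarrow> int \<Rightarrow> kvec set" where
  "peirce \<kappa> p \<mu> q = {y. gen_idem \<kappa> p \<star> y = y \<and> y \<star> gen_idem \<mu> q = y}"

definition rmult :: "weight \<Rightarrow> int \<Rightarrow> weight \<Rightarrow> int \<Rightarrow> kvec \<Rightarrow> (nat \<Rightarrow> kvec) \<Rightarrow> (nat \<Rightarrow> kvec)" where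
  "rmult \<kappa> p \<mu> q y = (\<lambda>x \<in> carrier (R \<kappa> p). \<lambda>i \<in> {..<length (W \<mu> q)}. x 0 \<star> y)"

text \<open>As \<open>gen_idem\<close> is 0 in inactive degrees, the Peirce component shrinks to 0
  together with the term of the resolution, and the same formulas serve inside and outside the
  resolution.\<close>

lemma peirce_inactive: "y \<in> peirce \<kappa> p \<mu> q \<Longrightarrow> \<not> active \<kappa> p \<or> \<not> active \<mu> q \<Longrightarrow> y = 0"
  by (auto simp: peirce_def gen_idem_def)

lemma peirce_zero: "0 \<in> peirce \<kappa> p \<mu> q" by (simp add: peirce_def)
lemma peirce_add: "x \<in> peirce \<kappa> p \<mu> q \<Longrightarrow> y \<in> peirce \<kappa> p \<mu> q \<Longrightarrow> x + y \<in> peirce \<kappa> p \<mu> q"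
  by (simp add: peirce_def kmul_add_left kmul_add_right)
lemma peirce_diff: "x \<in> peirce \<kappa> p \<mu> q \<Longrightarrow> y \<in> peirce \<kappa> p \<mu> q \<Longrightarrow> x - y \<in> peirce \<kappa> p \<mu> q"
  by (simp add: peirce_def kmul_diff_left kmul_diff_right)
lemma peirce_scl: "x \<in> peirce \<kappa> p \<mu> q \<Longrightarrow> scl c x \<in> peirce \<kappa> p \<mu> q" by (simp add: peirce_def)
lemma peirce_mul: "x \<in> peirce \<kappa> p \<mu> q \<Longrightarrow> y \<in> peirce \<mu> q \<nu> s \<Longrightarrow> x \<star> y \<in> peirce \<kappa> p \<nu> s"
  unfolding peirce_def by (simp add: kmul_assoc) (metis kmul_assoc)
lemma peirce_sum: "(\<And>i. i \<in> I \<Longrightarrow> f i \<in> peirce \<kappa> p \<mu> q) \<Longrightarrow> sum f I \<in> peirce \<kappa> p \<mu> q"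
  unfolding peirce_def by (simp add: kmul_sum_left kmul_sum_right)

lemma rmult_apply: "x \<in> carrier (R \<kappa> p) \<Longrightarrow> rmult \<kappa> p \<mu> q y x = (\<lambda>i \<in> {..<length (W \<mu> q)}. x 0 \<star> y)"
  by (simp add: rmult_def)

lemma rmult_closed: "\<mu> \<in> ws \<Longrightarrow> y \<in> peirce \<kappa> p \<mu> q \<Longrightarrow> x \<in> carrier (R \<kappa> p) \<Longrightarrow> rmult \<kappa> p \<mu> q y x \<in> carrier (R \<mu> q)"
  unfolding rmult_apply by (rule R_intro) (simp_all add: kmul_assoc peirce_def)

text \<open>Composing right multiplications multiplies the elements in the order of application. If
  the middle term is inactive, the intermediate value has no entry at index 0; then
  \<open>z = 0\<close> and both sides vanish.\<close>

lemma rmult_comp: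
  assumes "\<mu> \<in> ws" "y \<in> peirce \<kappa> p \<mu> q" "z \<in> peirce \<mu> q \<nu> s" "x \<in> carrier (R \<kappa> p)"
  shows "rmult \<mu> q \<nu> s z (rmult \<kappa> p \<mu> q y x) = (\<lambda>i \<in> {..<length (W \<nu> s)}. x 0 \<star> (y \<star> z))"
proof -
  have "(rmult \<kappa> p \<mu> q y x) 0 \<star> z = x 0 \<star> (y \<star> z)"
  proof (cases "active \<mu> q")
    case True
    then show ?thesis using assms by (simp add: rmult_apply W_form kmul_assoc)
  next
    case False
    then show ?thesis using peirce_inactive[OF assms(3)] by simp
  qed
  then show ?thesis by (simp add: rmult_apply[OF rmult_closed[OF assms(1,2,4)]])
qed

lemma rmult_hom:
  assumes "\<kappa> \<in> ws" "\<mu> \<in> ws" "y \<in> peirce \<kappa> p \<mu> q"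
  shows "rmult \<kappa> p \<mu> q y \<in> homs Kh (R \<kappa> p) (R \<mu> q)"
proof -
  interpret abelian_group "R \<kappa> p" by (rule RT_abelian[OF W_set[OF assms(1)]])
  have y0: "y = 0" if "\<not> active \<kappa> p" using peirce_inactive[OF assms(3)] that by simp
  have sm: "a \<odot>\<^bsub>R \<kappa> p\<^esub> x \<in> carrier (R \<kappa> p)" if "x \<in> carrier (R \<kappa> p)" for a x
    using that assms(1) unfolding RT_ops carrier_R[OF assms(1)] by (simp add: W_form kmul_assoc)
  show ?thesis unfolding homs_def
  proof (intro CollectI conjI ballI)
    show "rmult \<kappa> p \<mu> q y \<in> carrier (R \<kappa> p) \<rightarrow>\<^sub>E carrier (R \<mu> q)"
      using rmult_closed[OF assms(2,3)] by (simp add: PiE_iff rmult_def)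
  next
    fix x x' assume x: "x \<in> carrier (R \<kappa> p)" "x' \<in> carrier (R \<kappa> p)"
    show "rmult \<kappa> p \<mu> q y (x \<oplus>\<^bsub>R \<kappa> p\<^esub> x') = rmult \<kappa> p \<mu> q y x \<oplus>\<^bsub>R \<mu> q\<^esub> rmult \<kappa> p \<mu> q y x'"
      unfolding rmult_apply[OF x(1)] rmult_apply[OF x(2)] rmult_apply[OF a_closed[OF x]] unfolding RT_ops
      using y0 assms(1) by (cases "active \<kappa> p") (auto simp: W_form kmul_add_left intro!: restrict_ext)
  next
    fix a x assume x: "x \<in> carrier (R \<kappa> p)"
    show "rmult \<kappa> p \<mu> q y (a \<odot>\<^bsub>R \<kappa> p\<^esub> x) = a \<odot>\<^bsub>R \<mu> q\<^esub> rmult \<kappa> p \<mu> q y x"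
      unfolding rmult_apply[OF x] rmult_apply[OF sm[OF x]] unfolding RT_ops
      using y0 assms(1) by (cases "active \<kappa> p") (auto simp: W_form kmul_assoc intro!: restrict_ext)
  qed
qed

text \<open>The element is the image of the generator, by \<open>hom_expand\<close> for one summand
  on each side. If one of the two terms is the zero module, index 0 carries no information and the
  element is set to 0.\<close>

lemma hom_rmult:
  assumes "\<kappa> \<in> ws" "\<mu> \<in> ws" and f: "f \<in> homs Kh (R \<kappa> p) (R \<mu> q)"
  defines "y \<equiv> (if active \<kappa> p \<and> active \<mu> q then f (gen (W \<kappa> p) 0) 0 else 0)"
  shows "f = rmult \<kappa> p \<mu> q y" "y \<in> peirce \<kappa> p \<mu> q"
proof -
  have ex: "f x 0 = (if active \<kappa> p then x 0 \<star> f (gen (W \<kappa> p) 0) 0 else 0)"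
    if "x \<in> carrier (R \<kappa> p)" "active \<mu> q" for x
    using hom_expand[OF W_set[OF assms(1)] f that(1), of 0] that(2) assms(1,2) by (simp add: W_form)
  have fc: "f x \<in> carrier (R \<mu> q)" if "x \<in> carrier (R \<kappa> p)" for x using homsD(1)[OF f that] .
  show y: "y \<in> peirce \<kappa> p \<mu> q"
  proof (cases "active \<kappa> p \<and> active \<mu> q")
    case True
    have g: "gen (W \<kappa> p) 0 \<in> carrier (R \<kappa> p)" by (rule gen_carrier[OF W_set[OF assms(1)]])
    have "f (gen (W \<kappa> p) 0) 0 = gen_idem \<kappa> p \<star> f (gen (W \<kappa> p) 0) 0"
      using ex[OF g] True assms(1) by (simp add: gen_def W_form gen_idem_def)
    moreover have "f (gen (W \<kappa> p) 0) 0 \<star> gen_idem \<mu> q = f (gen (W \<kappa> p) 0) 0"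
      using fc[OF g] True by (simp add: carrier_R[OF assms(2)])
    ultimately show ?thesis using True by (simp add: y_def peirce_def)
  qed (auto simp: y_def peirce_zero)
  have fe: "f \<in> extensional (carrier (R \<kappa> p))" using f by (simp add: homs_def PiE_iff)
  show "f = rmult \<kappa> p \<mu> q y"
  proof (rule extensionalityI[OF fe])
    show "rmult \<kappa> p \<mu> q y \<in> extensional (carrier (R \<kappa> p))" by (simp add: rmult_def)
    fix x assume x: "x \<in> carrier (R \<kappa> p)"
    show "f x = rmult \<kappa> p \<mu> q y x"
    proof (rule RT_eqI[OF fc[OF x] rmult_closed[OF assms(2) y x] W_set[OF assms(2)]])
      fix k assume k: "k < length (W \<mu> q)"
      then have "active \<mu> q" "k = 0" using assms(2) by (auto simp: W_form split: if_splits)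
      then show "f x k = rmult \<kappa> p \<mu> q y x k" using ex[OF x] k by (simp add: rmult_apply[OF x] y_def)
    qed
  qed
qed

lemma rmult_inject:
  assumes "\<kappa> \<in> ws" "\<mu> \<in> ws" "y \<in> peirce \<kappa> p \<mu> q" "y' \<in> peirce \<kappa> p \<mu> q" "rmult \<kappa> p \<mu> q y = rmult \<kappa> p \<mu> q y'"
  shows "y = y'"
proof (cases "active \<kappa> p \<and> active \<mu> q")
  case True
  have g: "gen (W \<kappa> p) 0 \<in> carrier (R \<kappa> p)" by (rule gen_carrier[OF W_set[OF assms(1)]])
  have "rmult \<kappa> p \<mu> q v (gen (W \<kappa> p) 0) 0 = v" if "v \<in> peirce \<kappa> p \<mu> q" for v
    unfolding rmult_apply[OF g] using that True assms(1,2) by (simp add: gen_def W_form peirce_def gen_idem_def)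
  then show ?thesis using assms(3-5) by metis
next
  case False
  then show ?thesis using peirce_inactive assms(3,4) by metis
qed

section \<open>Coordinates of the endomorphism algebra\<close>

definition coords :: "int \<Rightarrow> (weight \<times> weight \<times> int \<Rightarrow> kvec) set" where
  "coords r = {y. \<forall>\<kappa> \<mu> p. y (\<kappa>, \<mu>, p) \<in> peirce \<kappa> p \<mu> (p - r)}"

definition of_coords :: "int \<Rightarrow> (weight \<times> weight \<times> int \<Rightarrow> kvec) \<Rightarrow> endo" where
  "of_coords r y = (\<lambda>(\<kappa>, \<mu>, p) \<in> ws \<times> ws \<times> UNIV. rmult \<kappa> p \<mu> (p - r) (y (\<kappa>, \<mu>, p)))"

definition As :: "int \<Rightarrow> (complex, endo) module" where "As r = endo_space N 1 W r"
definition dA :: "int \<Rightarrow> endo \<Rightarrow> endo" where "dA = endo_diff N 1 W D"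
definition mA :: "int \<Rightarrow> endo \<Rightarrow> int \<Rightarrow> endo \<Rightarrow> endo" where "mA = endo_mult N 1 W"

lemma As_eq: "As r = product_module (ws \<times> ws \<times> UNIV) (\<lambda>(\<kappa>, \<mu>, p). hom_space Kh (R \<kappa> p) (R \<mu> (p - r)))"
  unfolding As_def endo_space_def ws_def[symmetric] Kh_def[symmetric] rterm_def[symmetric] resolution_term_RT ..

lemma coords_D: "y \<in> coords r \<Longrightarrow> y (\<kappa>, \<mu>, p) \<in> peirce \<kappa> p \<mu> (p - r)" by (simp add: coords_def)

text \<open>Coordinates are indexed by all triples, including those with lists that are not weights;
  the Peirce condition forces 0 there, which makes \<open>of_coords\<close> injective.\<close>

lemma coords_outside: "y \<in> coords r \<Longrightarrow> \<kappa> \<notin> ws \<or> \<mu> \<notin> ws \<Longrightarrow> y (\<kappa>, \<mu>, p) = 0"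
  using peirce_inactive[OF coords_D] by (auto simp: active_def)

lemma carrier_As: "carrier (As r) = of_coords r ` coords r"
proof (intro subset_antisym subsetI)
  fix f assume "f \<in> carrier (As r)"
  then have f: "f \<in> (\<Pi>\<^sub>E i \<in> ws \<times> ws \<times> UNIV. carrier ((\<lambda>(\<kappa>, \<mu>, p). hom_space Kh (R \<kappa> p) (R \<mu> (p - r))) i))"
    by (simp add: As_eq product_module_def)
  have fh: "f (\<kappa>, \<mu>, p) \<in> homs Kh (R \<kappa> p) (R \<mu> (p - r))" if "\<kappa> \<in> ws" "\<mu> \<in> ws" for \<kappa> \<mu> p
    using PiE_mem[OF f, of "(\<kappa>, \<mu>, p)"] that by (simp add: hom_space_def)
  have "\<exists>v. v \<in> peirce \<kappa> p \<mu> (p - r) \<and> (\<kappa> \<in> ws \<longrightarrow> \<mu> \<in> ws \<longrightarrow> f (\<kappa>, \<mu>, p) = rmult \<kappa> p \<mu> (p - r) v)" for \<kappa> \<mu> p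
    using hom_rmult[OF _ _ fh, of \<kappa> \<mu> p] peirce_zero by blast
  note ex = this
  define y where "y \<kappa> \<mu> p = (SOME v. v \<in> peirce \<kappa> p \<mu> (p - r) \<and> (\<kappa> \<in> ws \<longrightarrow> \<mu> \<in> ws \<longrightarrow> f (\<kappa>, \<mu>, p) = rmult \<kappa> p \<mu> (p - r) v))"
    for \<kappa> \<mu> p
  have y: "y \<kappa> \<mu> p \<in> peirce \<kappa> p \<mu> (p - r)" "\<kappa> \<in> ws \<Longrightarrow> \<mu> \<in> ws \<Longrightarrow> f (\<kappa>, \<mu>, p) = rmult \<kappa> p \<mu> (p - r) (y \<kappa> \<mu> p)" for \<kappa> \<mu> p
    using someI_ex[OF ex[of \<kappa> p \<mu>]] unfolding y_def by blast+
  show "f \<in> of_coords r ` coords r"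
  proof (rule image_eqI)
    show "(\<lambda>(\<kappa>, \<mu>, p). y \<kappa> \<mu> p) \<in> coords r" using y(1) by (simp add: coords_def)
    have "f \<in> extensional (ws \<times> ws \<times> UNIV)" using f by (simp add: PiE_iff)
    then show "f = of_coords r (\<lambda>(\<kappa>, \<mu>, p). y \<kappa> \<mu> p)"
      by (rule extensionalityI) (auto simp: of_coords_def y(2))
  qed
next
  fix f assume "f \<in> of_coords r ` coords r"
  then show "f \<in> carrier (As r)"
    by (auto simp: As_eq product_module_def hom_space_def of_coords_def coords_D intro!: rmult_hom)
qed

lemma of_coords_inject:
  assumes "y \<in> coords r" "z \<in> coords r" "of_coords r y = of_coords r z"
  shows "y = z"
proof
  fix i :: "weight \<times> weight \<times> int"
  obtain \<kappa> \<mu> p where i: "i = (\<kappa>, \<mu>, p)" by (metis surj_pair)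
  show "y i = z i"
  proof (cases "\<kappa> \<in> ws \<and> \<mu> \<in> ws")
    case True
    have "rmult \<kappa> p \<mu> (p - r) (y i) = rmult \<kappa> p \<mu> (p - r) (z i)"
      using fun_cong[OF assms(3), of i] True by (simp add: of_coords_def i)
    then show ?thesis using rmult_inject True assms(1,2)[THEN coords_D] unfolding i by blast
  next
    case False
    then show ?thesis using assms(1,2)[THEN coords_outside] unfolding i by metis
  qed
qed

definition scl_coords :: "complex \<Rightarrow> (weight \<times> weight \<times> int \<Rightarrow> kvec) \<Rightarrow> (weight \<times> weight \<times> int \<Rightarrow> kvec)" where
  "scl_coords c y = (\<lambda>i. scl c (y i))"

lemma coords_zero: "0 \<in> coords r" by (simp add: coords_def peirce_zero)
lemma coords_add: "y \<in> coords r \<Longrightarrow> z \<in> coords r \<Longrightarrow> y + z \<in> coords r" by (simp add: coords_def peirce_add)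
lemma coords_scl_coords: "y \<in> coords r \<Longrightarrow> scl_coords c y \<in> coords r" by (simp add: coords_def scl_coords_def peirce_scl)

lemma of_coords_zero: "\<zero>\<^bsub>As r\<^esub> = of_coords r 0"
  unfolding As_eq product_module_def hom_space_def of_coords_def
  by (auto intro!: restrict_ext simp: rmult_def RT_ops)

lemma of_coords_add:
  assumes "y \<in> coords r" "z \<in> coords r"
  shows "of_coords r y \<oplus>\<^bsub>As r\<^esub> of_coords r z = of_coords r (y + z)"
  unfolding As_eq product_module_def hom_space_def of_coords_def
  by (auto intro!: restrict_ext simp: rmult_def RT_ops kmul_add_right)

lemma of_coords_smult:
  assumes "y \<in> coords r"
  shows "c \<odot>\<^bsub>As r\<^esub> of_coords r y = of_coords r (scl_coords c y)"
proof -
  have "scale Kh (R \<mu> (p - r)) c (rmult \<kappa> p \<mu> (p - r) (y (\<kappa>, \<mu>, p)) x) = rmult \<kappa> p \<mu> (p - r) (scl_coords c y (\<kappa>, \<mu>, p)) x"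
    if "\<kappa> \<in> ws" "\<mu> \<in> ws" "x \<in> carrier (R \<kappa> p)" for \<kappa> \<mu> p x
    unfolding scale_RT[OF rmult_closed[OF that(2) coords_D[OF assms] that(3)] W_set[OF that(2)]]
    using that by (auto simp: rmult_apply scl_coords_def intro!: restrict_ext)
  then show ?thesis
    unfolding As_eq product_module_def hom_space_def
    by (auto simp: of_coords_def intro!: restrict_ext) (auto simp: rmult_def intro!: restrict_ext)
qed

lemma As_E:
  assumes "f \<in> carrier (As r)"
  obtains y where "y \<in> coords r" "f = of_coords r y"
  using assms unfolding carrier_As by auto

definition to_coords :: "int \<Rightarrow> endo \<Rightarrow> (weight \<times> weight \<times> int \<Rightarrow> kvec)" where "to_coords r = inv_into (coords r) (of_coords r)"

lemma to_coords_of_coords [simp]: "y \<in> coords r \<Longrightarrow> to_coords r (of_coords r y) = y"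
  unfolding to_coords_def by (rule inv_into_f_f) (auto simp: inj_on_def intro: of_coords_inject)

lemma of_coords_closed: "y \<in> coords r \<Longrightarrow> of_coords r y \<in> carrier (As r)"
  unfolding carrier_As by simp

text \<open>All functions, without Peirce conditions: one ambient vector space into which the
  components of all degrees embed.\<close>

definition coord_module :: "(complex, weight \<times> weight \<times> int \<Rightarrow> kvec) module" where
  "coord_module = \<lparr>carrier = UNIV, monoid.mult = undefined, one = undefined, ring.zero = 0, add = (+), module.smult = scl_coords\<rparr>"

lemma module_coord: "module complex_ring coord_module"
proof (rule moduleI)
  show "cring complex_ring" by (rule cring_from_type_algebra)
  show "abelian_group coord_module"
  proof (rule abelian_groupI)
    fix x :: "weight \<times> weight \<times> int \<Rightarrow> kvec"
    show "\<exists>y\<in>carrier coord_module. y \<oplus>\<^bsub>coord_module\<^esub> x = \<zero>\<^bsub>coord_module\<^esub>"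
      by (rule bexI[of _ "- x"]) (simp_all add: coord_module_def)
  qed (simp_all add: coord_module_def add.assoc add.commute)
qed (auto simp: coord_module_def scl_coords_def fun_eq_iff algebra_simps)

lemma module_As: "module complex_ring (As r)"
proof (rule module_transfer[OF module_coord, where \<phi> = "to_coords r"])
  show "inj_on (to_coords r) (carrier (As r))" by (auto simp: inj_on_def elim!: As_E)
  show "\<zero>\<^bsub>As r\<^esub> \<in> carrier (As r)" "to_coords r \<zero>\<^bsub>As r\<^esub> = \<zero>\<^bsub>coord_module\<^esub>"
    by (simp_all add: of_coords_zero coords_zero of_coords_closed) (simp add: coord_module_def)
  show "x \<oplus>\<^bsub>As r\<^esub> y \<in> carrier (As r) \<and> to_coords r (x \<oplus>\<^bsub>As r\<^esub> y) = to_coords r x \<oplus>\<^bsub>coord_module\<^esub> to_coords r y"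
    if "x \<in> carrier (As r)" "y \<in> carrier (As r)" for x y
    using that by (elim As_E) (simp add: of_coords_add coords_add of_coords_closed, simp add: coord_module_def)
  show "c \<odot>\<^bsub>As r\<^esub> x \<in> carrier (As r) \<and> to_coords r (c \<odot>\<^bsub>As r\<^esub> x) = c \<odot>\<^bsub>coord_module\<^esub> to_coords r x"
    if "x \<in> carrier (As r)" for c x
    using that by (elim As_E) (simp add: of_coords_smult coords_scl_coords of_coords_closed, simp add: coord_module_def)
qed (simp add: coord_module_def)

section \<open>Differential and product on coordinates\<close>

definition dcoeff :: "weight \<Rightarrow> int \<Rightarrow> kvec" where
  "dcoeff \<kappa> p = (if active \<kappa> p \<and> active \<kappa> (p - 1) then D \<kappa> p (gen (W \<kappa> p) 0) 0 else 0)"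

lemma D_rmult: "\<kappa> \<in> ws \<Longrightarrow> D \<kappa> p = rmult \<kappa> p \<kappa> (p - 1) (dcoeff \<kappa> p)"
  and dcoeff_peirce: "dcoeff \<kappa> p \<in> peirce \<kappa> p \<kappa> (p - 1)"
proof -
  show "D \<kappa> p = rmult \<kappa> p \<kappa> (p - 1) (dcoeff \<kappa> p)" if "\<kappa> \<in> ws"
    using hom_rmult(1)[OF that that resolution.D_hom[OF resolution_at[OF that], of p]] unfolding dcoeff_def .
  show "dcoeff \<kappa> p \<in> peirce \<kappa> p \<kappa> (p - 1)"
  proof (cases "\<kappa> \<in> ws")
    case True
    show ?thesis using hom_rmult(2)[OF True True resolution.D_hom[OF resolution_at[OF True], of p]] unfolding dcoeff_def .
  qed (simp add: dcoeff_def active_def peirce_zero)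
qed

lemma dcoeff_form:
  assumes "\<kappa> \<in> ws" "0 < p" "p \<le> int (idx \<kappa>)"
  shows "\<exists>c. c \<noteq> 0 \<and> dcoeff \<kappa> p = scl c (bU (vert \<kappa> p))"
  using resolution.dc_eq[OF resolution_at[OF assms(1)] assms(2,3)] assms
    resolution.dc_def[OF resolution_at[OF assms(1)]]
  by (simp add: dcoeff_def active_def vert_def)

lemma dcoeff_zero: "\<not> (\<kappa> \<in> ws \<and> 0 < p \<and> p \<le> int (idx \<kappa>)) \<Longrightarrow> dcoeff \<kappa> p = 0"
  by (auto simp: dcoeff_def active_def)

text \<open>Expanding \<open>(-1)^r (\<partial> f - (-1)^r f \<partial>)\<close> leaves the sign
  \<open>(-1)^r\<close> on the first term only. As maps are right multiplications, applying the
  differential after \<open>f\<close> gives \<open>y \<star> dcoeff \<mu>\<close>, and applying it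
  before gives \<open>dcoeff \<kappa> \<star> y\<close> with \<open>y\<close> taken at
  \<open>p - 1\<close>.\<close>

definition ydiff :: "int \<Rightarrow> (weight \<times> weight \<times> int \<Rightarrow> kvec) \<Rightarrow> (weight \<times> weight \<times> int \<Rightarrow> kvec)" where
  "ydiff r y = (\<lambda>(\<kappa>, \<mu>, p). scl ((-1) powi r) (y (\<kappa>, \<mu>, p) \<star> dcoeff \<mu> (p - r)) - dcoeff \<kappa> p \<star> y (\<kappa>, \<mu>, p - 1))"

text \<open>Composition from left to right becomes the product of \<open>K\<close> in the same
  order. The argument \<open>p - r\<close> is the position reached after the first factor.\<close>

definition ymul :: "int \<Rightarrow> (weight \<times> weight \<times> int \<Rightarrow> kvec) \<Rightarrow> (weight \<times> weight \<times> int \<Rightarrow> kvec) \<Rightarrow> (weight \<times> weight \<times> int \<Rightarrow> kvec)" where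
  "ymul r y z = (\<lambda>(\<kappa>, \<nu>, p). \<Sum>\<mu> \<in> ws. y (\<kappa>, \<mu>, p) \<star> z (\<mu>, \<nu>, p - r))"

lemma ydiff_apply: "ydiff r y (\<kappa>, \<mu>, p) = scl ((-1) powi r) (y (\<kappa>, \<mu>, p) \<star> dcoeff \<mu> (p - r)) - dcoeff \<kappa> p \<star> y (\<kappa>, \<mu>, p - 1)"
  by (simp add: ydiff_def)

lemma ymul_apply: "ymul r y z (\<kappa>, \<nu>, p) = (\<Sum>\<mu> \<in> ws. y (\<kappa>, \<mu>, p) \<star> z (\<mu>, \<nu>, p - r))"
  by (simp add: ymul_def)

lemma ydiff_coords:
  assumes "y \<in> coords r"
  shows "ydiff r y \<in> coords (r + 1)"
proof -
  have "y (\<kappa>, \<mu>, p) \<star> dcoeff \<mu> (p - r) \<in> peirce \<kappa> p \<mu> (p - (r + 1))" for \<kappa> \<mu> p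
    using peirce_mul[OF coords_D[OF assms] dcoeff_peirce] by (simp add: algebra_simps)
  moreover have "dcoeff \<kappa> p \<star> y (\<kappa>, \<mu>, p - 1) \<in> peirce \<kappa> p \<mu> (p - (r + 1))" for \<kappa> \<mu> p
    using peirce_mul[OF dcoeff_peirce coords_D[OF assms, of \<kappa> \<mu> "p - 1"]] by (simp add: algebra_simps)
  ultimately show ?thesis unfolding coords_def by (auto simp: ydiff_apply intro!: peirce_diff peirce_scl)
qed

lemma ymul_coords:
  assumes "y \<in> coords r" "z \<in> coords s"
  shows "ymul r y z \<in> coords (r + s)"
proof -
  have "y (\<kappa>, \<mu>, p) \<star> z (\<mu>, \<nu>, p - r) \<in> peirce \<kappa> p \<nu> (p - (r + s))" for \<kappa> \<mu> \<nu> p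
    using peirce_mul[OF coords_D[OF assms(1)] coords_D[OF assms(2)]] by (simp add: algebra_simps)
  then show ?thesis unfolding coords_def by (auto simp: ymul_apply intro!: peirce_sum)
qed

lemma scl_scl: "scl a (scl b x) = scl (a * b) x" by (simp add: fun_eq_iff)
lemma scl_one [simp]: "scl 1 x = x" by (simp add: fun_eq_iff)
lemma scl_diff: "scl c (x - y) = scl c x - scl c y" by (simp add: fun_eq_iff algebra_simps)

lemma R_minus: "\<mu> \<in> ws \<Longrightarrow> x \<in> carrier (R \<mu> q) \<Longrightarrow> y \<in> carrier (R \<mu> q) \<Longrightarrow>
    x \<ominus>\<^bsub>R \<mu> q\<^esub> y = (\<lambda>k \<in> {..<length (W \<mu> q)}. x k - y k)"
  by (rule RT_minus[OF W_set])

lemma dA_of_coords: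
  assumes "y \<in> coords r"
  shows "dA r (of_coords r y) = of_coords (r + 1) (ydiff r y)"
proof -
  have "(let L = R \<kappa> p; M = R \<mu> (p - r - 1); sc = scale Kh M in
      (\<lambda>x \<in> carrier L. sc ((-1) powi r) (D \<mu> (p - r) (of_coords r y (\<kappa>, \<mu>, p) x) \<ominus>\<^bsub>M\<^esub>
        sc ((-1) powi r) (of_coords r y (\<kappa>, \<mu>, p - 1) (D \<kappa> p x))))) = rmult \<kappa> p \<mu> (p - (r + 1)) (ydiff r y (\<kappa>, \<mu>, p))"
    if w: "\<kappa> \<in> ws" "\<mu> \<in> ws" for \<kappa> \<mu> p
  proof -
    let ?n = "{..<length (W \<mu> (p - r - 1))}" and ?s = "(-1) powi r :: complex"
    have ix: "p - 1 - r = p - r - 1" "p - (r + 1) = p - r - 1" by simp_all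
    have y1: "y (\<kappa>, \<mu>, p) \<in> peirce \<kappa> p \<mu> (p - r)" using coords_D[OF assms] .
    have y2: "y (\<kappa>, \<mu>, p - 1) \<in> peirce \<kappa> (p - 1) \<mu> (p - r - 1)" using coords_D[OF assms, of \<kappa> \<mu> "p - 1"] unfolding ix .
    have "scale Kh (R \<mu> (p - r - 1)) ?s (D \<mu> (p - r) (of_coords r y (\<kappa>, \<mu>, p) x) \<ominus>\<^bsub>R \<mu> (p - r - 1)\<^esub>
        scale Kh (R \<mu> (p - r - 1)) ?s (of_coords r y (\<kappa>, \<mu>, p - 1) (D \<kappa> p x))) = (\<lambda>i \<in> ?n. x 0 \<star> ydiff r y (\<kappa>, \<mu>, p))"
      if x: "x \<in> carrier (R \<kappa> p)" for x
    proof -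
      have a: "D \<mu> (p - r) (of_coords r y (\<kappa>, \<mu>, p) x) = (\<lambda>i \<in> ?n. x 0 \<star> (y (\<kappa>, \<mu>, p) \<star> dcoeff \<mu> (p - r)))"
        using rmult_comp[OF w(2) y1 dcoeff_peirce x] w by (simp add: of_coords_def D_rmult)
      have b: "of_coords r y (\<kappa>, \<mu>, p - 1) (D \<kappa> p x) = (\<lambda>i \<in> ?n. x 0 \<star> (dcoeff \<kappa> p \<star> y (\<kappa>, \<mu>, p - 1)))"
        using rmult_comp[OF w(1) dcoeff_peirce y2 x] w by (simp add: of_coords_def D_rmult ix)
      have ca: "(\<lambda>i \<in> ?n. x 0 \<star> (y (\<kappa>, \<mu>, p) \<star> dcoeff \<mu> (p - r))) \<in> carrier (R \<mu> (p - r - 1))"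
        using peirce_mul[OF y1 dcoeff_peirce] by (intro R_intro[OF w(2)]) (simp add: peirce_def kmul_assoc)
      have cb: "(\<lambda>i \<in> ?n. scl c (x 0 \<star> (dcoeff \<kappa> p \<star> y (\<kappa>, \<mu>, p - 1)))) \<in> carrier (R \<mu> (p - r - 1))" for c
        using peirce_mul[OF dcoeff_peirce y2] by (intro R_intro[OF w(2)]) (simp add: peirce_def kmul_assoc)
      have sb: "scale Kh (R \<mu> (p - r - 1)) ?s (\<lambda>i \<in> ?n. x 0 \<star> (dcoeff \<kappa> p \<star> y (\<kappa>, \<mu>, p - 1))) =
          (\<lambda>i \<in> ?n. scl ?s (x 0 \<star> (dcoeff \<kappa> p \<star> y (\<kappa>, \<mu>, p - 1))))"
        using scale_RT[OF cb[of 1] W_set[OF w(2)], of ?s] by (auto intro!: restrict_ext)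
      have m: "(\<lambda>i \<in> ?n. x 0 \<star> (y (\<kappa>, \<mu>, p) \<star> dcoeff \<mu> (p - r))) \<ominus>\<^bsub>R \<mu> (p - r - 1)\<^esub>
          (\<lambda>i \<in> ?n. scl ?s (x 0 \<star> (dcoeff \<kappa> p \<star> y (\<kappa>, \<mu>, p - 1)))) =
          (\<lambda>i \<in> ?n. x 0 \<star> (y (\<kappa>, \<mu>, p) \<star> dcoeff \<mu> (p - r)) - scl ?s (x 0 \<star> (dcoeff \<kappa> p \<star> y (\<kappa>, \<mu>, p - 1))))"
        unfolding R_minus[OF w(2) ca cb] by (rule restrict_ext) simp
      have cm: "(\<lambda>i \<in> ?n. x 0 \<star> (y (\<kappa>, \<mu>, p) \<star> dcoeff \<mu> (p - r)) - scl ?s (x 0 \<star> (dcoeff \<kappa> p \<star> y (\<kappa>, \<mu>, p - 1)))) \<in> carrier (R \<mu> (p - r - 1))"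
        using peirce_mul[OF y1 dcoeff_peirce] peirce_mul[OF dcoeff_peirce y2]
        by (intro R_intro[OF w(2)]) (simp add: peirce_def kmul_assoc kmul_diff_left)
      show ?thesis unfolding a b sb m scale_RT[OF cm W_set[OF w(2)]]
        by (rule restrict_ext) (simp add: ydiff_apply kmul_diff_right scl_diff scl_scl)
    qed
    then show ?thesis unfolding Let_def rmult_def ix by (rule restrict_ext)
  qed
  then show ?thesis
    unfolding dA_def endo_diff_def ws_def[symmetric] Kh_def[symmetric] rterm_def[symmetric] resolution_term_RT
      of_coords_def[of "r + 1"]
    by (intro restrict_ext) (clarsimp simp del: Let_def)
qed

lemma finsum_R:
  assumes "\<nu> \<in> ws" "finite F" "\<And>\<mu>. \<mu> \<in> F \<Longrightarrow> v \<mu> \<star> gen_idem \<nu> q = v \<mu>"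
  shows "finsum (R \<nu> q) (\<lambda>\<mu>. \<lambda>i \<in> {..<length (W \<nu> q)}. v \<mu>) F = (\<lambda>i \<in> {..<length (W \<nu> q)}. \<Sum>\<mu> \<in> F. v \<mu>)"
  using assms(2,3)
proof (induction F)
  case empty
  interpret abelian_group "R \<nu> q" by (rule RT_abelian[OF W_set[OF assms(1)]])
  show ?case by (simp add: RT_ops zero_fun_def)
next
  case (insert \<mu> F)
  interpret abelian_group "R \<nu> q" by (rule RT_abelian[OF W_set[OF assms(1)]])
  have c': "\<And>\<mu>'. \<mu>' \<in> insert \<mu> F \<Longrightarrow> (\<lambda>i \<in> {..<length (W \<nu> q)}. v \<mu>') \<in> carrier (R \<nu> q)"
    by (rule R_intro[OF assms(1)]) (use insert.prems in simp)
  have "finsum (R \<nu> q) (\<lambda>\<mu>. \<lambda>i \<in> {..<length (W \<nu> q)}. v \<mu>) (insert \<mu> F) =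
     (\<lambda>i \<in> {..<length (W \<nu> q)}. v \<mu>) \<oplus>\<^bsub>R \<nu> q\<^esub> finsum (R \<nu> q) (\<lambda>\<mu>. \<lambda>i \<in> {..<length (W \<nu> q)}. v \<mu>) F"
    by (rule finsum_insert[OF insert.hyps]) (use c' in blast)+
  also have "finsum (R \<nu> q) (\<lambda>\<mu>. \<lambda>i \<in> {..<length (W \<nu> q)}. v \<mu>) F = (\<lambda>i \<in> {..<length (W \<nu> q)}. \<Sum>\<mu> \<in> F. v \<mu>)"
    by (rule insert.IH) (use insert.prems in simp)
  also have "(\<lambda>i \<in> {..<length (W \<nu> q)}. v \<mu>) \<oplus>\<^bsub>R \<nu> q\<^esub> (\<lambda>i \<in> {..<length (W \<nu> q)}. \<Sum>\<mu> \<in> F. v \<mu>) =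
      (\<lambda>i \<in> {..<length (W \<nu> q)}. v \<mu> + (\<Sum>\<mu> \<in> F. v \<mu>))"
    unfolding RT_ops by (rule restrict_ext) simp
  finally show ?case unfolding sum.insert[OF insert.hyps] .
qed

lemma mA_of_coords:
  assumes "y \<in> coords r" "z \<in> coords s"
  shows "mA r (of_coords r y) s (of_coords s z) = of_coords (r + s) (ymul r y z)"
proof -
  have "(\<lambda>x \<in> carrier (R \<kappa> p). finsum (R \<nu> (p - r - s)) (\<lambda>\<mu>. of_coords s z (\<mu>, \<nu>, p - r) (of_coords r y (\<kappa>, \<mu>, p) x)) ws) =
      rmult \<kappa> p \<nu> (p - (r + s)) (ymul r y z (\<kappa>, \<nu>, p))" if w: "\<kappa> \<in> ws" "\<nu> \<in> ws" for \<kappa> \<nu> p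
  proof -
    have ix: "p - (r + s) = p - r - s" by simp
    have "finsum (R \<nu> (p - r - s)) (\<lambda>\<mu>. of_coords s z (\<mu>, \<nu>, p - r) (of_coords r y (\<kappa>, \<mu>, p) x)) ws =
      (\<lambda>i \<in> {..<length (W \<nu> (p - r - s))}. x 0 \<star> ymul r y z (\<kappa>, \<nu>, p))" if x: "x \<in> carrier (R \<kappa> p)" for x
    proof -
      interpret abelian_group "R \<nu> (p - r - s)" by (rule RT_abelian[OF W_set[OF w(2)]])
      have e: "of_coords s z (\<mu>, \<nu>, p - r) (of_coords r y (\<kappa>, \<mu>, p) x) =
        (\<lambda>i \<in> {..<length (W \<nu> (p - r - s))}. x 0 \<star> (y (\<kappa>, \<mu>, p) \<star> z (\<mu>, \<nu>, p - r)))" if m: "\<mu> \<in> ws" for \<mu>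
        using rmult_comp[OF m coords_D[OF assms(1)] coords_D[OF assms(2)] x] m w by (simp add: of_coords_def)
      have idem: "(x 0 \<star> (y (\<kappa>, \<mu>, p) \<star> z (\<mu>, \<nu>, p - r))) \<star> gen_idem \<nu> (p - r - s) = x 0 \<star> (y (\<kappa>, \<mu>, p) \<star> z (\<mu>, \<nu>, p - r))" for \<mu>
        using peirce_mul[OF coords_D[OF assms(1)] coords_D[OF assms(2), of \<mu> \<nu> "p - r"], of \<kappa>] by (simp add: peirce_def kmul_assoc)
      have "finsum (R \<nu> (p - r - s)) (\<lambda>\<mu>. of_coords s z (\<mu>, \<nu>, p - r) (of_coords r y (\<kappa>, \<mu>, p) x)) ws =
        finsum (R \<nu> (p - r - s)) (\<lambda>\<mu>. \<lambda>i \<in> {..<length (W \<nu> (p - r - s))}. x 0 \<star> (y (\<kappa>, \<mu>, p) \<star> z (\<mu>, \<nu>, p - r))) ws"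
        by (rule finsum_cong') (use e idem w(2) in \<open>auto intro!: R_intro\<close>)
      also have "\<dots> = (\<lambda>i \<in> {..<length (W \<nu> (p - r - s))}. \<Sum>\<mu> \<in> ws. x 0 \<star> (y (\<kappa>, \<mu>, p) \<star> z (\<mu>, \<nu>, p - r)))"
        by (rule finsum_R[OF w(2) _ idem]) (unfold ws_def, rule finite_weights)
      finally show ?thesis by (simp add: ymul_apply kmul_sum_right)
    qed
    then show ?thesis unfolding rmult_def ix by (rule restrict_ext)
  qed
  then show ?thesis
    unfolding mA_def endo_mult_def ws_def[symmetric] rterm_def[symmetric] resolution_term_RT of_coords_def[of "r + s"]
    by (intro restrict_ext) clarsimp
qed

end

section \<open>Formality\<close>

text \<open>Starting from the value 0 at \<open>lo - 1\<close>, each \<open>\<alpha> p\<close> is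
  obtained from \<open>\<alpha> (p - 1)\<close> by dividing by \<open>a p\<close>.\<close>

lemma recursion_up:
  fixes a b \<eta> :: "int \<Rightarrow> complex"
  assumes "\<And>p. lo \<le> p \<Longrightarrow> p \<le> hi \<Longrightarrow> a p \<noteq> 0"
  shows "\<exists>\<alpha>. (\<forall>p. lo \<le> p \<and> p \<le> hi \<longrightarrow> a p * \<alpha> p - b p * \<alpha> (p - 1) = \<eta> p) \<and> (\<forall>p. p < lo \<or> hi < p \<longrightarrow> \<alpha> p = 0)"
proof -
  have "lo + int n \<le> hi + 1 \<Longrightarrow> \<exists>\<alpha>. (\<forall>p. lo \<le> p \<and> p < lo + int n \<longrightarrow> a p * \<alpha> p - b p * \<alpha> (p - 1) = \<eta> p) \<and>
    (\<forall>p. p < lo \<or> lo + int n \<le> p \<longrightarrow> \<alpha> p = 0)" for n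
  proof (induction n)
    case 0
    show ?case by (rule exI[of _ "\<lambda>_. 0"]) auto
  next
    case (Suc n)
    then obtain \<alpha> where \<alpha>: "\<And>p. lo \<le> p \<Longrightarrow> p < lo + int n \<Longrightarrow> a p * \<alpha> p - b p * \<alpha> (p - 1) = \<eta> p"
      "\<And>p. p < lo \<or> lo + int n \<le> p \<Longrightarrow> \<alpha> p = 0" by auto
    let ?q = "lo + int n"
    let ?\<beta> = "\<alpha>(?q := (\<eta> ?q + b ?q * \<alpha> (?q - 1)) / a ?q)"
    have q: "a ?q \<noteq> 0" using Suc.prems by (intro assms) auto
    show ?case
    proof (rule exI[of _ ?\<beta>], intro conjI allI impI)
      fix p assume p: "lo \<le> p \<and> p < lo + int (Suc n)"
      show "a p * ?\<beta> p - b p * ?\<beta> (p - 1) = \<eta> p"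
      proof (cases "p = ?q")
        case True
        then show ?thesis using q by simp
      next
        case False
        then show ?thesis using \<alpha>(1)[of p] p by simp
      qed
    next
      fix p assume p: "p < lo \<or> lo + int (Suc n) \<le> p"
      then show "?\<beta> p = 0" using \<alpha>(2)[of p] by auto
    qed
  qed
  note P = this[of "nat (hi + 1 - lo)"]
  show ?thesis
  proof (cases "lo \<le> hi + 1")
    case True
    then have "lo + int (nat (hi + 1 - lo)) = hi + 1" by simp
    then show ?thesis using P by (auto simp: zless_add1_eq add1_zle_eq zle_add1_eq_le)
  next
    case False
    then show ?thesis by (intro exI[of _ "\<lambda>_. 0"]) auto
  qed
qed

text \<open>The reflection \<open>\<alpha> p = \<beta> (- p - 1)\<close> exchanges the roles of
  \<open>a\<close> and \<open>b\<close> and reduces to \<open>recursion_up\<close>. The recursion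
  starts with 0 at \<open>hi\<close>, so the value at \<open>lo - 1\<close>, one place below the
  equations, may be nonzero.\<close>

lemma recursion_down:
  fixes a b \<eta> :: "int \<Rightarrow> complex"
  assumes "\<And>p. lo \<le> p \<Longrightarrow> p \<le> hi \<Longrightarrow> b p \<noteq> 0"
  shows "\<exists>\<alpha>. (\<forall>p. lo \<le> p \<and> p \<le> hi \<longrightarrow> a p * \<alpha> p - b p * \<alpha> (p - 1) = \<eta> p) \<and> (\<forall>p. p < lo - 1 \<or> hi \<le> p \<longrightarrow> \<alpha> p = 0)"
proof -
  have "\<exists>\<beta>. (\<forall>q. - hi \<le> q \<and> q \<le> - lo \<longrightarrow> - b (- q) * \<beta> q - (- a (- q)) * \<beta> (q - 1) = \<eta> (- q)) \<and>
    (\<forall>q. q < - hi \<or> - lo < q \<longrightarrow> \<beta> q = 0)"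
    by (rule recursion_up) (use assms in simp)
  then obtain \<beta> where \<beta>: "\<And>q. - hi \<le> q \<Longrightarrow> q \<le> - lo \<Longrightarrow> - b (- q) * \<beta> q - (- a (- q)) * \<beta> (q - 1) = \<eta> (- q)"
    "\<And>q. q < - hi \<or> - lo < q \<Longrightarrow> \<beta> q = 0" by blast
  show ?thesis
  proof (rule exI[of _ "\<lambda>p. \<beta> (- p - 1)"], intro conjI allI impI)
    fix p assume "lo \<le> p \<and> p \<le> hi"
    then show "a p * \<beta> (- p - 1) - b p * \<beta> (- (p - 1) - 1) = \<eta> p" using \<beta>(1)[of "- p"] by simp
  next
    fix p assume "p < lo - 1 \<or> hi \<le> p"
    then show "\<beta> (- p - 1) = 0" by (intro \<beta>(2)) auto
  qed
qed

context one_wedge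
begin

lemma bU_bU: "i < N \<Longrightarrow> j < N \<Longrightarrow> bU i \<star> bU j = 0"
  by (rule kvec_eqI) (auto simp: kmul_simps bU_simps)

definition bV :: "nat \<Rightarrow> kvec" where "bV i = basis_vec (eV i)"

lemma bV_apply: "bV i b = (if b = eV i then 1 else 0)" by (simp add: bV_def basis_vec_def)

lemma bE_bV: "j < N \<Longrightarrow> bE (Suc j) \<star> bV j = bV j" "j < N \<Longrightarrow> bV j \<star> bE j = bV j"
  by (rule kvec_eqI; auto simp: kmul_simps bE_apply bV_apply)+

lemma scl_add: "scl c (x + y) = scl c x + scl c y" by (simp add: fun_eq_iff algebra_simps)
lemma scl_zero [simp]: "scl c 0 = 0" by (simp add: fun_eq_iff)
lemma scl_sum: "scl c (\<Sum>i \<in> I. f i) = (\<Sum>i \<in> I. scl c (f i))"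
  by (induction I rule: infinite_finite_induct) (simp_all only: sum.infinite sum.empty sum.insert scl_zero scl_add not_False_eq_True)

definition span_EV :: "kvec set" where "span_EV = {v. \<forall>i < N. v (eX i) = 0 \<and> v (eU i) = 0}"

text \<open>In the product formulas each summand of a \<open>u\<close> or \<open>x\<close>
  coordinate contains a \<open>u\<close> or \<open>x\<close> coordinate of one of the factors; the
  product of two \<open>v\<close> coordinates does not occur in them.\<close>

lemma span_EV_mul: "v \<in> span_EV \<Longrightarrow> w \<in> span_EV \<Longrightarrow> v \<star> w \<in> span_EV"
  by (auto simp: span_EV_def kmul_simps)

lemma span_EV_add: "v \<in> span_EV \<Longrightarrow> w \<in> span_EV \<Longrightarrow> v + w \<in> span_EV" and span_EV_scl: "v \<in> span_EV \<Longrightarrow> scl c v \<in> span_EV" and span_EV_zero: "0 \<in> span_EV"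
  by (auto simp: span_EV_def)

lemma span_EV_sum: "(\<And>i. i \<in> I \<Longrightarrow> f i \<in> span_EV) \<Longrightarrow> sum f I \<in> span_EV"
  by (induction I rule: infinite_finite_induct) (simp_all only: sum.infinite sum.empty sum.insert span_EV_zero span_EV_add not_False_eq_True insert_iff simp_thms)

end

context resolutions
begin

lemma dcoeff_coord:
  "i \<le> N \<Longrightarrow> dcoeff \<kappa> p (eE i) = 0" "i < N \<Longrightarrow> dcoeff \<kappa> p (eX i) = 0" "i < N \<Longrightarrow> dcoeff \<kappa> p (eV i) = 0"
  "\<kappa> \<in> ws \<Longrightarrow> 0 < p \<Longrightarrow> p \<le> int (idx \<kappa>) \<Longrightarrow> dcoeff \<kappa> p (eU (vert \<kappa> p)) \<noteq> 0"
proof -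
  have "(\<forall>i \<le> N. dcoeff \<kappa> p (eE i) = 0) \<and> (\<forall>i < N. dcoeff \<kappa> p (eX i) = 0 \<and> dcoeff \<kappa> p (eV i) = 0) \<and>
    (\<kappa> \<in> ws \<and> 0 < p \<and> p \<le> int (idx \<kappa>) \<longrightarrow> dcoeff \<kappa> p (eU (vert \<kappa> p)) \<noteq> 0)"
  proof (cases "\<kappa> \<in> ws \<and> 0 < p \<and> p \<le> int (idx \<kappa>)")
    case True
    then obtain c where c: "c \<noteq> 0" "dcoeff \<kappa> p = scl c (bU (vert \<kappa> p))" using dcoeff_form by blast
    have "vert \<kappa> p < N" using True ws_idx[of \<kappa>] by (auto simp: vert_def)
    then show ?thesis using c by (simp add: bU_simps)
  next
    case False
    then show ?thesis using dcoeff_zero[OF False] by simp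
  qed
  then show "i \<le> N \<Longrightarrow> dcoeff \<kappa> p (eE i) = 0" "i < N \<Longrightarrow> dcoeff \<kappa> p (eX i) = 0" "i < N \<Longrightarrow> dcoeff \<kappa> p (eV i) = 0"
    "\<kappa> \<in> ws \<Longrightarrow> 0 < p \<Longrightarrow> p \<le> int (idx \<kappa>) \<Longrightarrow> dcoeff \<kappa> p (eU (vert \<kappa> p)) \<noteq> 0" by blast+
qed

text \<open>Each coefficient is 0 or a multiple of some \<open>u_j\<close>, and any two
  \<open>u_i\<close>, \<open>u_j\<close> have product 0 in \<open>K\<close>. So the square of the
  differential vanishes by a relation of the algebra.\<close>

lemma dcoeff_dcoeff: "dcoeff \<kappa> p \<star> dcoeff \<kappa> (p - 1) = 0"
proof -
  have form: "\<exists>c j. j < N \<and> dcoeff \<kappa> p = scl c (bU j)" if "dcoeff \<kappa> p \<noteq> 0" for p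
  proof -
    have a: "\<kappa> \<in> ws \<and> 0 < p \<and> p \<le> int (idx \<kappa>)" using dcoeff_zero that by blast
    then have "vert \<kappa> p < N" using ws_idx[of \<kappa>] by (auto simp: vert_def)
    then show ?thesis using dcoeff_form a by blast
  qed
  show ?thesis
  proof (cases "dcoeff \<kappa> p = 0 \<or> dcoeff \<kappa> (p - 1) = 0")
    case False
    then obtain c j c' j' where "j < N" "dcoeff \<kappa> p = scl c (bU j)" "j' < N" "dcoeff \<kappa> (p - 1) = scl c' (bU j')"
      using form by metis
    then show ?thesis by (simp add: bU_bU)
  qed auto
qed

lemma sign_suc: "(-1 :: complex) powi (r + 1) = - ((-1) powi r)"
  by (subst power_int_add_1') simp_all

lemma ydiff_add: "ydiff r (y + z) = ydiff r y + ydiff r z"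
  by (rule ext) (simp add: ydiff_def split_beta kmul_add_left kmul_add_right scl_add)

lemma ydiff_scl_coords: "ydiff r (scl_coords c y) = scl_coords c (ydiff r y)"
  by (rule ext) (simp add: ydiff_def scl_coords_def split_beta scl_diff scl_scl mult.commute)

lemma ydiff_ydiff: "ydiff (r + 1) (ydiff r y) = 0"
proof
  fix i :: "weight \<times> weight \<times> int"
  obtain \<kappa> \<mu> p where i: "i = (\<kappa>, \<mu>, p)" by (metis surj_pair)
  have u1: "y j \<star> dcoeff \<mu> (p - r) \<star> dcoeff \<mu> (p - (r + 1)) = 0" for j
    using dcoeff_dcoeff[of \<mu> "p - r"] by (simp add: kmul_assoc algebra_simps)
  have u2: "dcoeff \<kappa> p \<star> (dcoeff \<kappa> (p - 1) \<star> v) = 0" for v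
    using dcoeff_dcoeff[of \<kappa> p] by (simp add: kmul_assoc[symmetric])
  have ix: "p - 1 - r = p - (r + 1)" by simp
  show "ydiff (r + 1) (ydiff r y) i = 0 i"
    unfolding i ydiff_apply kmul_diff_left kmul_diff_right kmul_scl u1 u2 scl_zero sign_suc ix
    by (simp add: kmul_assoc fun_eq_iff)
qed

lemma ymul_add_left: "ymul r (y + y') z = ymul r y z + ymul r y' z"
  by (rule ext) (simp add: ymul_def split_beta kmul_add_left sum.distrib)

lemma ymul_add_right: "ymul r y (z + z') = ymul r y z + ymul r y z'"
  by (rule ext) (simp add: ymul_def split_beta kmul_add_right sum.distrib)

lemma ymul_scl_coords: "ymul r (scl_coords c y) z = scl_coords c (ymul r y z)" "ymul r y (scl_coords c z) = scl_coords c (ymul r y z)"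
  by (rule ext, simp add: ymul_def scl_coords_def split_beta scl_sum)+

lemma ymul_assoc: "ymul (r + s) (ymul r y z) w = ymul r y (ymul s z w)"
proof
  fix i :: "weight \<times> weight \<times> int"
  obtain \<kappa> \<pi> p where i: "i = (\<kappa>, \<pi>, p)" by (metis surj_pair)
  have ix: "p - (r + s) = p - r - s" by simp
  show "ymul (r + s) (ymul r y z) w i = ymul r y (ymul s z w) i"
    unfolding i ymul_apply kmul_sum_left kmul_sum_right kmul_assoc ix by (rule sum.swap)
qed

text \<open>For each middle weight \<open>\<mu>\<close> the terms in which
  \<open>dcoeff \<mu>\<close> stands between \<open>y\<close> and \<open>z\<close> occur with the
  signs \<open>(-1)^r\<close> and \<open>- (-1)^r\<close> and cancel.\<close>

lemma ydiff_ymul: "ydiff (r + s) (ymul r y z) = ymul (r + 1) (ydiff r y) z + scl_coords ((-1) powi r) (ymul r y (ydiff s z))"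
proof
  fix i :: "weight \<times> weight \<times> int"
  obtain \<kappa> \<nu> p where i: "i = (\<kappa>, \<nu>, p)" by (metis surj_pair)
  have ix: "p - (r + s) = p - r - s" "p - (r + 1) = p - r - 1" "p - 1 - r = p - r - 1" by simp_all
  have sg: "(-1 :: complex) powi (r + s) = (-1) powi r * (-1) powi s" by (simp add: power_int_add)
  have "ydiff (r + s) (ymul r y z) i = (\<Sum>\<mu> \<in> ws. scl ((-1) powi r * (-1) powi s) (y (\<kappa>, \<mu>, p) \<star> (z (\<mu>, \<nu>, p - r) \<star> dcoeff \<nu> (p - r - s)))
      - dcoeff \<kappa> p \<star> (y (\<kappa>, \<mu>, p - 1) \<star> z (\<mu>, \<nu>, p - r - 1)))"
    unfolding i ydiff_apply ymul_apply ix sg kmul_sum_left kmul_sum_right scl_sum sum_subtractf kmul_assoc ..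
  also have "\<dots> = (\<Sum>\<mu> \<in> ws. (scl ((-1) powi r) (y (\<kappa>, \<mu>, p) \<star> dcoeff \<mu> (p - r)) - dcoeff \<kappa> p \<star> y (\<kappa>, \<mu>, p - 1)) \<star> z (\<mu>, \<nu>, p - r - 1)
      + scl ((-1) powi r) (y (\<kappa>, \<mu>, p) \<star> (scl ((-1) powi s) (z (\<mu>, \<nu>, p - r) \<star> dcoeff \<nu> (p - r - s)) - dcoeff \<mu> (p - r) \<star> z (\<mu>, \<nu>, p - r - 1))))"
    by (rule sum.cong) (simp_all add: kmul_diff_left kmul_diff_right scl_diff scl_scl kmul_assoc)
  also have "\<dots> = (ymul (r + 1) (ydiff r y) z + scl_coords ((-1) powi r) (ymul r y (ydiff s z))) i"
    unfolding i plus_fun_apply scl_coords_def ymul_apply ydiff_apply ix scl_sum sum.distrib ..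
  finally show "ydiff (r + s) (ymul r y z) i = (ymul (r + 1) (ydiff r y) z + scl_coords ((-1) powi r) (ymul r y (ydiff s z))) i" .
qed

lemma dg_algebra_A: "dg_algebra As dA mA"
proof (rule dg_algebra.intro)
  show "module complex_ring (As d)" for d by (rule module_As)
  show "dA d x \<in> carrier (As (d + 1))" if "x \<in> carrier (As d)" for d x
    using that by (elim As_E) (simp add: dA_of_coords of_coords_closed ydiff_coords)
  show "dA d (x \<oplus>\<^bsub>As d\<^esub> y) = dA d x \<oplus>\<^bsub>As (d + 1)\<^esub> dA d y" if "x \<in> carrier (As d)" "y \<in> carrier (As d)" for d x y
    using that by (elim As_E) (simp add: dA_of_coords of_coords_add coords_add ydiff_coords ydiff_add)
  show "dA d (c \<odot>\<^bsub>As d\<^esub> x) = c \<odot>\<^bsub>As (d + 1)\<^esub> dA d x" if "x \<in> carrier (As d)" for d c x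
    using that by (elim As_E) (simp add: dA_of_coords of_coords_smult coords_scl_coords ydiff_coords ydiff_scl_coords)
  show "dA (d + 1) (dA d x) = \<zero>\<^bsub>As (d + 1 + 1)\<^esub>" if "x \<in> carrier (As d)" for d x
    using that by (elim As_E) (simp only: dA_of_coords ydiff_coords ydiff_ydiff of_coords_zero)
  show "mA d x e y \<in> carrier (As (d + e))" if "x \<in> carrier (As d)" "y \<in> carrier (As e)" for d x e y
    using that by (elim As_E) (simp add: mA_of_coords of_coords_closed ymul_coords)
  show "mA d (x \<oplus>\<^bsub>As d\<^esub> x') e y = mA d x e y \<oplus>\<^bsub>As (d + e)\<^esub> mA d x' e y"
    if "x \<in> carrier (As d)" "x' \<in> carrier (As d)" "y \<in> carrier (As e)" for d x x' e y
    using that by (elim As_E) (simp add: mA_of_coords of_coords_add coords_add ymul_coords ymul_add_left)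
  show "mA d x e (y \<oplus>\<^bsub>As e\<^esub> y') = mA d x e y \<oplus>\<^bsub>As (d + e)\<^esub> mA d x e y'"
    if "x \<in> carrier (As d)" "y \<in> carrier (As e)" "y' \<in> carrier (As e)" for d x e y y'
    using that by (elim As_E) (simp add: mA_of_coords of_coords_add coords_add ymul_coords ymul_add_right)
  show "mA d (c \<odot>\<^bsub>As d\<^esub> x) e y = c \<odot>\<^bsub>As (d + e)\<^esub> mA d x e y"
    if "x \<in> carrier (As d)" "y \<in> carrier (As e)" for d c x e y
    using that by (elim As_E) (simp add: mA_of_coords of_coords_smult coords_scl_coords ymul_coords ymul_scl_coords)
  show "mA d x e (c \<odot>\<^bsub>As e\<^esub> y) = c \<odot>\<^bsub>As (d + e)\<^esub> mA d x e y"
    if "x \<in> carrier (As d)" "y \<in> carrier (As e)" for d c x e y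
    using that by (elim As_E) (simp add: mA_of_coords of_coords_smult coords_scl_coords ymul_coords ymul_scl_coords)
  show "mA (d + e) (mA d x e y) g z = mA d x (e + g) (mA e y g z)"
    if "x \<in> carrier (As d)" "y \<in> carrier (As e)" "z \<in> carrier (As g)" for d x e y g z
    using that by (elim As_E) (simp add: mA_of_coords ymul_coords ymul_assoc add.assoc)
  show "dA (d + e) (mA d x e y) = mA (d + 1) (dA d x) e y \<oplus>\<^bsub>As (d + e + 1)\<^esub> (-1) powi d \<odot>\<^bsub>As (d + e + 1)\<^esub> mA d x (e + 1) (dA e y)"
    if "x \<in> carrier (As d)" "y \<in> carrier (As e)" for d x e y
  proof -
    obtain v w where v: "v \<in> coords d" "x = of_coords d v" and w: "w \<in> coords e" "y = of_coords e w" using \<open>x \<in> _\<close> \<open>y \<in> _\<close> by (elim As_E)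
    have e: "d + 1 + e = d + e + 1" "d + (e + 1) = d + e + 1" by simp_all
    have b: "ymul (d + 1) (ydiff d v) w \<in> coords (d + e + 1)" "ymul d v (ydiff e w) \<in> coords (d + e + 1)"
      using ymul_coords[OF ydiff_coords[OF v(1)] w(1)] ymul_coords[OF v(1) ydiff_coords[OF w(1)]] unfolding e .
    have m: "mA (d + 1) (of_coords (d + 1) (ydiff d v)) e (of_coords e w) = of_coords (d + e + 1) (ymul (d + 1) (ydiff d v) w)"
      "mA d (of_coords d v) (e + 1) (of_coords (e + 1) (ydiff e w)) = of_coords (d + e + 1) (ymul d v (ydiff e w))"
      using mA_of_coords[OF ydiff_coords[OF v(1)] w(1)] mA_of_coords[OF v(1) ydiff_coords[OF w(1)]] unfolding e .
    show ?thesis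
      unfolding v(2) w(2) mA_of_coords[OF v(1) w(1)] dA_of_coords[OF ymul_coords[OF v(1) w(1)]] dA_of_coords[OF v(1)] dA_of_coords[OF w(1)]
        m of_coords_smult[OF b(2)] of_coords_add[OF b(1) coords_scl_coords[OF b(2)]] ydiff_ymul ..
  qed
qed

text \<open>In a component \<open>e_a K e_b\<close> the element \<open>u_i\<close> occurs only for
  \<open>b = a + 1\<close> and \<open>x_i\<close> only for \<open>a = b\<close>. A nonzero
  coordinate therefore fixes the difference of the two vertices.\<close>

lemma peirce_coord:
  assumes "v \<in> peirce \<kappa> p \<mu> q" "i < N"
  shows "v (eU i) \<noteq> 0 \<Longrightarrow> active \<kappa> p \<and> active \<mu> q \<and> i = vert \<kappa> p \<and> Suc i = vert \<mu> q"
    and "v (eX i) \<noteq> 0 \<Longrightarrow> active \<kappa> p \<and> active \<mu> q \<and> Suc i = vert \<kappa> p \<and> Suc i = vert \<mu> q"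
proof -
  have l: "(gen_idem \<kappa> p \<star> v) b = v b" and r: "(v \<star> gen_idem \<mu> q) b = v b" for b using assms(1) by (auto simp: peirce_def)
  have "v (eU i) = 0" if "\<not> (active \<kappa> p \<and> active \<mu> q \<and> i = vert \<kappa> p \<and> Suc i = vert \<mu> q)"
    using l[of "eU i"] r[of "eU i"] that left_bE(3)[of "vert \<kappa> p" i v] right_bE(3)[of "vert \<mu> q" i v] vert_le[of \<kappa> p] vert_le[of \<mu> q] assms(2)
    by (auto simp: gen_idem_def split: if_splits)
  then show "v (eU i) \<noteq> 0 \<Longrightarrow> active \<kappa> p \<and> active \<mu> q \<and> i = vert \<kappa> p \<and> Suc i = vert \<mu> q" by blast
  have "v (eX i) = 0" if "\<not> (active \<kappa> p \<and> active \<mu> q \<and> Suc i = vert \<kappa> p \<and> Suc i = vert \<mu> q)"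
    using l[of "eX i"] r[of "eX i"] that left_bE(2)[of "vert \<kappa> p" i v] right_bE(2)[of "vert \<mu> q" i v] vert_le[of \<kappa> p] vert_le[of \<mu> q] assms(2)
    by (auto simp: gen_idem_def split: if_splits)
  then show "v (eX i) \<noteq> 0 \<Longrightarrow> active \<kappa> p \<and> active \<mu> q \<and> Suc i = vert \<kappa> p \<and> Suc i = vert \<mu> q" by blast
qed

lemma vert_int: "active \<kappa> p \<Longrightarrow> int (vert \<kappa> p) = int (idx \<kappa>) - p"
  by (simp add: active_def vert_def)

text \<open>By \<open>kl\<close>, both terms are active for \<open>p\<close> from
  \<open>max 0 r\<close> to \<open>idx \<mu> + r\<close>, the places of the unknowns. For
  \<open>r < 0\<close> there is one equation for each of them; the recursion goes up and divides by
  the coefficients at \<open>\<mu>\<close>, nonzero because \<open>p - r > 0\<close>. For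
  \<open>r \<ge> 0\<close> there is one more unknown, at \<open>p = r\<close>; the recursion goes
  down and divides by the coefficients at \<open>\<kappa>\<close>, nonzero because
  \<open>0 < p\<close> and, by \<open>kl\<close>, \<open>p \<le> idx \<kappa>\<close>.\<close>

lemma recursion_solution:
  assumes w: "\<kappa> \<in> ws" "\<mu> \<in> ws" and kl: "int (idx \<mu>) + r \<le> int (idx \<kappa>)" and s: "s \<noteq> 0"
  shows "\<exists>\<alpha>. (\<forall>p. max 0 (r + 1) \<le> p \<and> p \<le> int (idx \<mu>) + r \<longrightarrow>
      (s * dcoeff \<mu> (p - r) (eU (vert \<mu> (p - r)))) * \<alpha> p - dcoeff \<kappa> p (eU (vert \<kappa> p)) * \<alpha> (p - 1) = \<eta> p) \<and>
    (\<forall>p. p < max 0 r \<or> int (idx \<mu>) + r < p \<longrightarrow> \<alpha> p = 0)"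
proof (cases "r < 0")
  case True
  obtain \<alpha> where \<alpha>: "\<And>p. 0 \<le> p \<Longrightarrow> p \<le> int (idx \<mu>) + r \<Longrightarrow>
      (s * dcoeff \<mu> (p - r) (eU (vert \<mu> (p - r)))) * \<alpha> p - dcoeff \<kappa> p (eU (vert \<kappa> p)) * \<alpha> (p - 1) = \<eta> p"
      "\<And>p. p < 0 \<or> int (idx \<mu>) + r < p \<Longrightarrow> \<alpha> p = 0"
    using recursion_up[of 0 "int (idx \<mu>) + r" "\<lambda>p. s * dcoeff \<mu> (p - r) (eU (vert \<mu> (p - r)))" "\<lambda>p. dcoeff \<kappa> p (eU (vert \<kappa> p))" \<eta>]
      dcoeff_coord(4)[OF w(2)] s True by auto
  then show ?thesis using True by (intro exI[of _ \<alpha>]) auto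
next
  case False
  obtain \<alpha> where \<alpha>: "\<And>p. r + 1 \<le> p \<Longrightarrow> p \<le> int (idx \<mu>) + r \<Longrightarrow>
      (s * dcoeff \<mu> (p - r) (eU (vert \<mu> (p - r)))) * \<alpha> p - dcoeff \<kappa> p (eU (vert \<kappa> p)) * \<alpha> (p - 1) = \<eta> p"
      "\<And>p. p < r + 1 - 1 \<or> int (idx \<mu>) + r \<le> p \<Longrightarrow> \<alpha> p = 0"
    using recursion_down[of "r + 1" "int (idx \<mu>) + r" "\<lambda>p. dcoeff \<kappa> p (eU (vert \<kappa> p))" "\<lambda>p. s * dcoeff \<mu> (p - r) (eU (vert \<mu> (p - r)))" \<eta>]
      dcoeff_coord(4)[OF w(1)] kl False by auto
  then show ?thesis using False by (intro exI[of _ \<alpha>]) auto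
qed

text \<open>For given \<open>\<kappa>\<close>, \<open>\<mu>\<close> and \<open>r\<close>, only one of the coefficients at \<open>u\<^sub>i\<close> and at \<open>x\<^sub>i\<close> can be nonzero, and \<open>w\<close>
  consists of multiples of \<open>e\<^sub>i\<close> in the first case and of \<open>v\<^sub>i\<close> in the second.\<close>

lemma bounding_component:
  assumes y: "\<And>p. y p \<in> peirce \<kappa> p \<mu> (p - (r + 1))"
  shows "\<exists>w. (\<forall>p. w p \<in> peirce \<kappa> p \<mu> (p - r)) \<and>
    (\<forall>p. y p - (scl ((-1) powi r) (w p \<star> dcoeff \<mu> (p - r)) - dcoeff \<kappa> p \<star> w (p - 1)) \<in> span_EV)"
proof -
  let ?s = "(-1) powi r :: complex"
  define \<delta> where "\<delta> w p = scl ?s (w p \<star> dcoeff \<mu> (p - r)) - dcoeff \<kappa> p \<star> w (p - 1)" for w p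
  have \<delta>Y: "\<delta> w p \<in> peirce \<kappa> p \<mu> (p - (r + 1))" if "\<And>p. w p \<in> peirce \<kappa> p \<mu> (p - r)" for w p
  proof -
    have "w p \<star> dcoeff \<mu> (p - r) \<in> peirce \<kappa> p \<mu> (p - (r + 1))" using peirce_mul[OF that[of p] dcoeff_peirce] by (simp only: diff_diff_eq)
    moreover have "dcoeff \<kappa> p \<star> w (p - 1) \<in> peirce \<kappa> p \<mu> (p - (r + 1))"
      using peirce_mul[OF dcoeff_peirce that[of "p - 1"]] by (simp only: diff_diff_eq add.commute)
    ultimately show ?thesis unfolding \<delta>_def by (intro peirce_diff peirce_scl)
  qed
  have \<delta>U: "\<delta> w p (eU i) = ?s * (w p (eE i) * dcoeff \<mu> (p - r) (eU i)) - dcoeff \<kappa> p (eU i) * w (p - 1) (eE (Suc i))" if "i < N" for w p i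
    using that dcoeff_coord(1)[of "Suc i" \<mu> "p - r"] dcoeff_coord(1)[of i \<kappa> p] by (simp add: \<delta>_def kmul_U)
  have \<delta>X: "\<delta> w p (eX i) = ?s * (w p (eV i) * dcoeff \<mu> (p - r) (eU i)) -
      (if Suc i < N then dcoeff \<kappa> p (eU (Suc i)) * w (p - 1) (eV (Suc i)) else 0)" if "i < N" for w p i
    using that by (simp add: \<delta>_def kmul_X dcoeff_coord)
  show ?thesis unfolding \<delta>_def[symmetric]
  proof (cases "\<kappa> \<in> ws \<and> \<mu> \<in> ws")
    case False
    then have "y p = 0" for p using peirce_inactive[OF y] by (auto simp: active_def)
    then show "\<exists>w. (\<forall>p. w p \<in> peirce \<kappa> p \<mu> (p - r)) \<and> (\<forall>p. y p - \<delta> w p \<in> span_EV)"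
      by (intro exI[of _ "\<lambda>_. 0"]) (simp add: \<delta>_def peirce_zero span_EV_zero)
  next
    case w: True
    \<comment> \<open>In active degrees the vertices \<open>vert \<mu> (p - (r + 1))\<close> and
      \<open>vert \<kappa> p\<close> differ by \<open>?t + 1\<close>, independently of
      \<open>p\<close>. By \<open>peirce_coord\<close>, \<open>u\<close> coordinates require the
      value 1 and \<open>x\<close> coordinates the value 0.\<close>
    let ?t = "int (idx \<mu>) + r - int (idx \<kappa>)"
    consider (U) "?t = 0" | (X) "?t = -1" | (none) "?t \<noteq> 0" "?t \<noteq> -1" by blast
    then show "\<exists>w. (\<forall>p. w p \<in> peirce \<kappa> p \<mu> (p - r)) \<and> (\<forall>p. y p - \<delta> w p \<in> span_EV)"
    proof cases
      case none
      have "y p \<in> span_EV" for p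
        unfolding span_EV_def using peirce_coord[OF y[of p]] vert_int[of \<kappa> p] vert_int[of \<mu> "p - (r + 1)"] none by fastforce
      then show ?thesis by (intro exI[of _ "\<lambda>_. 0"]) (simp add: \<delta>_def peirce_zero)
    next
      case U
      obtain \<alpha> where \<alpha>: "\<And>p. max 0 (r + 1) \<le> p \<Longrightarrow> p \<le> int (idx \<mu>) + r \<Longrightarrow>
          (?s * dcoeff \<mu> (p - r) (eU (vert \<mu> (p - r)))) * \<alpha> p - dcoeff \<kappa> p (eU (vert \<kappa> p)) * \<alpha> (p - 1) = y p (eU (vert \<kappa> p))"
        "\<And>p. p < max 0 r \<or> int (idx \<mu>) + r < p \<Longrightarrow> \<alpha> p = 0"
        using recursion_solution[of \<kappa> \<mu> r ?s "\<lambda>p. y p (eU (vert \<kappa> p))"] w U by auto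
      define w where "w p = (if active \<kappa> p \<and> active \<mu> (p - r) then scl (\<alpha> p) (bE (vert \<kappa> p)) else 0)" for p
      have vv: "vert \<mu> (p - r) = vert \<kappa> p" for p using U by (simp add: vert_def algebra_simps)
      have wY: "w p \<in> peirce \<kappa> p \<mu> (p - r)" for p
        using vv[of p] vert_le[of \<kappa> p] by (auto simp: w_def peirce_def gen_idem_def bE_idem)
      \<comment> \<open>This holds for inactive degrees too, because the solution vanishes outside
        the range of the unknowns; the equation at the lower end, which refers to
        \<open>p - 1\<close>, relies on it.\<close>
      have wE: "w p (eE (vert \<kappa> p)) = \<alpha> p" for p
        using \<alpha>(2)[of p] w U by (auto simp: w_def bE_apply active_def)
      have "y p - \<delta> w p \<in> span_EV" for p
        unfolding span_EV_def
      proof (intro CollectI allI impI)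
        fix i assume i: "i < N"
        have "\<not> (active \<kappa> p \<and> active \<mu> (p - (r + 1)) \<and> Suc i = vert \<kappa> p \<and> Suc i = vert \<mu> (p - (r + 1)))"
          using vert_int[of \<kappa> p] vert_int[of \<mu> "p - (r + 1)"] U by auto
        then have "y p (eX i) = 0" "\<delta> w p (eX i) = 0" using peirce_coord(2)[OF y[of p] i] peirce_coord(2)[OF \<delta>Y[OF wY, of p] i] by blast+
        moreover have "y p (eU i) = \<delta> w p (eU i)"
        proof (cases "active \<kappa> p \<and> active \<mu> (p - (r + 1)) \<and> i = vert \<kappa> p")
          case True
          then have "vert \<kappa> (p - 1) = Suc i" by (auto simp: vert_def active_def)
          then have "w (p - 1) (eE (Suc i)) = \<alpha> (p - 1)" using wE[of "p - 1"] by simp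
          moreover have "max 0 (r + 1) \<le> p" "p \<le> int (idx \<mu>) + r" using True U by (auto simp: active_def)
          ultimately show ?thesis using \<alpha>(1)[of p] wE[of p] True unfolding \<delta>U[OF i] vv by (simp add: mult_ac)
        next
          case False
          then show ?thesis using peirce_coord(1)[OF y[of p] i] peirce_coord(1)[OF \<delta>Y[OF wY, of p] i] by metis
        qed
        ultimately show "(y p - \<delta> w p) (eX i) = 0 \<and> (y p - \<delta> w p) (eU i) = 0" by simp
      qed
      then show ?thesis using wY by blast
    next
      case X
      obtain \<alpha> where \<alpha>: "\<And>p. max 0 (r + 1) \<le> p \<Longrightarrow> p \<le> int (idx \<mu>) + r \<Longrightarrow>
          (?s * dcoeff \<mu> (p - r) (eU (vert \<mu> (p - r)))) * \<alpha> p - dcoeff \<kappa> p (eU (vert \<kappa> p)) * \<alpha> (p - 1) = y p (eX (vert \<mu> (p - r)))"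
        "\<And>p. p < max 0 r \<or> int (idx \<mu>) + r < p \<Longrightarrow> \<alpha> p = 0"
        using recursion_solution[of \<kappa> \<mu> r ?s "\<lambda>p. y p (eX (vert \<mu> (p - r)))"] w X by auto
      define w where "w p = (if active \<kappa> p \<and> active \<mu> (p - r) then scl (\<alpha> p) (bV (vert \<mu> (p - r))) else 0)" for p
      have vv: "vert \<kappa> p = Suc (vert \<mu> (p - r))" if "active \<mu> (p - r)" for p using X that by (auto simp: vert_def active_def)
      have wY: "w p \<in> peirce \<kappa> p \<mu> (p - r)" for p
        using vv[of p] vert_le[of \<kappa> p] bE_bV[of "vert \<mu> (p - r)"] by (auto simp: w_def peirce_def gen_idem_def)
      have wV: "w p (eV (vert \<mu> (p - r))) = \<alpha> p" for p
        using \<alpha>(2)[of p] w X by (auto simp: w_def bV_apply active_def)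
      have "y p - \<delta> w p \<in> span_EV" for p
        unfolding span_EV_def
      proof (intro CollectI allI impI)
        fix i assume i: "i < N"
        have "\<not> (active \<kappa> p \<and> active \<mu> (p - (r + 1)) \<and> i = vert \<kappa> p \<and> Suc i = vert \<mu> (p - (r + 1)))"
          using vert_int[of \<kappa> p] vert_int[of \<mu> "p - (r + 1)"] X by auto
        then have "y p (eU i) = 0" "\<delta> w p (eU i) = 0" using peirce_coord(1)[OF y[of p] i] peirce_coord(1)[OF \<delta>Y[OF wY, of p] i] by blast+
        moreover have "y p (eX i) = \<delta> w p (eX i)"
        proof (cases "active \<kappa> p \<and> active \<mu> (p - (r + 1)) \<and> Suc i = vert \<kappa> p")
          case True
          have v1: "vert \<mu> (p - r) = i" using True X by (auto simp: vert_def active_def)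
          have v2: "vert \<mu> (p - 1 - r) = Suc i" using True X by (auto simp: vert_def active_def)
          have 1: "w (p - 1) (eV (Suc i)) = \<alpha> (p - 1)" using wV[of "p - 1"] unfolding v2 .
          \<comment> \<open>For \<open>Suc i = N\<close> the summand from
            \<open>u_(i+1) v_(i+1)\<close> is missing in the product. In that case
            \<open>vert \<kappa> p = N\<close>, which is possible only for \<open>p = 0\<close>,
            where the differential is 0, so the recursion has no such term either.\<close>
          have 2: "dcoeff \<kappa> p (eU (vert \<kappa> p)) * \<alpha> (p - 1) = (if Suc i < N then dcoeff \<kappa> p (eU (Suc i)) * w (p - 1) (eV (Suc i)) else 0)"
          proof (cases "Suc i < N")
            case False
            then have "int (idx \<kappa>) - p \<ge> int N" using True i vert_int[of \<kappa> p] by simp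
            then have "dcoeff \<kappa> p = 0" using ws_idx[of \<kappa>] w True by (intro dcoeff_zero) (auto simp: active_def)
            then show ?thesis using False by simp
          qed (use 1 True in simp)
          have "max 0 (r + 1) \<le> p" "p \<le> int (idx \<mu>) + r" using True X by (auto simp: active_def vert_def)
          then show ?thesis using \<alpha>(1)[of p] wV[of p] 2 unfolding \<delta>X[OF i] v1 by (simp add: mult_ac)
        next
          case False
          then show ?thesis using peirce_coord(2)[OF y[of p] i] peirce_coord(2)[OF \<delta>Y[OF wY, of p] i] by metis
        qed
        ultimately show "(y p - \<delta> w p) (eX i) = 0 \<and> (y p - \<delta> w p) (eU i) = 0" by simp
      qed
      then show ?thesis using wY by blast
    qed
  qed
qed

text \<open>The differential does not mix components with different \<open>\<kappa>\<close> or
  \<open>\<mu>\<close>, so the solutions of \<open>bounding_component\<close> are chosen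
  independently and put together.\<close>

lemma bounding:
  assumes y: "y \<in> coords (r + 1)"
  shows "\<exists>w \<in> coords r. \<forall>i. (y - ydiff r w) i \<in> span_EV"
proof -
  have ex: "\<exists>w. (\<forall>p. w p \<in> peirce \<kappa> p \<mu> (p - r)) \<and>
    (\<forall>p. y (\<kappa>, \<mu>, p) - (scl ((-1) powi r) (w p \<star> dcoeff \<mu> (p - r)) - dcoeff \<kappa> p \<star> w (p - 1)) \<in> span_EV)" for \<kappa> \<mu>
    by (rule bounding_component) (rule coords_D[OF y])
  define w where "w \<kappa> \<mu> = (SOME w. (\<forall>p. w p \<in> peirce \<kappa> p \<mu> (p - r)) \<and>
    (\<forall>p. y (\<kappa>, \<mu>, p) - (scl ((-1) powi r) (w p \<star> dcoeff \<mu> (p - r)) - dcoeff \<kappa> p \<star> w (p - 1)) \<in> span_EV))" for \<kappa> \<mu>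
  have w: "w \<kappa> \<mu> p \<in> peirce \<kappa> p \<mu> (p - r)"
    "y (\<kappa>, \<mu>, p) - (scl ((-1) powi r) (w \<kappa> \<mu> p \<star> dcoeff \<mu> (p - r)) - dcoeff \<kappa> p \<star> w \<kappa> \<mu> (p - 1)) \<in> span_EV" for \<kappa> \<mu> p
    using someI_ex[OF ex[of \<kappa> \<mu>]] unfolding w_def by blast+
  show ?thesis
  proof (rule bexI[of _ "\<lambda>(\<kappa>, \<mu>, p). w \<kappa> \<mu> p"])
    show "(\<lambda>(\<kappa>, \<mu>, p). w \<kappa> \<mu> p) \<in> coords r" using w(1) by (simp add: coords_def)
    show "\<forall>i. (y - ydiff r (\<lambda>(\<kappa>, \<mu>, p). w \<kappa> \<mu> p)) i \<in> span_EV" using w(2) by (auto simp: ydiff_apply)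
  qed
qed

text \<open>The factor \<open>dcoeff\<close> has no \<open>e\<close>, \<open>x\<close> or
  \<open>v\<close> coordinates, so a coboundary has no \<open>e\<close> and no \<open>v\<close>
  coordinates. Being in \<open>span_EV\<close> removes the \<open>u\<close> and \<open>x\<close>
  coordinates as well.\<close>

lemma ydiff_span_EV:
  assumes "w \<in> coords r" "\<And>i. ydiff r w i \<in> span_EV"
  shows "ydiff r w = 0"
proof
  fix i :: "weight \<times> weight \<times> int"
  obtain \<kappa> \<mu> p where i: "i = (\<kappa>, \<mu>, p)" by (metis surj_pair)
  have "ydiff r w i (eE j) = 0" if "j \<le> N" for j unfolding i ydiff_apply using that by (simp add: kmul_E dcoeff_coord)
  moreover have "ydiff r w i (eV j) = 0" if "j < N" for j unfolding i ydiff_apply using that by (simp add: kmul_V dcoeff_coord)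
  moreover have "ydiff r w i b = 0" if "b \<notin> diags" for b unfolding i ydiff_apply using that by (simp add: kmul_outside)
  ultimately show "ydiff r w i = 0 i" using assms(2)[of i] by (intro kvec_eqI) (auto simp: span_EV_def)
qed

text \<open>The cocycle condition is imposed separately: the scalars at the \<open>e_i\<close> or
  \<open>v_i\<close> along a resolution satisfy it only if they solve the homogeneous
  recursion.\<close>

definition reps :: "int \<Rightarrow> endo set" where "reps r = of_coords r ` {y \<in> coords r. ydiff r y = 0 \<and> (\<forall>i. y i \<in> span_EV)}"

lemma reps_I: "y \<in> coords r \<Longrightarrow> ydiff r y = 0 \<Longrightarrow> (\<And>i. y i \<in> span_EV) \<Longrightarrow> of_coords r y \<in> reps r"
  by (auto simp: reps_def)

lemma reps_E:
  assumes "f \<in> reps r"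
  obtains y where "y \<in> coords r" "ydiff r y = 0" "\<forall>i. y i \<in> span_EV" "f = of_coords r y"
  using assms by (auto simp: reps_def)

lemma dg_formal_A: "dg_formal As dA mA reps"
proof (rule dg_formal.intro[OF dg_algebra_A], rule dg_formal_axioms.intro)
  show "x \<in> carrier (As d)" if "x \<in> reps d" for x d using that by (elim reps_E) (simp add: of_coords_closed)
  show "x \<oplus>\<^bsub>As d\<^esub> y \<in> reps d" if "x \<in> reps d" "y \<in> reps d" for x d y
    using that by (elim reps_E) (auto simp: of_coords_add ydiff_add intro!: reps_I coords_add span_EV_add)
  show "c \<odot>\<^bsub>As d\<^esub> x \<in> reps d" if "x \<in> reps d" for x d c
  proof -
    obtain y where y: "y \<in> coords d" "ydiff d y = 0" "\<forall>i. y i \<in> span_EV" "x = of_coords d y" using \<open>x \<in> reps d\<close> by (rule reps_E)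
    have "ydiff d (scl_coords c y) = 0" unfolding ydiff_scl_coords y(2) by (rule ext) (simp add: scl_coords_def)
    moreover have "scl_coords c y i \<in> span_EV" for i unfolding scl_coords_def by (intro span_EV_scl y(3)[rule_format])
    ultimately show ?thesis unfolding y(4) of_coords_smult[OF y(1)] by (intro reps_I coords_scl_coords y(1))
  qed
  show "\<zero>\<^bsub>As d\<^esub> \<in> reps d" for d
    unfolding of_coords_zero by (rule reps_I[OF coords_zero]) (auto simp: ydiff_def span_EV_zero fun_eq_iff)
  show "mA d x e y \<in> reps (d + e)" if "x \<in> reps d" "y \<in> reps e" for x d y e
  proof -
    obtain v where v: "v \<in> coords d" "ydiff d v = 0" "\<forall>i. v i \<in> span_EV" "x = of_coords d v" using \<open>x \<in> reps d\<close> by (rule reps_E)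
    obtain w where w: "w \<in> coords e" "ydiff e w = 0" "\<forall>i. w i \<in> span_EV" "y = of_coords e w" using \<open>y \<in> reps e\<close> by (rule reps_E)
    have "ydiff (d + e) (ymul d v w) = 0"
      unfolding ydiff_ymul v(2) w(2) by (rule ext) (auto simp: ymul_def scl_coords_def split_beta)
    moreover have "ymul d v w i \<in> span_EV" for i
      using v(3) w(3) by (auto simp: ymul_def split_beta intro!: span_EV_sum span_EV_mul)
    ultimately show ?thesis unfolding v(4) w(4) mA_of_coords[OF v(1) w(1)] by (intro reps_I ymul_coords v(1) w(1))
  qed
  show "dA d x = \<zero>\<^bsub>As (d + 1)\<^esub>" if "x \<in> reps d" for x d
    using that by (elim reps_E) (simp only: dA_of_coords of_coords_zero)
  show "\<exists>c \<in> reps (d + 1). \<exists>w \<in> carrier (As d). x = dA d w \<oplus>\<^bsub>As (d + 1)\<^esub> c"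
    if "x \<in> carrier (As (d + 1))" "dA (d + 1) x = \<zero>\<^bsub>As (d + 1 + 1)\<^esub>" for x d
  proof -
    obtain y where y: "y \<in> coords (d + 1)" "x = of_coords (d + 1) y" using \<open>x \<in> carrier (As (d + 1))\<close> by (rule As_E)
    have "of_coords (d + 1 + 1) (ydiff (d + 1) y) = of_coords (d + 1 + 1) 0"
      using that(2) unfolding y(2) dA_of_coords[OF y(1)] of_coords_zero .
    then have dy: "ydiff (d + 1) y = 0" using of_coords_inject[OF ydiff_coords[OF y(1)] coords_zero] by blast
    obtain w where w: "w \<in> coords d" "\<forall>i. (y - ydiff d w) i \<in> span_EV" using bounding[OF y(1)] by blast
    let ?c = "y - ydiff d w"
    have e: "?c = y + scl_coords (-1) (ydiff d w)" by (rule ext) (simp add: scl_coords_def fun_eq_iff)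
    have c: "?c \<in> coords (d + 1)" unfolding e by (intro coords_add coords_scl_coords y(1) ydiff_coords w(1))
    have "ydiff (d + 1) ?c = 0"
      unfolding e ydiff_add ydiff_scl_coords ydiff_ydiff dy by (rule ext) (simp add: scl_coords_def)
    then have "of_coords (d + 1) ?c \<in> reps (d + 1)" using c w(2) by (intro reps_I) auto
    moreover have "x = dA d (of_coords d w) \<oplus>\<^bsub>As (d + 1)\<^esub> of_coords (d + 1) ?c"
      unfolding y(2) dA_of_coords[OF w(1)] of_coords_add[OF ydiff_coords[OF w(1)] c] by simp
    ultimately show ?thesis using of_coords_closed[OF w(1)] by blast
  qed
  show "dA d w = \<zero>\<^bsub>As (d + 1)\<^esub>" if "w \<in> carrier (As d)" "dA d w \<in> reps (d + 1)" for w d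
  proof -
    obtain v where v: "v \<in> coords d" "w = of_coords d v" using \<open>w \<in> carrier (As d)\<close> by (rule As_E)
    obtain y where y: "y \<in> coords (d + 1)" "\<forall>i. y i \<in> span_EV" "of_coords (d + 1) (ydiff d v) = of_coords (d + 1) y"
      using \<open>dA d w \<in> reps (d + 1)\<close> unfolding v(2) dA_of_coords[OF v(1)] by (rule reps_E) blast
    then have "ydiff d v = y" using of_coords_inject[OF ydiff_coords[OF v(1)]] by blast
    then have "ydiff d v = 0" using ydiff_span_EV[OF v(1)] y(2) by simp
    then show ?thesis unfolding v(2) dA_of_coords[OF v(1)] of_coords_zero by simp
  qed
qed

end

theorem theorem6p7:
  fixes N :: nat
    and W :: "weight \<Rightarrow> int \<Rightarrow> weight list"
    and D :: "weight \<Rightarrow> int \<Rightarrow> (nat \<Rightarrow> kvec) \<Rightarrow> (nat \<Rightarrow> kvec)"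
  assumes "N \<ge> 1"
    and "\<forall>\<kappa> \<in> weights N 1. linear_resolution N 1 \<kappa> (W \<kappa>) (D \<kappa>)"
  defines "A \<equiv> endo_space N 1 W"
    and "mA \<equiv> endo_operations N 1 W D"
  defines "E \<equiv> cohomology A mA"
  shows "\<exists>m f. minimal_model A mA m f \<and>
    (\<forall>z \<in> tensors E. length z \<ge> 3 \<longrightarrow> m z = \<zero>\<^bsub>E (tensor_degree z + 2 - int (length z))\<^esub>)"
proof -
  interpret res: resolutions N W D
    using assms(2) by (rule resolutions.intro)
  have A: "res.As = A" unfolding A_def by (rule ext) (rule res.As_def)
  have ops: "dg_operations res.As res.dA res.mA = mA"
    unfolding mA_def endo_operations_def res.dA_def res.mA_def A[unfolded A_def] ..
  show ?thesis using dg_formal.minimal_model_exists[OF res.dg_formal_A] unfolding A ops[unfolded A] E_def .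
qed

end
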